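(* Let $G$ be a countable discrete group, $E$ a row-finite graph with no sources, $\sigma$ an action of $G$ on $E$ (written $g\cdot x=\sigma_g(x)$), and $\phi:G\times E^1\to G$ a one-cocycle for the restriction of $\sigma$ to $E^1$ such that $\phi(g,e)\cdot v=g\cdot v$ for all $g\in G$, $e\in E^1$, $v\in E^0$. Let $K$ be a field (with the trivial involution). Suppose that for every $g\in G$ and every $v\in E^0$, there are at most finitely many minimal strongly fixed paths for $g$ with range $v$. The following holds: (1) If $E^0$ is infinite and the Exel-Pardo algebra $L_K(G,E)$ is simple, then $[L_K(G, E), L_K(G, E)]$ is a simple Lie $K$-algebra. (2) If $E^0$ is finite and $L_K(G,E)$ is a nontrivial simple Exel-Pardo algebra, then the Lie $K$-algebra $[L_K(G, E), L_K(G, E)]$ is simple if and only if $1_{L_K(G, E)}\notin [L_K(G, E), L_K(G, E)]$.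
   Context: A (directed) graph $E=(E^0,E^1,r,s)$ consists of disjoint sets $E^0$ (vertices) and $E^1$ (edges) and maps $s,r:E^1\to E^0$. It is row-finite if $|r^{-1}(v)|<\infty$ for all $v\in E^0$; a source is a vertex $v$ with $r^{-1}(v)=\varnothing$. A path of length $n\ge 1$ is a sequence $p=e_1\cdots e_n$ of edges with $s(e_i)=r(e_{i+1})$; $s(p)=s(e_n)$, $r(p)=r(e_1)$; vertices are paths of length $0$; $E^*$ is the set of all paths. The prefixes of $p$ are $r(p)$ and $e_1\cdots e_i$, $1\le i\le n$. An automorphism of $E$ is a bijection $\sigma$ of $E^0\sqcup E^1$ with $\sigma(E^i)=E^i$ $(i=0,1)$, $r\circ\sigma=\sigma\circ r$, $s\circ\sigma=\sigma\circ s$. An action of $G$ on $E$ is a group homomorphism $g\mapsto\sigma_g$ from $G$ to the automorphism group of $E$. A one-cocycle for the restricted action on $E^1$ is a map $\phi:G\times E^1\to G$ with $\phi(gh,e)=\phi(g,h\cdot e)\phi(h,e)$ for all $g,h\in G$, $e\in E^1$. $e_G$ denotes the unit of $G$. The action and cocycle extend to $E^*$ by $\phi(g,v)=g$ for $v\in E^0$, $g\cdot(e\alpha)=(g\cdot e)(\phi(g,e)\cdot\alpha)$ and $\phi(g,e\alpha)=\phi(\phi(g,e),\alpha)$ for $e\in E^1$, $\alpha\in E^*$ with $s(e)=r(\alpha)$. A path $\alpha\in E^*$ is strongly fixed by $g\in G$ if $g\cdot\alpha=\alpha$ and $\phi(g,\alpha)=e_G$; if in addition no proper prefix of $\alpha$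 is strongly fixed by $g$, then $\alpha$ is a minimal strongly fixed path for $g$. The Exel-Pardo algebra $L_K(G,E)$ is the $*$-algebra over $K$ (not necessarily unital, with $K$-linear involution) generated by $\{P_{v,f}\mid v\in E^0,f\in G\}\cup\{S_{e,g}\mid e\in E^1,g\in G\}$ subject to ($\delta$ the Kronecker delta): (a) writing $p_v=P_{v,e_G}$ and $s_e=S_{e,e_G}$: $p_vp_w=\delta_{v,w}p_w$; $p_{r(e)}s_e=s_e=s_ep_{s(e)}$ and $p_{s(e)}s_e^*=s_e^*=s_e^*p_{r(e)}$; $s_e^*s_f=\delta_{e,f}p_{s(e)}$; $p_v=\sum_{e\in r^{-1}(v)}s_es_e^*$ for every $v$ with $0<|r^{-1}(v)|<\infty$; (b) $(P_{v,f})^*=P_{f^{-1}\cdot v,f^{-1}}$; (c) $P_{v,f}P_{w,h}=\delta_{v,f\cdot w}P_{v,fh}$; (d) $P_{v,f}S_{e,g}=\delta_{v,r(f\cdot e)}S_{f\cdot e,\phi(f,e)g}$; (e) $S_{e,g}P_{v,f}=\delta_{g\cdot v,s(e)}S_{e,gf}$. When $E^0$ is finite, $1_{L_K(G,E)}=\sum_{v\in E^0}P_{v,e_G}$ is the identity. A simple Exel-Pardo algebra $L_K(G,E)$ is nontrivial if $L_K(G,E)\not\cong K$. For an associative $K$-algebra $R$ (not necessarily unital), $[R,R]$ is the $K$-span of all commutators $[x,y]=xy-yx$, $x,y\in R$; it is a Lie $K$-algebra under $[x,y]=xy-yx$. A Lie $K$-algebra $L$ is simple if $[L,L]\neq 0$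 and its only Lie ideals ($K$-subspaces $I$ with $[L,I]\subseteq I$) are $0$ and $L$. *)

theory Defs
  imports
    "HOL-Algebra.Module"
    "HOL-Algebra.Group_Action"
    "HOL-Library.Countable_Set"
    "Graph_Theory.Digraph"
begin

section \<open>Associative algebras and Lie algebras over a commutative ring\<close>

text \<open>
  Associative algebras are not assumed to be unital. They are carried by the record
  \<^type>\<open>module\<close>; its field \<^const>\<open>one\<close> is not constrained here.
\<close>

locale assoc_algebra = Module.module K A for K (structure) and A (structure) +
  assumes mult_closed: "\<lbrakk>x \<in> carrier A; y \<in> carrier A\<rbrakk> \<Longrightarrow> x \<otimes>\<^bsub>A\<^esub> y \<in> carrier A"
    and mult_assoc: "\<lbrakk>x \<in> carrier A; y \<in> carrier A; z \<in> carrier A\<rbrakk> \<Longrightarrow>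
      (x \<otimes>\<^bsub>A\<^esub> y) \<otimes>\<^bsub>A\<^esub> z = x \<otimes>\<^bsub>A\<^esub> (y \<otimes>\<^bsub>A\<^esub> z)"
    and mult_l_distr: "\<lbrakk>x \<in> carrier A; y \<in> carrier A; z \<in> carrier A\<rbrakk> \<Longrightarrow>
      (x \<oplus>\<^bsub>A\<^esub> y) \<otimes>\<^bsub>A\<^esub> z = x \<otimes>\<^bsub>A\<^esub> z \<oplus>\<^bsub>A\<^esub> y \<otimes>\<^bsub>A\<^esub> z"
    and mult_r_distr: "\<lbrakk>x \<in> carrier A; y \<in> carrier A; z \<in> carrier A\<rbrakk> \<Longrightarrow>
      z \<otimes>\<^bsub>A\<^esub> (x \<oplus>\<^bsub>A\<^esub> y) = z \<otimes>\<^bsub>A\<^esub> x \<oplus>\<^bsub>A\<^esub> z \<otimes>\<^bsub>A\<^esub> y"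
    and smult_mult_l: "\<lbrakk>c \<in> carrier K; x \<in> carrier A; y \<in> carrier A\<rbrakk> \<Longrightarrow>
      (c \<odot>\<^bsub>A\<^esub> x) \<otimes>\<^bsub>A\<^esub> y = c \<odot>\<^bsub>A\<^esub> (x \<otimes>\<^bsub>A\<^esub> y)"
    and smult_mult_r: "\<lbrakk>c \<in> carrier K; x \<in> carrier A; y \<in> carrier A\<rbrakk> \<Longrightarrow>
      x \<otimes>\<^bsub>A\<^esub> (c \<odot>\<^bsub>A\<^esub> y) = c \<odot>\<^bsub>A\<^esub> (x \<otimes>\<^bsub>A\<^esub> y)"

definition algebra_ideal ::
  "('k, 'm) ring_scheme \<Rightarrow> ('k, 'a, 'n) module_scheme \<Rightarrow> 'a set \<Rightarrow> bool" where
  "algebra_ideal K A I \<longleftrightarrow> submodule I K A \<and>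
     (\<forall>x\<in>carrier A. \<forall>a\<in>I. x \<otimes>\<^bsub>A\<^esub> a \<in> I \<and> a \<otimes>\<^bsub>A\<^esub> x \<in> I)"

locale simple_algebra = assoc_algebra K A for K (structure) and A (structure) +
  assumes mult_nontrivial: "\<exists>x\<in>carrier A. \<exists>y\<in>carrier A. x \<otimes>\<^bsub>A\<^esub> y \<noteq> \<zero>\<^bsub>A\<^esub>"
    and ideal_trivial: "algebra_ideal K A I \<Longrightarrow> I = {\<zero>\<^bsub>A\<^esub>} \<or> I = carrier A"

definition algebra_isomorphic ::
  "('k, 'm) ring_scheme \<Rightarrow> ('k, 'a, 'n) module_scheme \<Rightarrow> ('k, 'b, 'o) module_scheme \<Rightarrow> bool" where
  "algebra_isomorphic K A B \<longleftrightarrow> (\<exists>h. bij_betw h (carrier A) (carrier B) \<and>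
     (\<forall>x\<in>carrier A. \<forall>y\<in>carrier A. h (x \<oplus>\<^bsub>A\<^esub> y) = h x \<oplus>\<^bsub>B\<^esub> h y) \<and>
     (\<forall>x\<in>carrier A. \<forall>y\<in>carrier A. h (x \<otimes>\<^bsub>A\<^esub> y) = h x \<otimes>\<^bsub>B\<^esub> h y) \<and>
     (\<forall>c\<in>carrier K. \<forall>x\<in>carrier A. h (c \<odot>\<^bsub>A\<^esub> x) = c \<odot>\<^bsub>B\<^esub> h x))"

text \<open>The base ring as an algebra over itself.\<close>

definition self_algebra :: "('k, 'm) ring_scheme \<Rightarrow> ('k, 'k) module" where
  "self_algebra K = \<lparr>carrier = carrier K, mult = mult K, one = one K, zero = zero K,
     add = add K, smult = mult K\<rparr>"

definition linear_span ::
  "('k, 'm) ring_scheme \<Rightarrow> ('k, 'a, 'n) module_scheme \<Rightarrow> 'a set \<Rightarrow> 'a set" where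
  "linear_span K M S = \<Inter>{N. submodule N K M \<and> S \<subseteq> N}"

locale lie_algebra = Module.module K M for K (structure) and M (structure) +
  fixes bracket :: "'c \<Rightarrow> 'c \<Rightarrow> 'c"
  assumes bracket_closed: "\<lbrakk>x \<in> carrier M; y \<in> carrier M\<rbrakk> \<Longrightarrow> bracket x y \<in> carrier M"
    and bracket_add_l: "\<lbrakk>x \<in> carrier M; y \<in> carrier M; z \<in> carrier M\<rbrakk> \<Longrightarrow>
      bracket (x \<oplus>\<^bsub>M\<^esub> y) z = bracket x z \<oplus>\<^bsub>M\<^esub> bracket y z"
    and bracket_add_r: "\<lbrakk>x \<in> carrier M; y \<in> carrier M; z \<in> carrier M\<rbrakk> \<Longrightarrow>
      bracket z (x \<oplus>\<^bsub>M\<^esub> y) = bracket z x \<oplus>\<^bsub>M\<^esub> bracket z y"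
    and bracket_smult_l: "\<lbrakk>c \<in> carrier K; x \<in> carrier M; y \<in> carrier M\<rbrakk> \<Longrightarrow>
      bracket (c \<odot>\<^bsub>M\<^esub> x) y = c \<odot>\<^bsub>M\<^esub> bracket x y"
    and bracket_smult_r: "\<lbrakk>c \<in> carrier K; x \<in> carrier M; y \<in> carrier M\<rbrakk> \<Longrightarrow>
      bracket x (c \<odot>\<^bsub>M\<^esub> y) = c \<odot>\<^bsub>M\<^esub> bracket x y"
    and bracket_self: "x \<in> carrier M \<Longrightarrow> bracket x x = \<zero>\<^bsub>M\<^esub>"
    and jacobi: "\<lbrakk>x \<in> carrier M; y \<in> carrier M; z \<in> carrier M\<rbrakk> \<Longrightarrow>
      bracket x (bracket y z) \<oplus>\<^bsub>M\<^esub> bracket y (bracket z x) \<oplus>\<^bsub>M\<^esub> bracket z (bracket x y) = \<zero>\<^bsub>M\<^esub>"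

definition lie_ideal ::
  "('k, 'm) ring_scheme \<Rightarrow> ('k, 'a, 'n) module_scheme \<Rightarrow> ('a \<Rightarrow> 'a \<Rightarrow> 'a) \<Rightarrow> 'a set \<Rightarrow> bool" where
  "lie_ideal K M bracket I \<longleftrightarrow>
     submodule I K M \<and> (\<forall>x\<in>carrier M. \<forall>a\<in>I. bracket x a \<in> I)"

locale simple_lie_algebra = lie_algebra K M bracket
  for K (structure) and M (structure) and bracket +
  assumes derived_nontrivial:
      "linear_span K M {bracket x y | x y. x \<in> carrier M \<and> y \<in> carrier M} \<noteq> {\<zero>\<^bsub>M\<^esub>}"
    and lie_ideal_trivial: "lie_ideal K M bracket I \<Longrightarrow> I = {\<zero>\<^bsub>M\<^esub>} \<or> I = carrier M"

definition commutator :: "('k, 'a, 'n) module_scheme \<Rightarrow> 'a \<Rightarrow> 'a \<Rightarrow> 'a" where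
  "commutator A x y = x \<otimes>\<^bsub>A\<^esub> y \<ominus>\<^bsub>A\<^esub> y \<otimes>\<^bsub>A\<^esub> x"

definition commutator_space ::
  "('k, 'm) ring_scheme \<Rightarrow> ('k, 'a, 'n) module_scheme \<Rightarrow> 'a set" where
  "commutator_space K A =
     linear_span K A {commutator A x y | x y. x \<in> carrier A \<and> y \<in> carrier A}"


section \<open>Presentations of $*$-algebras by generators and relations\<close>

text \<open>
  The $*$-algebra over \<open>K\<close> (with trivial involution on \<open>K\<close>) on generators \<open>X\<close> subject to
  relations \<open>R\<close> is the algebra of all terms over \<open>X\<close> modulo the least congruence that
  contains \<open>R\<close> and all instances of the axioms of a (not necessarily unital) $*$-algebra.
\<close>

datatype ('k, 'x) star_term =
    Gen 'x
  | Null
  | Sum "('k, 'x) star_term" "('k, 'x) star_term" (infixl \<open>\<^bold>+\<close> 65)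
  | Neg "('k, 'x) star_term"
  | Prod "('k, 'x) star_term" "('k, 'x) star_term" (infixl \<open>\<^bold>*\<close> 70)
  | Scale 'k "('k, 'x) star_term" (infixr \<open>\<^bold>\<cdot>\<close> 75)
  | Star "('k, 'x) star_term" (\<open>_\<^sup>\<star>\<close> [999] 999)

inductive_set star_terms :: "('k, 'm) ring_scheme \<Rightarrow> 'x set \<Rightarrow> ('k, 'x) star_term set"
  for K :: "('k, 'm) ring_scheme" and X :: "'x set" where
  "x \<in> X \<Longrightarrow> Gen x \<in> star_terms K X"
| "Null \<in> star_terms K X"
| "\<lbrakk>s \<in> star_terms K X; t \<in> star_terms K X\<rbrakk> \<Longrightarrow> s \<^bold>+ t \<in> star_terms K X"
| "t \<in> star_terms K X \<Longrightarrow> Neg t \<in> star_terms K X"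
| "\<lbrakk>s \<in> star_terms K X; t \<in> star_terms K X\<rbrakk> \<Longrightarrow> s \<^bold>* t \<in> star_terms K X"
| "\<lbrakk>c \<in> carrier K; t \<in> star_terms K X\<rbrakk> \<Longrightarrow> c \<^bold>\<cdot> t \<in> star_terms K X"
| "t \<in> star_terms K X \<Longrightarrow> t\<^sup>\<star> \<in> star_terms K X"

inductive star_eq ::
  "('k, 'm) ring_scheme \<Rightarrow> 'x set \<Rightarrow> (('k, 'x) star_term \<times> ('k, 'x) star_term) set \<Rightarrow>
   ('k, 'x) star_term \<Rightarrow> ('k, 'x) star_term \<Rightarrow> bool"
  for K :: "('k, 'm) ring_scheme" and X :: "'x set"
    and R :: "(('k, 'x) star_term \<times> ('k, 'x) star_term) set" where
  relation: "\<lbrakk>(s, t) \<in> R; s \<in> star_terms K X; t \<in> star_terms K X\<rbrakk> \<Longrightarrow> star_eq K X R s t"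
| refl: "t \<in> star_terms K X \<Longrightarrow> star_eq K X R t t"
| sym: "star_eq K X R s t \<Longrightarrow> star_eq K X R t s"
| trans: "\<lbrakk>star_eq K X R s t; star_eq K X R t u\<rbrakk> \<Longrightarrow> star_eq K X R s u"
| cong_sum: "\<lbrakk>star_eq K X R s s'; star_eq K X R t t'\<rbrakk> \<Longrightarrow> star_eq K X R (s \<^bold>+ t) (s' \<^bold>+ t')"
| cong_neg: "star_eq K X R t t' \<Longrightarrow> star_eq K X R (Neg t) (Neg t')"
| cong_prod: "\<lbrakk>star_eq K X R s s'; star_eq K X R t t'\<rbrakk> \<Longrightarrow> star_eq K X R (s \<^bold>* t) (s' \<^bold>* t')"
| cong_scale: "\<lbrakk>c \<in> carrier K; star_eq K X R t t'\<rbrakk> \<Longrightarrow> star_eq K X R (c \<^bold>\<cdot> t) (c \<^bold>\<cdot> t')"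
| cong_star: "star_eq K X R t t' \<Longrightarrow> star_eq K X R (t\<^sup>\<star>) (t'\<^sup>\<star>)"
| sum_assoc: "\<lbrakk>s \<in> star_terms K X; t \<in> star_terms K X; u \<in> star_terms K X\<rbrakk> \<Longrightarrow>
    star_eq K X R (s \<^bold>+ t \<^bold>+ u) (s \<^bold>+ (t \<^bold>+ u))"
| sum_comm: "\<lbrakk>s \<in> star_terms K X; t \<in> star_terms K X\<rbrakk> \<Longrightarrow> star_eq K X R (s \<^bold>+ t) (t \<^bold>+ s)"
| sum_null: "t \<in> star_terms K X \<Longrightarrow> star_eq K X R (Null \<^bold>+ t) t"
| sum_neg: "t \<in> star_terms K X \<Longrightarrow> star_eq K X R (Neg t \<^bold>+ t) Null"
| prod_assoc: "\<lbrakk>s \<in> star_terms K X; t \<in> star_terms K X; u \<in> star_terms K X\<rbrakk> \<Longrightarrow>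
    star_eq K X R (s \<^bold>* t \<^bold>* u) (s \<^bold>* (t \<^bold>* u))"
| distrib_l: "\<lbrakk>s \<in> star_terms K X; t \<in> star_terms K X; u \<in> star_terms K X\<rbrakk> \<Longrightarrow>
    star_eq K X R ((s \<^bold>+ t) \<^bold>* u) (s \<^bold>* u \<^bold>+ t \<^bold>* u)"
| distrib_r: "\<lbrakk>s \<in> star_terms K X; t \<in> star_terms K X; u \<in> star_terms K X\<rbrakk> \<Longrightarrow>
    star_eq K X R (s \<^bold>* (t \<^bold>+ u)) (s \<^bold>* t \<^bold>+ s \<^bold>* u)"
| scale_one: "t \<in> star_terms K X \<Longrightarrow> star_eq K X R (\<one>\<^bsub>K\<^esub> \<^bold>\<cdot> t) t"
| scale_mult: "\<lbrakk>c \<in> carrier K; d \<in> carrier K; t \<in> star_terms K X\<rbrakk> \<Longrightarrow>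
    star_eq K X R ((c \<otimes>\<^bsub>K\<^esub> d) \<^bold>\<cdot> t) (c \<^bold>\<cdot> d \<^bold>\<cdot> t)"
| scale_add: "\<lbrakk>c \<in> carrier K; d \<in> carrier K; t \<in> star_terms K X\<rbrakk> \<Longrightarrow>
    star_eq K X R ((c \<oplus>\<^bsub>K\<^esub> d) \<^bold>\<cdot> t) (c \<^bold>\<cdot> t \<^bold>+ d \<^bold>\<cdot> t)"
| scale_sum: "\<lbrakk>c \<in> carrier K; s \<in> star_terms K X; t \<in> star_terms K X\<rbrakk> \<Longrightarrow>
    star_eq K X R (c \<^bold>\<cdot> (s \<^bold>+ t)) (c \<^bold>\<cdot> s \<^bold>+ c \<^bold>\<cdot> t)"
| scale_prod_l: "\<lbrakk>c \<in> carrier K; s \<in> star_terms K X; t \<in> star_terms K X\<rbrakk> \<Longrightarrow>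
    star_eq K X R ((c \<^bold>\<cdot> s) \<^bold>* t) (c \<^bold>\<cdot> (s \<^bold>* t))"
| scale_prod_r: "\<lbrakk>c \<in> carrier K; s \<in> star_terms K X; t \<in> star_terms K X\<rbrakk> \<Longrightarrow>
    star_eq K X R (s \<^bold>* (c \<^bold>\<cdot> t)) (c \<^bold>\<cdot> (s \<^bold>* t))"
| star_star: "t \<in> star_terms K X \<Longrightarrow> star_eq K X R (t\<^sup>\<star>\<^sup>\<star>) t"
| star_sum: "\<lbrakk>s \<in> star_terms K X; t \<in> star_terms K X\<rbrakk> \<Longrightarrow>
    star_eq K X R ((s \<^bold>+ t)\<^sup>\<star>) (s\<^sup>\<star> \<^bold>+ t\<^sup>\<star>)"
| star_scale: "\<lbrakk>c \<in> carrier K; t \<in> star_terms K X\<rbrakk> \<Longrightarrow>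
    star_eq K X R ((c \<^bold>\<cdot> t)\<^sup>\<star>) (c \<^bold>\<cdot> t\<^sup>\<star>)"
| star_prod: "\<lbrakk>s \<in> star_terms K X; t \<in> star_terms K X\<rbrakk> \<Longrightarrow>
    star_eq K X R ((s \<^bold>* t)\<^sup>\<star>) (t\<^sup>\<star> \<^bold>* s\<^sup>\<star>)"

definition star_rel ::
  "('k, 'm) ring_scheme \<Rightarrow> 'x set \<Rightarrow> (('k, 'x) star_term \<times> ('k, 'x) star_term) set \<Rightarrow>
   (('k, 'x) star_term \<times> ('k, 'x) star_term) set" where
  "star_rel K X R = {(s, t). star_eq K X R s t}"

record ('k, 'a) star_algebra = "('k, 'a) module" +
  involution :: "'a \<Rightarrow> 'a"

text \<open>
  A presented algebra has no unit in general, so its field \<^const>\<open>one\<close> is left unspecified.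
\<close>

definition presented_algebra ::
  "('k, 'm) ring_scheme \<Rightarrow> 'x set \<Rightarrow> (('k, 'x) star_term \<times> ('k, 'x) star_term) set \<Rightarrow>
   ('k, ('k, 'x) star_term set) star_algebra" where
  "presented_algebra K X R =
     \<lparr>carrier = star_terms K X // star_rel K X R,
      mult = (\<lambda>A B. \<Union>s\<in>A. \<Union>t\<in>B. star_rel K X R `` {s \<^bold>* t}),
      one = undefined,
      zero = star_rel K X R `` {Null},
      add = (\<lambda>A B. \<Union>s\<in>A. \<Union>t\<in>B. star_rel K X R `` {s \<^bold>+ t}),
      smult = (\<lambda>c A. \<Union>t\<in>A. star_rel K X R `` {c \<^bold>\<cdot> t}),
      involution = (\<lambda>A. \<Union>t\<in>A. star_rel K X R `` {t\<^sup>\<star>})\<rparr>"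

lemma star_eq_terms:
  assumes "cring K" and "star_eq K X R s t"
  shows "s \<in> star_terms K X \<and> t \<in> star_terms K X"
proof -
  interpret cring K by fact
  show ?thesis using assms(2)
    by induction (auto intro!: star_terms.intros)
qed

lemma equiv_star_rel:
  assumes "cring K"
  shows "equiv (star_terms K X) (star_rel K X R)"
  using star_eq_terms[OF assms]
  by (intro equivI refl_onI symI transI)
     (auto simp: star_rel_def intro: star_eq.refl star_eq.sym star_eq.trans)

lemma presented_algebra_ops:
  assumes "cring K" "s \<in> star_terms K X" "t \<in> star_terms K X"
  shows "star_rel K X R `` {s} \<oplus>\<^bsub>presented_algebra K X R\<^esub> star_rel K X R `` {t} = star_rel K X R `` {s \<^bold>+ t}"
    and "star_rel K X R `` {s} \<otimes>\<^bsub>presented_algebra K X R\<^esub> star_rel K X R `` {t} = star_rel K X R `` {s \<^bold>* t}"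
    and "c \<in> carrier K \<Longrightarrow> c \<odot>\<^bsub>presented_algebra K X R\<^esub> star_rel K X R `` {t} = star_rel K X R `` {c \<^bold>\<cdot> t}"
    and "involution (presented_algebra K X R) (star_rel K X R `` {t}) = star_rel K X R `` {t\<^sup>\<star>}"
proof -
  note e = equiv_star_rel[OF assms(1), of X R]
  have eqc: "star_eq K X R s t \<Longrightarrow> star_rel K X R `` {s} = star_rel K X R `` {t}" for s t
    by (intro equiv_class_eq[OF e]) (simp add: star_rel_def)
  have c1: "(\<lambda>s t. star_rel K X R `` {s \<^bold>+ t}) respects2 (star_rel K X R)"
    by (intro congruent2I' eqc star_eq.cong_sum) (auto simp: star_rel_def)
  have c2: "(\<lambda>s t. star_rel K X R `` {s \<^bold>* t}) respects2 (star_rel K X R)"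
    by (intro congruent2I' eqc star_eq.cong_prod) (auto simp: star_rel_def)
  have c3: "(\<lambda>t. star_rel K X R `` {c \<^bold>\<cdot> t}) respects (star_rel K X R)" if "c \<in> carrier K"
    by (intro congruentI eqc star_eq.cong_scale that) (auto simp: star_rel_def)
  have c4: "(\<lambda>t. star_rel K X R `` {t\<^sup>\<star>}) respects (star_rel K X R)"
    by (intro congruentI eqc star_eq.cong_star) (auto simp: star_rel_def)
  show "star_rel K X R `` {s} \<oplus>\<^bsub>presented_algebra K X R\<^esub> star_rel K X R `` {t} = star_rel K X R `` {s \<^bold>+ t}"
    using UN_equiv_class2[OF e e c1 assms(2,3)] by (simp add: presented_algebra_def)
  show "star_rel K X R `` {s} \<otimes>\<^bsub>presented_algebra K X R\<^esub> star_rel K X R `` {t} = star_rel K X R `` {s \<^bold>* t}"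
    using UN_equiv_class2[OF e e c2 assms(2,3)] by (simp add: presented_algebra_def)
  show "c \<odot>\<^bsub>presented_algebra K X R\<^esub> star_rel K X R `` {t} = star_rel K X R `` {c \<^bold>\<cdot> t}" if "c \<in> carrier K"
    using UN_equiv_class[OF e c3[OF that] assms(3)] by (simp add: presented_algebra_def)
  show "involution (presented_algebra K X R) (star_rel K X R `` {t}) = star_rel K X R `` {t\<^sup>\<star>}"
    using UN_equiv_class[OF e c4 assms(3)] by (simp add: presented_algebra_def)
qed

lemma assoc_algebra_presented_algebra:
  assumes "cring K"
  shows "assoc_algebra K (presented_algebra K X R)"
proof -
  interpret cring K by fact
  let ?A = "presented_algebra K X R"
  define cl where "cl t = star_rel K X R `` {t}" for t
  have eqc: "star_eq K X R s t \<Longrightarrow> cl s = cl t" for s t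
    unfolding cl_def
    by (intro equiv_class_eq[OF equiv_star_rel[OF assms]]) (simp add: star_rel_def)
  have car: "carrier ?A = cl ` star_terms K X" and zer: "\<zero>\<^bsub>?A\<^esub> = cl Null"
    by (auto simp: presented_algebra_def quotient_def cl_def)
  note ops = presented_algebra_ops(1-3)[OF assms, where X = X and R = R, folded cl_def]
  have "abelian_group ?A"
  proof (rule abelian_groupI)
    fix x assume "x \<in> carrier ?A"
    then obtain t where t: "t \<in> star_terms K X" "x = cl t" by (auto simp: car)
    then have "cl (Neg t) \<in> carrier ?A" "cl (Neg t) \<oplus>\<^bsub>?A\<^esub> x = \<zero>\<^bsub>?A\<^esub>"
      by (auto simp: car ops zer star_terms.intros del: equalityI intro!: eqc star_eq.intros)
    then show "\<exists>y\<in>carrier ?A. y \<oplus>\<^bsub>?A\<^esub> x = \<zero>\<^bsub>?A\<^esub>" by blast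
  qed (auto simp: car ops zer star_terms.intros
         del: equalityI intro!: eqc star_eq.sum_assoc star_eq.sum_comm star_eq.sum_null)
  then have "Module.module K ?A"
    by (intro moduleI assms)
       (auto simp: car ops star_terms.intros
         del: equalityI intro!: eqc star_eq.scale_one star_eq.scale_mult star_eq.scale_add star_eq.scale_sum)
  then show ?thesis
    by (intro assoc_algebra.intro assoc_algebra_axioms.intro)
       (auto simp: car ops star_terms.intros del: equalityI intro!: eqc star_eq.prod_assoc star_eq.distrib_l
         star_eq.distrib_r star_eq.scale_prod_l star_eq.scale_prod_r)
qed


section \<open>Graphs, group actions, cocycles and paths\<close>

text \<open>
  Graphs are digraphs with source map \<^const>\<open>tail\<close> and range map \<^const>\<open>head\<close>, so
  the fibre of the range map over \<open>v\<close> is \<^term>\<open>in_arcs E v\<close>.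
\<close>

definition row_finite :: "('v, 'e) pre_digraph \<Rightarrow> bool" where
  "row_finite E \<longleftrightarrow> (\<forall>v\<in>verts E. finite (in_arcs E v))"

definition no_sources :: "('v, 'e) pre_digraph \<Rightarrow> bool" where
  "no_sources E \<longleftrightarrow> (\<forall>v\<in>verts E. in_arcs E v \<noteq> {})"

text \<open>
  An automorphism of a graph is given by its restrictions to vertices and edges, and
  accordingly an action by a pair \<open>\<sigma>\<^sub>0\<close>, \<open>\<sigma>\<^sub>1\<close>.
\<close>

locale graph_action =
  wf_digraph E + V: group_action G "verts E" \<sigma>\<^sub>0 + A: group_action G "arcs E" \<sigma>\<^sub>1
  for G :: "('g, 'n) monoid_scheme" and E :: "('v, 'e) pre_digraph"
    and \<sigma>\<^sub>0 :: "'g \<Rightarrow> 'v \<Rightarrow> 'v" and \<sigma>\<^sub>1 :: "'g \<Rightarrow> 'e \<Rightarrow> 'e" +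
  assumes head_equivariant:
      "\<lbrakk>g \<in> carrier G; e \<in> arcs E\<rbrakk> \<Longrightarrow> head E (\<sigma>\<^sub>1 g e) = \<sigma>\<^sub>0 g (head E e)"
    and tail_equivariant:
      "\<lbrakk>g \<in> carrier G; e \<in> arcs E\<rbrakk> \<Longrightarrow> tail E (\<sigma>\<^sub>1 g e) = \<sigma>\<^sub>0 g (tail E e)"

definition one_cocycle ::
  "('g, 'n) monoid_scheme \<Rightarrow> 'e set \<Rightarrow> ('g \<Rightarrow> 'e \<Rightarrow> 'e) \<Rightarrow> ('g \<Rightarrow> 'e \<Rightarrow> 'g) \<Rightarrow> bool" where
  "one_cocycle G S act \<phi> \<longleftrightarrow> \<phi> \<in> carrier G \<rightarrow> S \<rightarrow> carrier G \<and>
     (\<forall>g\<in>carrier G. \<forall>h\<in>carrier G. \<forall>e\<in>S. \<phi> (g \<otimes>\<^bsub>G\<^esub> h) e = \<phi> g (act h e) \<otimes>\<^bsub>G\<^esub> \<phi> h e)"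

text \<open>
  The path $e_1 \cdots e_n$ is encoded as
  \<open>Edge e\<^sub>1 (Edge e\<^sub>2 (\<dots> (Edge e\<^sub>n (Vertex (s e\<^sub>n)))))\<close>.
\<close>

datatype ('v, 'e) path = Vertex 'v | Edge 'e "('v, 'e) path"

primrec path_range :: "('v, 'e) pre_digraph \<Rightarrow> ('v, 'e) path \<Rightarrow> 'v" where
  "path_range E (Vertex v) = v"
| "path_range E (Edge e \<alpha>) = head E e"

primrec is_path :: "('v, 'e) pre_digraph \<Rightarrow> ('v, 'e) path \<Rightarrow> bool" where
  "is_path E (Vertex v) \<longleftrightarrow> v \<in> verts E"
| "is_path E (Edge e \<alpha>) \<longleftrightarrow> e \<in> arcs E \<and> is_path E \<alpha> \<and> tail E e = path_range E \<alpha>"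

primrec prefixes :: "('v, 'e) pre_digraph \<Rightarrow> ('v, 'e) path \<Rightarrow> ('v, 'e) path set" where
  "prefixes E (Vertex v) = {Vertex v}"
| "prefixes E (Edge e \<alpha>) = insert (Vertex (head E e)) (Edge e ` prefixes E \<alpha>)"

primrec path_act ::
  "('g \<Rightarrow> 'v \<Rightarrow> 'v) \<Rightarrow> ('g \<Rightarrow> 'e \<Rightarrow> 'e) \<Rightarrow> ('g \<Rightarrow> 'e \<Rightarrow> 'g) \<Rightarrow> 'g \<Rightarrow> ('v, 'e) path \<Rightarrow> ('v, 'e) path"
where
  "path_act \<sigma>\<^sub>0 \<sigma>\<^sub>1 \<phi> g (Vertex v) = Vertex (\<sigma>\<^sub>0 g v)"
| "path_act \<sigma>\<^sub>0 \<sigma>\<^sub>1 \<phi> g (Edge e \<alpha>) = Edge (\<sigma>\<^sub>1 g e) (path_act \<sigma>\<^sub>0 \<sigma>\<^sub>1 \<phi> (\<phi> g e) \<alpha>)"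

primrec path_cocycle :: "('g \<Rightarrow> 'e \<Rightarrow> 'g) \<Rightarrow> 'g \<Rightarrow> ('v, 'e) path \<Rightarrow> 'g" where
  "path_cocycle \<phi> g (Vertex v) = g"
| "path_cocycle \<phi> g (Edge e \<alpha>) = path_cocycle \<phi> (\<phi> g e) \<alpha>"

definition strongly_fixed ::
  "('g, 'n) monoid_scheme \<Rightarrow> ('g \<Rightarrow> 'v \<Rightarrow> 'v) \<Rightarrow> ('g \<Rightarrow> 'e \<Rightarrow> 'e) \<Rightarrow> ('g \<Rightarrow> 'e \<Rightarrow> 'g) \<Rightarrow>
   'g \<Rightarrow> ('v, 'e) path \<Rightarrow> bool" where
  "strongly_fixed G \<sigma>\<^sub>0 \<sigma>\<^sub>1 \<phi> g \<alpha> \<longleftrightarrow>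
     path_act \<sigma>\<^sub>0 \<sigma>\<^sub>1 \<phi> g \<alpha> = \<alpha> \<and> path_cocycle \<phi> g \<alpha> = \<one>\<^bsub>G\<^esub>"

definition minimal_strongly_fixed ::
  "('g, 'n) monoid_scheme \<Rightarrow> ('v, 'e) pre_digraph \<Rightarrow>
   ('g \<Rightarrow> 'v \<Rightarrow> 'v) \<Rightarrow> ('g \<Rightarrow> 'e \<Rightarrow> 'e) \<Rightarrow> ('g \<Rightarrow> 'e \<Rightarrow> 'g) \<Rightarrow> 'g \<Rightarrow> ('v, 'e) path \<Rightarrow> bool" where
  "minimal_strongly_fixed G E \<sigma>\<^sub>0 \<sigma>\<^sub>1 \<phi> g \<alpha> \<longleftrightarrow>
     strongly_fixed G \<sigma>\<^sub>0 \<sigma>\<^sub>1 \<phi> g \<alpha> \<and>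
     (\<forall>\<beta>\<in>prefixes E \<alpha>. \<beta> \<noteq> \<alpha> \<longrightarrow> \<not> strongly_fixed G \<sigma>\<^sub>0 \<sigma>\<^sub>1 \<phi> g \<beta>)"


section \<open>Exel-Pardo algebras\<close>

datatype ('v, 'e, 'g) ep_generator = PGen 'v 'g | SGen 'e 'g

definition ep_generators ::
  "('g, 'n) monoid_scheme \<Rightarrow> ('v, 'e) pre_digraph \<Rightarrow> ('v, 'e, 'g) ep_generator set" where
  "ep_generators G E = {PGen v f | v f. v \<in> verts E \<and> f \<in> carrier G} \<union>
     {SGen e g | e g. e \<in> arcs E \<and> g \<in> carrier G}"

abbreviation P_term :: "'v \<Rightarrow> 'g \<Rightarrow> ('k, ('v, 'e, 'g) ep_generator) star_term" where
  "P_term v f \<equiv> Gen (PGen v f)"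

abbreviation S_term :: "'e \<Rightarrow> 'g \<Rightarrow> ('k, ('v, 'e, 'g) ep_generator) star_term" where
  "S_term e g \<equiv> Gen (SGen e g)"

text \<open>
  In \<open>a_sum\<close> the finite sum over \<open>r\<^sup>-\<^sup>1(v)\<close> is written out along each repetition-free
  enumeration \<open>es\<close> of the fibre; these sums all agree modulo the axioms.
\<close>

inductive_set ep_relations ::
  "('g, 'n) monoid_scheme \<Rightarrow> ('v, 'e) pre_digraph \<Rightarrow>
   ('g \<Rightarrow> 'v \<Rightarrow> 'v) \<Rightarrow> ('g \<Rightarrow> 'e \<Rightarrow> 'e) \<Rightarrow> ('g \<Rightarrow> 'e \<Rightarrow> 'g) \<Rightarrow>
   (('k, ('v, 'e, 'g) ep_generator) star_term \<times> ('k, ('v, 'e, 'g) ep_generator) star_term) set"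
  for G :: "('g, 'n) monoid_scheme" (structure) and E :: "('v, 'e) pre_digraph"
    and \<sigma>\<^sub>0 :: "'g \<Rightarrow> 'v \<Rightarrow> 'v" and \<sigma>\<^sub>1 :: "'g \<Rightarrow> 'e \<Rightarrow> 'e" and \<phi> :: "'g \<Rightarrow> 'e \<Rightarrow> 'g" where
  a_pp: "\<lbrakk>v \<in> verts E; w \<in> verts E\<rbrakk> \<Longrightarrow>
    (P_term v \<one> \<^bold>* P_term w \<one>, if v = w then P_term w \<one> else Null) \<in> ep_relations G E \<sigma>\<^sub>0 \<sigma>\<^sub>1 \<phi>"
| a_ps: "e \<in> arcs E \<Longrightarrow>
    (P_term (head E e) \<one> \<^bold>* S_term e \<one>, S_term e \<one>) \<in> ep_relations G E \<sigma>\<^sub>0 \<sigma>\<^sub>1 \<phi>"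
| a_sp: "e \<in> arcs E \<Longrightarrow>
    (S_term e \<one> \<^bold>* P_term (tail E e) \<one>, S_term e \<one>) \<in> ep_relations G E \<sigma>\<^sub>0 \<sigma>\<^sub>1 \<phi>"
| a_pst: "e \<in> arcs E \<Longrightarrow>
    (P_term (tail E e) \<one> \<^bold>* (S_term e \<one>)\<^sup>\<star>, (S_term e \<one>)\<^sup>\<star>) \<in> ep_relations G E \<sigma>\<^sub>0 \<sigma>\<^sub>1 \<phi>"
| a_stp: "e \<in> arcs E \<Longrightarrow>
    ((S_term e \<one>)\<^sup>\<star> \<^bold>* P_term (head E e) \<one>, (S_term e \<one>)\<^sup>\<star>) \<in> ep_relations G E \<sigma>\<^sub>0 \<sigma>\<^sub>1 \<phi>"
| a_sts: "\<lbrakk>e \<in> arcs E; f \<in> arcs E\<rbrakk> \<Longrightarrow>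
    ((S_term e \<one>)\<^sup>\<star> \<^bold>* S_term f \<one>, if e = f then P_term (tail E e) \<one> else Null)
      \<in> ep_relations G E \<sigma>\<^sub>0 \<sigma>\<^sub>1 \<phi>"
| a_sum: "\<lbrakk>v \<in> verts E; es \<noteq> []; distinct es; set es = in_arcs E v\<rbrakk> \<Longrightarrow>
    (P_term v \<one>, foldr Sum (map (\<lambda>e. S_term e \<one> \<^bold>* (S_term e \<one>)\<^sup>\<star>) es) Null)
      \<in> ep_relations G E \<sigma>\<^sub>0 \<sigma>\<^sub>1 \<phi>"
| b: "\<lbrakk>v \<in> verts E; f \<in> carrier G\<rbrakk> \<Longrightarrow>
    ((P_term v f)\<^sup>\<star>, P_term (\<sigma>\<^sub>0 (inv f) v) (inv f)) \<in> ep_relations G E \<sigma>\<^sub>0 \<sigma>\<^sub>1 \<phi>"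
| c: "\<lbrakk>v \<in> verts E; f \<in> carrier G; w \<in> verts E; h \<in> carrier G\<rbrakk> \<Longrightarrow>
    (P_term v f \<^bold>* P_term w h, if v = \<sigma>\<^sub>0 f w then P_term v (f \<otimes> h) else Null)
      \<in> ep_relations G E \<sigma>\<^sub>0 \<sigma>\<^sub>1 \<phi>"
| d: "\<lbrakk>v \<in> verts E; f \<in> carrier G; e \<in> arcs E; g \<in> carrier G\<rbrakk> \<Longrightarrow>
    (P_term v f \<^bold>* S_term e g,
     if v = head E (\<sigma>\<^sub>1 f e) then S_term (\<sigma>\<^sub>1 f e) (\<phi> f e \<otimes> g) else Null)
      \<in> ep_relations G E \<sigma>\<^sub>0 \<sigma>\<^sub>1 \<phi>"
| e: "\<lbrakk>e \<in> arcs E; g \<in> carrier G; v \<in> verts E; f \<in> carrier G\<rbrakk> \<Longrightarrow>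
    (S_term e g \<^bold>* P_term v f, if \<sigma>\<^sub>0 g v = tail E e then S_term e (g \<otimes> f) else Null)
      \<in> ep_relations G E \<sigma>\<^sub>0 \<sigma>\<^sub>1 \<phi>"

text \<open>
  The field \<^const>\<open>one\<close> is the sum of the vertex projections. It is the identity
  if there are finitely many vertices, and otherwise has no meaning, since
  \<^const>\<open>finsum\<close> over an infinite set is zero by convention.
\<close>

definition exel_pardo_algebra ::
  "('k, 'm) ring_scheme \<Rightarrow> ('g, 'n) monoid_scheme \<Rightarrow> ('v, 'e) pre_digraph \<Rightarrow>
   ('g \<Rightarrow> 'v \<Rightarrow> 'v) \<Rightarrow> ('g \<Rightarrow> 'e \<Rightarrow> 'e) \<Rightarrow> ('g \<Rightarrow> 'e \<Rightarrow> 'g) \<Rightarrow>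
   ('k, ('k, ('v, 'e, 'g) ep_generator) star_term set) star_algebra" where
  "exel_pardo_algebra K G E \<sigma>\<^sub>0 \<sigma>\<^sub>1 \<phi> =
     (let X = ep_generators G E; R = ep_relations G E \<sigma>\<^sub>0 \<sigma>\<^sub>1 \<phi>; A = presented_algebra K X R
      in A\<lparr>one := \<Oplus>\<^bsub>A\<^esub>v\<in>verts E. star_rel K X R `` {P_term v \<one>\<^bsub>G\<^esub>}\<rparr>)"

lemma assoc_algebra_exel_pardo_algebra:
  assumes "cring K"
  shows "assoc_algebra K (exel_pardo_algebra K G E \<sigma>\<^sub>0 \<sigma>\<^sub>1 \<phi>)"
proof -
  let ?A = "presented_algebra K (ep_generators G E) (ep_relations G E \<sigma>\<^sub>0 \<sigma>\<^sub>1 \<phi>)"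
  have "assoc_algebra K (?A\<lparr>one := u\<rparr>)" for u
    using assoc_algebra_presented_algebra[OF assms, of "ep_generators G E" "ep_relations G E \<sigma>\<^sub>0 \<sigma>\<^sub>1 \<phi>"]
    unfolding assoc_algebra_def assoc_algebra_axioms_def Module.module_def module_axioms_def
      abelian_group_def abelian_group_axioms_def abelian_monoid_def
    by simp
  then show ?thesis by (simp add: exel_pardo_algebra_def Let_def)
qed

text \<open>
  The rule \<open>relation\<close> of \<^const>\<open>star_eq\<close> ignores pairs that are not terms over
  the generators. No relation is lost in this way.
\<close>

lemma ep_relations_terms:
  assumes "graph_action G E \<sigma>\<^sub>0 \<sigma>\<^sub>1" and "one_cocycle G (arcs E) \<sigma>\<^sub>1 \<phi>"
  shows "ep_relations G E \<sigma>\<^sub>0 \<sigma>\<^sub>1 \<phi> \<subseteq>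
    star_terms K (ep_generators G E) \<times> star_terms K (ep_generators G E)"
proof -
  interpret graph_action G E \<sigma>\<^sub>0 \<sigma>\<^sub>1 by fact
  interpret Gr: group G using V.group_hom by (rule group_hom.axioms)
  have V: "\<sigma>\<^sub>0 g v \<in> verts E" if "g \<in> carrier G" "v \<in> verts E" for g v
    using V.element_image that by blast
  have A: "\<sigma>\<^sub>1 g e \<in> arcs E" if "g \<in> carrier G" "e \<in> arcs E" for g e
    using A.element_image that by blast
  have F: "\<phi> g e \<in> carrier G" if "g \<in> carrier G" "e \<in> arcs E" for g e
    using assms(2) that by (auto simp: one_cocycle_def)
  have P: "P_term v f \<in> star_terms K (ep_generators G E)" if "v \<in> verts E" "f \<in> carrier G" for v f
    using that by (auto simp: ep_generators_def intro!: star_terms.intros)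
  have S: "S_term e g \<in> star_terms K (ep_generators G E)" if "e \<in> arcs E" "g \<in> carrier G" for e g
    using that by (auto simp: ep_generators_def intro!: star_terms.intros)
  have sum: "foldr Sum ts Null \<in> star_terms K (ep_generators G E)"
    if "set ts \<subseteq> star_terms K (ep_generators G E)" for ts
    using that by (induction ts) (auto intro!: star_terms.intros)
  have "s \<in> star_terms K (ep_generators G E) \<and> t \<in> star_terms K (ep_generators G E)"
    if "(s, t) \<in> ep_relations G E \<sigma>\<^sub>0 \<sigma>\<^sub>1 \<phi>" for s t
    using that
  proof cases
    case (a_sum v es)
    then show ?thesis
      by (auto intro!: P S sum star_terms.intros(2-))
  qed (auto intro!: P S V A F star_terms.intros(2-))
  then show ?thesis by auto
qed

end

theory Submission
  imports Defs "HOL-Algebra.AbelCoset"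
begin

text \<open>
  Write \<open>L\<close> for the Exel-Pardo algebra. The group acts on the space of infinite paths
  $e_1 e_2 e_3 \ldots$ of the graph, because $\phi(g,e)$ and \<open>g\<close> move vertices in the same way. On
  the space of all functions from infinite paths to the field, \<open>P\<^bsub>v,f\<^esub>\<close> and \<open>S\<^bsub>e,g\<^esub>\<close> act
  by transport along the partial bijections \<open>x \<mapsto> f x\<close> (onto the paths with range \<open>v\<close>) and
  \<open>x \<mapsto> e (g x)\<close>; carrying the adjoint of every operator along gives a
  representation of the $*$-algebra (\<open>term_op_star_eq\<close>). Every vertex is the range of an infinite
  path, so the vertex projections act non-trivially, and a simple \<open>L\<close> is represented faithfully
  (\<open>faithful\<close>). All that is needed about \<open>L\<close> can therefore be read off from operators on functions.

  \<^item> There are infinitely many infinite paths (\<open>infinite_inf_paths\<close>). Otherwise two of the operators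
    \<open>s\<^bsub>\<alpha>\<^esub>\<close>, for prefixes \<open>\<alpha>\<close> of different lengths of one path, would coincide on the finite
    path space, hence in \<open>L\<close>. A second representation, on functions of an infinite path and an
    integer that changes by one with every edge, tells them apart.
  \<^item> Disjoint cylinder sets give orthogonal idempotents. Hence all elements of a finite subset of
    \<open>L\<close> lie in one corner \<open>pLp\<close> whose unit \<open>p\<close> is a sum of three orthogonal non-zero
    idempotents (\<open>idempotents\<close>).
  \<^item> A central element \<open>z\<close> commutes with all cylinder projections, and its value at one path \<open>x\<close>
    depends on finitely many values of the argument. So at \<open>x\<close> it multiplies by a scalar \<open>c\<close>
    (\<open>central_scalar\<close>). A central element that vanishes at one path is zero, as it generates an
    ideal other than \<open>L\<close> (\<open>central_zero\<close>). If \<open>E\<^sup>0\<close> is finite, this gives \<open>z = c 1\<close>; if \<open>E\<^sup>0\<close> is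
    infinite, \<open>z\<close> is supported on finitely many vertices and the centre is zero.

  The Lie-theoretic part is a form of Herstein's theorem for a simple algebra \<open>A\<close> with the corner
  property above: an additive subgroup \<open>U\<close> with \<open>[[A,A],U] \<subseteq> U\<close> is central or contains all
  commutators. Three idempotents \<open>e\<^sub>0 + e\<^sub>1 + e\<^sub>2 = 1\<close> of a simple ring allow a proof by Peirce
  decomposition that is the same in every characteristic: brackets with off-diagonal elements
  produce a non-zero off-diagonal element of \<open>U\<close> unless \<open>U\<close> is central, and one such element
  generates all commutators. Consequently \<open>[A,A]\<close> is a simple Lie algebra as soon as it contains no
  non-zero central element. For \<open>L\<close> with infinite \<open>E\<^sup>0\<close> this always holds; for finite \<open>E\<^sup>0\<close> it means
  \<open>1 \<notin> [L,L]\<close>. Conversely, if \<open>1 \<in> [L,L]\<close>, then the multiples of \<open>1\<close> form a Lie ideal of \<open>[L,L]\<close>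
  with zero brackets, so \<open>[L,L]\<close> is not simple.
\<close>

section \<open>Simple rings with three orthogonal idempotents\<close>

context ring
begin

lemma commutator_add:
  assumes "x \<in> carrier R" "y \<in> carrier R" "b \<in> carrier R"
  shows "(x \<oplus> y) \<otimes> b \<ominus> b \<otimes> (x \<oplus> y) = (x \<otimes> b \<ominus> b \<otimes> x) \<oplus> (y \<otimes> b \<ominus> b \<otimes> y)"
  using assms by algebra

lemma commutator_minus:
  assumes "x \<in> carrier R" "b \<in> carrier R"
  shows "(\<ominus> x) \<otimes> b \<ominus> b \<otimes> (\<ominus> x) = \<ominus> (x \<otimes> b \<ominus> b \<otimes> x)"
  using assms by algebra

text \<open>
  This identity makes \<open>{t. [t, R] \<subseteq> U}\<close> a subring for every additive subgroup \<open>U\<close>.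
\<close>

lemma commutator_mult:
  assumes "x \<in> carrier R" "y \<in> carrier R" "b \<in> carrier R"
  shows "x \<otimes> y \<otimes> b \<ominus> b \<otimes> (x \<otimes> y) =
    (x \<otimes> (y \<otimes> b) \<ominus> (y \<otimes> b) \<otimes> x) \<oplus> (y \<otimes> (b \<otimes> x) \<ominus> (b \<otimes> x) \<otimes> y)"
  using assms by algebra

lemma difference_of_sums:
  assumes "p \<in> carrier R" "q \<in> carrier R" "r \<in> carrier R" "s \<in> carrier R" "t \<in> carrier R" "p' \<in> carrier R"
  shows "(p \<oplus> q \<oplus> r) \<ominus> (s \<oplus> p' \<oplus> t) = (p \<ominus> p') \<oplus> q \<oplus> r \<oplus> \<ominus> s \<oplus> \<ominus> t"
  using assms by (simp add: minus_eq minus_add a_ac)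

lemma double_commutator:
  assumes "x \<in> carrier R" "y \<in> carrier R" "u \<in> carrier R"
  shows "y \<otimes> (x \<otimes> u \<ominus> u \<otimes> x) \<ominus> (x \<otimes> u \<ominus> u \<otimes> x) \<otimes> y =
    (y \<otimes> x) \<otimes> u \<oplus> u \<otimes> (x \<otimes> y) \<oplus> (\<ominus> (x \<otimes> u \<otimes> y) \<oplus> \<ominus> (y \<otimes> u \<otimes> x))"
  using assms by algebra

end

lemma less_3_cases: "i < (3::nat) \<Longrightarrow> i = 0 \<or> i = 1 \<or> i = 2"
  by linarith

lemma three_cases:
  assumes "i < (3::nat)" "j < 3" "i \<noteq> j"
  obtains k where "k < 3" "k \<noteq> i" "k \<noteq> j" "\<And>l. l < 3 \<Longrightarrow> l = i \<or> l = j \<or> l = k"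
proof -
  have "\<exists>k<3. k \<noteq> i \<and> k \<noteq> j \<and> (\<forall>l<3. l = i \<or> l = j \<or> l = k)"
    using less_3_cases[OF assms(1)] less_3_cases[OF assms(2)] assms(3) 
    by (auto dest: less_3_cases) (simp_all add: numeral_2_eq_2 numeral_3_eq_3 All_less_Suc Ex_less_Suc)
  then show ?thesis using that by blast
qed

text \<open>
  The assumption \<open>full\<close> is simplicity: every non-zero element generates the whole ring as an ideal.
  It speaks of additive subgroups that contain all products \<open>axb\<close>, so that a property of an
  element of \<open>RxR\<close> can be proved on such products and needs no explicit sums.
\<close>

locale three_idempotents = ring R for R (structure) +
  fixes e :: "nat \<Rightarrow> 'a"
  assumes idem_closed: "i < 3 \<Longrightarrow> e i \<in> carrier R"
    and idem_mult: "\<lbrakk>i < 3; j < 3\<rbrakk> \<Longrightarrow> e i \<otimes> e j = (if i = j then e i else \<zero>)"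
    and idem_nonzero: "i < 3 \<Longrightarrow> e i \<noteq> \<zero>"
    and idem_sum: "e 0 \<oplus> e 1 \<oplus> e 2 = \<one>"
    and full: "\<lbrakk>additive_subgroup H R; x \<in> carrier R; x \<noteq> \<zero>;
       \<And>a b. a \<in> carrier R \<Longrightarrow> b \<in> carrier R \<Longrightarrow> a \<otimes> x \<otimes> b \<in> H\<rbrakk> \<Longrightarrow> carrier R \<subseteq> H"
begin

text \<open>
  The Peirce component \<open>e\<^sub>i R e\<^sub>j\<close>, called \<open>A\<^sub>i\<^sub>j\<close> in the comments, as the set of fixed points of its
  projection.
\<close>

definition peirce :: "nat \<Rightarrow> nat \<Rightarrow> 'a set" where
  "peirce i j = {x \<in> carrier R. e i \<otimes> x = x \<and> x \<otimes> e j = x}"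

lemma additive_subgroupI:
  assumes "H \<subseteq> carrier R" "\<zero> \<in> H" "\<And>x y. x \<in> H \<Longrightarrow> y \<in> H \<Longrightarrow> x \<oplus> y \<in> H" "\<And>x. x \<in> H \<Longrightarrow> \<ominus> x \<in> H"
  shows "additive_subgroup H R"
  using assms by (auto intro!: additive_subgroup.intro subgroup.intro simp: a_inv_def)

lemma peirceD:
  assumes "x \<in> peirce i j"
  shows "x \<in> carrier R" "e i \<otimes> x = x" "x \<otimes> e j = x"
  using assms by (auto simp: peirce_def)

lemma peirceI:
  assumes "x \<in> carrier R" "i < 3" "j < 3"
  shows "e i \<otimes> x \<otimes> e j \<in> peirce i j"
proof -
  have "e i \<otimes> (e i \<otimes> x \<otimes> e j) = e i \<otimes> e i \<otimes> x \<otimes> e j"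
    using assms idem_closed by (simp add: m_assoc)
  moreover have "e i \<otimes> x \<otimes> e j \<otimes> e j = e i \<otimes> x \<otimes> (e j \<otimes> e j)"
    using assms idem_closed by (simp add: m_assoc)
  ultimately show ?thesis
    using assms idem_closed by (simp add: peirce_def idem_mult)
qed

lemma peirce_extend_right:
  assumes x: "x \<in> peirce i j" and "b \<in> carrier R" "i < 3" "l < 3"
  shows "x \<otimes> b \<otimes> e l \<in> peirce i l"
proof -
  have "e i \<otimes> (x \<otimes> b) = x \<otimes> b"
    using peirceD[OF x] assms(2,3) idem_closed by (simp add: m_assoc[symmetric])
  then show ?thesis using peirceI[of "x \<otimes> b" i l] peirceD(1)[OF x] assms(2-4) by simp
qed

lemma peirce_extend_left:
  assumes x: "x \<in> peirce i j" and "b \<in> carrier R" "l < 3" "j < 3"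
  shows "e l \<otimes> b \<otimes> x \<in> peirce l j"
proof -
  have "e l \<otimes> (b \<otimes> x) \<otimes> e j = e l \<otimes> b \<otimes> (x \<otimes> e j)"
    using peirceD(1)[OF x] assms(2-4) idem_closed by (simp add: m_assoc)
  then show ?thesis using peirceI[of "b \<otimes> x" l j] peirceD[OF x] assms(2-4) by simp
qed

lemma peirce_mult:
  assumes "x \<in> peirce i j" "y \<in> peirce j k" "i < 3" "k < 3"
  shows "x \<otimes> y \<in> peirce i k"
  using peirceD[OF assms(1)] peirceD[OF assms(2)] idem_closed[OF assms(3)] idem_closed[OF assms(4)]
  by (auto simp: peirce_def m_assoc) (metis m_assoc)

lemma peirce_mult_zero:
  assumes "x \<in> peirce i j" "y \<in> peirce k l" "j \<noteq> k" "j < 3" "k < 3"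
  shows "x \<otimes> y = \<zero>"
proof -
  note x = peirceD[OF assms(1)] and y = peirceD[OF assms(2)] and c = idem_closed[OF assms(4)] idem_closed[OF assms(5)]
  have "x \<otimes> y = (x \<otimes> e j) \<otimes> (e k \<otimes> y)" using x y by simp
  also have "\<dots> = x \<otimes> (e j \<otimes> e k) \<otimes> y" using x(1) y(1) c by (simp add: m_assoc)
  finally show ?thesis using assms x(1) y(1) by (simp add: idem_mult)
qed

text \<open>
  The elements that annihilate \<open>y\<close> from the left form an additive subgroup containing \<open>RxR\<close>.
\<close>

lemma prime_ring:
  assumes "x \<in> carrier R" "y \<in> carrier R" "\<And>a. a \<in> carrier R \<Longrightarrow> x \<otimes> a \<otimes> y = \<zero>"
  shows "x = \<zero> \<or> y = \<zero>"
proof (rule ccontr)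
  assume n: "\<not> ?thesis"
  let ?H = "{z \<in> carrier R. z \<otimes> y = \<zero>}"
  have "carrier R \<subseteq> ?H"
  proof (rule full[of _ x])
    show "additive_subgroup ?H R"
      using assms by (intro additive_subgroupI) (auto simp: l_distr l_minus)
    fix a b assume "a \<in> carrier R" "b \<in> carrier R"
    with assms show "a \<otimes> x \<otimes> b \<in> ?H" by (simp add: m_assoc)
  qed (use n assms in auto)
  then have "\<one> \<otimes> y = \<zero>" by auto
  with n assms show False by simp
qed

text \<open>
  For non-zero \<open>x\<close> in \<open>A\<^sub>k\<^sub>l\<close> the products \<open>A\<^sub>i\<^sub>k x A\<^sub>l\<^sub>j\<close> span \<open>A\<^sub>i\<^sub>j\<close>, because
  \<open>A\<^sub>i\<^sub>j = e\<^sub>i (RxR) e\<^sub>j\<close> and \<open>x = e\<^sub>k x e\<^sub>l\<close>.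
\<close>

lemma peirce_subset:
  assumes H: "additive_subgroup H R" and x: "x \<in> peirce k l" "x \<noteq> \<zero>"
    and lt: "i < 3" "j < 3" "k < 3" "l < 3"
    and m: "\<And>a b. a \<in> peirce i k \<Longrightarrow> b \<in> peirce l j \<Longrightarrow> a \<otimes> x \<otimes> b \<in> H"
  shows "peirce i j \<subseteq> H"
proof
  fix z assume z: "z \<in> peirce i j"
  interpret H: additive_subgroup H R by fact
  note c = idem_closed[OF lt(1)] idem_closed[OF lt(2)] idem_closed[OF lt(3)] idem_closed[OF lt(4)]
  let ?H = "{z \<in> carrier R. e i \<otimes> z \<otimes> e j \<in> H}"
  have "carrier R \<subseteq> ?H"
  proof (rule full[of _ x])
    show "additive_subgroup ?H R"
      using c by (intro additive_subgroupI) (auto simp: l_distr r_distr l_minus r_minus)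
    fix a b assume a: "a \<in> carrier R" "b \<in> carrier R"
    have "(e i \<otimes> a \<otimes> e k) \<otimes> x \<otimes> (e l \<otimes> b \<otimes> e j) = e i \<otimes> a \<otimes> (e k \<otimes> x \<otimes> e l) \<otimes> b \<otimes> e j"
      using a c peirceD(1)[OF x(1)] by (simp add: m_assoc)
    also have "\<dots> = e i \<otimes> (a \<otimes> x \<otimes> b) \<otimes> e j"
      using a c peirceD[OF x(1)] by (simp add: m_assoc)
    finally show "a \<otimes> x \<otimes> b \<in> ?H"
      using m[OF peirceI[OF a(1) lt(1,3)] peirceI[OF a(2) lt(4,2)]] a peirceD(1)[OF x(1)] by simp
  qed (use x in \<open>auto dest: peirceD\<close>)
  with peirceD[OF z] show "z \<in> H" by auto
qed

lemma idem_peirce: "i < 3 \<Longrightarrow> e i \<in> peirce i i"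
  by (simp add: peirce_def idem_closed idem_mult)

lemma peirce_subset_via:
  assumes "additive_subgroup H R" and lt: "i < 3" "j < 3" "k < 3"
    and m: "\<And>a b. a \<in> peirce i k \<Longrightarrow> b \<in> peirce k j \<Longrightarrow> a \<otimes> b \<in> H"
  shows "peirce i j \<subseteq> H"
  using assms(1) idem_peirce[OF lt(3)] idem_nonzero[OF lt(3)] lt(1,2,3,3)
  by (rule peirce_subset) (simp add: m peirceD)

lemma idem_sum_distinct: 
  assumes "i < 3" "j < 3" "k < 3" "i \<noteq> j" "k \<noteq> i" "k \<noteq> j"
  shows "e i \<oplus> e j \<oplus> e k = \<one>"
proof -
  have c: "e 0 \<in> carrier R" "e 1 \<in> carrier R" "e 2 \<in> carrier R" using idem_closed by auto
  have "(i=0 \<and> j=1 \<and> k=2) \<or> (i=0 \<and> j=2 \<and> k=1) \<or> (i=1 \<and> j=0 \<and> k=2) \<or> (i=1 \<and> j=2 \<and> k=0)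
     \<or> (i=2 \<and> j=0 \<and> k=1) \<or> (i=2 \<and> j=1 \<and> k=0)"
    using less_3_cases[of i] less_3_cases[of j] less_3_cases[of k] assms by auto
  then show ?thesis using idem_sum c by (auto simp: a_ac)
qed

text \<open>
  A diagonal component \<open>A\<^sub>i\<^sub>i\<close> is spanned by \<open>A\<^sub>i\<^sub>k A\<^sub>k\<^sub>i\<close> with \<open>k \<noteq> i\<close>, so the off-diagonal
  components generate the ring.
\<close>

lemma offdiagonal_generate:
  assumes H: "additive_subgroup H R" and mult: "\<And>x y. x \<in> H \<Longrightarrow> y \<in> H \<Longrightarrow> x \<otimes> y \<in> H"
    and off: "\<And>i j. i < 3 \<Longrightarrow> j < 3 \<Longrightarrow> i \<noteq> j \<Longrightarrow> peirce i j \<subseteq> H"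
  shows "carrier R \<subseteq> H"
proof
  fix z assume z: "z \<in> carrier R"
  interpret H: additive_subgroup H R by fact
  have all: "peirce i j \<subseteq> H" if "i < 3" "j < 3" for i j
  proof (cases "i = j")
    case True
    define k :: nat where "k = (if i = 0 then 1 else 0)"
    have k: "k < 3" "k \<noteq> i" by (auto simp: k_def)
    show ?thesis
    proof (rule peirce_subset_via[OF H that k(1)])
      fix a b assume "a \<in> peirce i k" "b \<in> peirce k j"
      then have "a \<in> H" "b \<in> H"
        using off[OF that(1) k(1)] off[OF k(1) that(2)] k(2) True by auto
      then show "a \<otimes> b \<in> H" by (rule mult)
    qed
  qed (use off that in auto)
  have c: "e i \<otimes> z \<otimes> e j \<in> H" if "i < 3" "j < 3" for i j
    using all[OF that] peirceI[OF z that] by auto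
  have ec: "e 0 \<in> carrier R" "e 1 \<in> carrier R" "e 2 \<in> carrier R" using idem_closed by auto
  have row: "e i \<otimes> z \<in> H" if "i < 3" for i
  proof -
    have ei: "e i \<in> carrier R" using that by (rule idem_closed)
    have "e i \<otimes> z = e i \<otimes> z \<otimes> (e 0 \<oplus> e 1 \<oplus> e 2)" using z ei idem_sum by simp
    also have "\<dots> = e i \<otimes> z \<otimes> e 0 \<oplus> e i \<otimes> z \<otimes> e 1 \<oplus> e i \<otimes> z \<otimes> e 2"
      using z ei ec by (simp add: r_distr)
    finally have eq: "e i \<otimes> z = \<dots>" .
    show ?thesis by (subst eq) (intro H.a_closed c that; simp)
  qed
  have "z = (e 0 \<oplus> e 1 \<oplus> e 2) \<otimes> z" using z idem_sum by simp
  also have "\<dots> = e 0 \<otimes> z \<oplus> e 1 \<otimes> z \<oplus> e 2 \<otimes> z" using z ec by (simp add: l_distr)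
  finally have eq: "z = \<dots>" .
  show "z \<in> H" by (subst eq) (intro H.a_closed row; simp)
qed

context
  fixes U
  assumes U: "additive_subgroup U R"
    and ad: "\<And>i j x u. \<lbrakk>i < 3; j < 3; i \<noteq> j; x \<in> peirce i j; u \<in> U\<rbrakk> \<Longrightarrow> x \<otimes> u \<ominus> u \<otimes> x \<in> U"
begin

interpretation U: additive_subgroup U R by (rule U)

text \<open>
  In the next two lemmas the bracket has only one non-zero term, since the indices of the other
  product do not match. They are the means by which elements of \<open>U\<close> travel between components.
\<close>

lemma left_move:
  assumes "y \<in> U" "y \<in> peirce k j" "a \<in> peirce i k" "i \<noteq> k" "i \<noteq> j" "i < 3" "j < 3" "k < 3"
  shows "a \<otimes> y \<in> U"
proof -
  have "y \<otimes> a = \<zero>" using assms by (intro peirce_mult_zero[OF assms(2,3)]) auto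
  then show ?thesis
    using ad[OF assms(6,8,4,3,1)] peirceD(1)[OF assms(2)] peirceD(1)[OF assms(3)] by (simp add: minus_eq)
qed

lemma right_move:
  assumes "y \<in> U" "y \<in> peirce i k" "b \<in> peirce k j" "j \<noteq> k" "i \<noteq> j" "i < 3" "j < 3" "k < 3"
  shows "y \<otimes> b \<in> U"
proof -
  have "b \<otimes> y = \<zero>" using assms by (intro peirce_mult_zero[OF assms(3,2)]) auto
  then have "\<ominus> (y \<otimes> b) \<in> U"
    using ad[OF assms(8,7) _ assms(3,1)] assms(4) peirceD(1)[OF assms(2)] peirceD(1)[OF assms(3)] by (simp add: minus_eq)
  then have "\<ominus> (\<ominus> (y \<otimes> b)) \<in> U" by (rule U.a_inv_closed)
  then show ?thesis using peirceD(1)[OF assms(2)] peirceD(1)[OF assms(3)] by simp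
qed

text \<open>
  The products \<open>A\<^sub>i\<^sub>i x A\<^sub>j\<^sub>j\<close> span \<open>A\<^sub>i\<^sub>j\<close>. A factor from \<open>A\<^sub>i\<^sub>i\<close> or \<open>A\<^sub>j\<^sub>j\<close> is not off-diagonal, but it is a sum
  of products that pass through a third index \<open>k\<close>, and each half of such a product can be
  absorbed by a bracket. This is where the third idempotent enters.
\<close>

lemma peirce_in_U:
  assumes x: "x \<in> U" "x \<in> peirce i j" "x \<noteq> \<zero>" and ij: "i < 3" "j < 3" "i \<noteq> j"
  shows "peirce i j \<subseteq> U"
proof -
  obtain k where k: "k < 3" "k \<noteq> i" "k \<noteq> j" using three_cases[OF ij] by blast
  have L: "c \<otimes> y \<in> U" if y: "y \<in> U" "y \<in> peirce i j" and c: "c \<in> peirce i i" for y c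
  proof -
    have yc: "y \<in> carrier R" using y peirceD by blast
    let ?H = "{z \<in> carrier R. z \<otimes> y \<in> U}"
    have H: "additive_subgroup ?H R"
      using yc by (intro additive_subgroupI) (auto simp: l_distr l_minus)
    have "peirce i i \<subseteq> ?H"
    proof (rule peirce_subset_via[OF H ij(1,1) k(1)])
      fix a b assume a: "a \<in> peirce i k" and b: "b \<in> peirce k i"
      have "b \<otimes> y \<in> U" by (rule left_move[OF y b]) (use ij k in auto)
      moreover have "b \<otimes> y \<in> peirce k j" using peirce_mult[OF b y(2)] k ij by simp
      ultimately have "a \<otimes> (b \<otimes> y) \<in> U" by (rule left_move[OF _ _ a]) (use ij k in auto)
      then show "a \<otimes> b \<in> ?H" using yc peirceD(1)[OF a] peirceD(1)[OF b] by (simp add: m_assoc)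
    qed
    then show ?thesis using c by auto
  qed
  have Rt: "y \<otimes> c \<in> U" if y: "y \<in> U" "y \<in> peirce i j" and c: "c \<in> peirce j j" for y c
  proof -
    have yc: "y \<in> carrier R" using y peirceD by blast
    let ?H = "{z \<in> carrier R. y \<otimes> z \<in> U}"
    have H: "additive_subgroup ?H R"
      using yc by (intro additive_subgroupI) (auto simp: r_distr r_minus)
    have "peirce j j \<subseteq> ?H"
    proof (rule peirce_subset_via[OF H ij(2,2) k(1)])
      fix a b assume a: "a \<in> peirce j k" and b: "b \<in> peirce k j"
      have "y \<otimes> a \<in> U" by (rule right_move[OF y a]) (use ij k in auto)
      moreover have "y \<otimes> a \<in> peirce i k" using peirce_mult[OF y(2) a] k ij by simp
      ultimately have "(y \<otimes> a) \<otimes> b \<in> U" by (rule right_move[OF _ _ b]) (use ij k in auto)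
      then show "a \<otimes> b \<in> ?H" using yc peirceD(1)[OF a] peirceD(1)[OF b] by (simp add: m_assoc)
    qed
    then show ?thesis using c by auto
  qed
  show ?thesis
  proof (rule peirce_subset[OF U x(2,3) ij(1,2) ij(1,2)])
    fix a b assume a: "a \<in> peirce i i" and b: "b \<in> peirce j j"
    show "a \<otimes> x \<otimes> b \<in> U"
      by (rule Rt[OF L[OF x(1,2) a] _ b]) (rule peirce_mult[OF a x(2) ij(1,2)])
  qed
qed

lemma all_offdiagonal_in_U:
  assumes "peirce i j \<subseteq> U" and ij: "i < 3" "j < 3" "i \<noteq> j" and "k < 3" "l < 3" "k \<noteq> l"
  shows "peirce k l \<subseteq> U"
proof -
  have L: "peirce k j \<subseteq> U" if "peirce i j \<subseteq> U" "i < 3" "j < 3" "k < 3" "i \<noteq> j" "k \<noteq> i" "k \<noteq> j" for i j k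
  proof (rule peirce_subset_via[OF U \<open>k < 3\<close> \<open>j < 3\<close> \<open>i < 3\<close>])
    fix a b assume "a \<in> peirce k i" "b \<in> peirce i j"
    with that(1) have "b \<in> U" by blast
    then show "a \<otimes> b \<in> U"
      by (rule left_move[OF _ \<open>b \<in> peirce i j\<close> \<open>a \<in> peirce k i\<close>]) (use that in simp_all)
  qed
  have Rt: "peirce i k \<subseteq> U" if "peirce i j \<subseteq> U" "i < 3" "j < 3" "k < 3" "i \<noteq> j" "k \<noteq> i" "k \<noteq> j" for i j k
  proof (rule peirce_subset_via[OF U \<open>i < 3\<close> \<open>k < 3\<close> \<open>j < 3\<close>])
    fix a b assume "a \<in> peirce i j" "b \<in> peirce j k"
    with that(1) have "a \<in> U" by blast
    then show "a \<otimes> b \<in> U"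
      by (rule right_move[OF _ \<open>a \<in> peirce i j\<close> \<open>b \<in> peirce j k\<close>]) (use that in simp_all)
  qed
  obtain m where m: "m < 3" "m \<noteq> i" "m \<noteq> j" "\<And>l. l < 3 \<Longrightarrow> l = i \<or> l = j \<or> l = m"
    using three_cases[OF ij] by blast
  have mj: "peirce m j \<subseteq> U" using L[OF assms(1)] ij m by simp
  have im: "peirce i m \<subseteq> U" using Rt[OF assms(1)] ij m by simp
  have mi: "peirce m i \<subseteq> U" using Rt[OF mj] ij m by simp
  have jm: "peirce j m \<subseteq> U" using L[OF im] ij m by simp
  have ji: "peirce j i \<subseteq> U" using L[OF mi] ij m by simp
  show ?thesis using m(4)[OF assms(5)] m(4)[OF assms(6)] assms(1,7) mj im mi jm ji by auto
qed

text \<open>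
  The elements \<open>t\<close> with \<open>[t, R] \<subseteq> U\<close> form a subring, so only off-diagonal \<open>x\<close> in \<open>A\<^sub>i\<^sub>j\<close> have to be
  considered. All Peirce components of \<open>[x, b]\<close> are off-diagonal except for those that come from
  \<open>e\<^sub>j b e\<^sub>i\<close>, and these contribute the bracket \<open>[x, e\<^sub>j b e\<^sub>i]\<close> of two off-diagonal elements.
\<close>

lemma commutators_in_U:
  assumes off: "\<And>i j. i < 3 \<Longrightarrow> j < 3 \<Longrightarrow> i \<noteq> j \<Longrightarrow> peirce i j \<subseteq> U"
    and ab: "a \<in> carrier R" "b \<in> carrier R"
  shows "a \<otimes> b \<ominus> b \<otimes> a \<in> U"
proof -
  let ?T = "{t \<in> carrier R. \<forall>b\<in>carrier R. t \<otimes> b \<ominus> b \<otimes> t \<in> U}"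
  have "carrier R \<subseteq> ?T"
  proof (rule offdiagonal_generate)
    show "additive_subgroup ?T R"
    proof (rule additive_subgroupI)
      fix x y assume "x \<in> ?T" "y \<in> ?T"
      then show "x \<oplus> y \<in> ?T" by (simp add: commutator_add)
    next
      fix x assume "x \<in> ?T"
      then show "\<ominus> x \<in> ?T" by (simp add: commutator_minus)
    qed (auto simp: minus_eq)
  next
    fix x y assume "x \<in> ?T" "y \<in> ?T"
    then show "x \<otimes> y \<in> ?T" by (simp add: commutator_mult)
  next
    fix i j :: nat assume ij: "i < 3" "j < 3" "i \<noteq> j"
    obtain k where k: "k < 3" "k \<noteq> i" "k \<noteq> j" using three_cases[OF ij] by blast
    have c: "e i \<in> carrier R" "e j \<in> carrier R" "e k \<in> carrier R" using ij k by (auto intro: idem_closed)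
    have s: "e i \<oplus> e j \<oplus> e k = \<one>" using idem_sum_distinct ij k by simp
    show "peirce i j \<subseteq> ?T"
    proof
      fix x assume x: "x \<in> peirce i j"
      note xD = peirceD[OF x]
      have "x \<otimes> b \<ominus> b \<otimes> x \<in> U" if b: "b \<in> carrier R" for b
      proof -
        let ?y = "e j \<otimes> b \<otimes> e i"
        have y: "?y \<in> peirce j i" using b ij by (intro peirceI)
        have yU: "x \<otimes> ?y \<ominus> ?y \<otimes> x \<in> U" using ad[OF ij x] off[OF ij(2,1)] y ij(3) by blast
        have 1: "x \<otimes> b \<otimes> e j \<in> U" "x \<otimes> b \<otimes> e k \<in> U" "e i \<otimes> b \<otimes> x \<in> U" "e k \<otimes> b \<otimes> x \<in> U"
          using peirce_extend_right[OF x b ij(1,2)] peirce_extend_right[OF x b ij(1) k(1)]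
            peirce_extend_left[OF x b ij(1,2)] peirce_extend_left[OF x b k(1) ij(2)]
            off[OF ij] off[OF ij(1) k(1)] off[OF k(1) ij(2)] k by blast+
        have "x \<otimes> b = x \<otimes> b \<otimes> (e i \<oplus> e j \<oplus> e k)" using xD b s by simp
        also have "\<dots> = x \<otimes> b \<otimes> e i \<oplus> x \<otimes> b \<otimes> e j \<oplus> x \<otimes> b \<otimes> e k" using xD(1) b c by (simp add: r_distr)
        also have "x \<otimes> b \<otimes> e i = x \<otimes> e j \<otimes> b \<otimes> e i" using xD by simp
        also have "\<dots> = x \<otimes> ?y" using xD(1) b c by (simp add: m_assoc)
        finally have xb': "x \<otimes> b = x \<otimes> ?y \<oplus> x \<otimes> b \<otimes> e j \<oplus> x \<otimes> b \<otimes> e k" .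
        have "b \<otimes> x = (e i \<oplus> e j \<oplus> e k) \<otimes> (b \<otimes> x)" using xD b s by simp
        also have "\<dots> = e i \<otimes> b \<otimes> x \<oplus> e j \<otimes> b \<otimes> x \<oplus> e k \<otimes> b \<otimes> x" using xD(1) b c by (simp add: l_distr m_assoc)
        also have "e j \<otimes> b \<otimes> x = e j \<otimes> b \<otimes> (e i \<otimes> x)" using xD by simp
        also have "\<dots> = ?y \<otimes> x" using xD(1) b c by (simp add: m_assoc)
        finally have bx': "b \<otimes> x = e i \<otimes> b \<otimes> x \<oplus> ?y \<otimes> x \<oplus> e k \<otimes> b \<otimes> x" .
        have "x \<otimes> b \<ominus> b \<otimes> x = (x \<otimes> ?y \<ominus> ?y \<otimes> x) \<oplus> x \<otimes> b \<otimes> e j \<oplus> x \<otimes> b \<otimes> e k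
            \<oplus> \<ominus> (e i \<otimes> b \<otimes> x) \<oplus> \<ominus> (e k \<otimes> b \<otimes> x)"
          unfolding arg_cong2[OF xb' bx', of "\<lambda>s t. s \<ominus> t"]
          using xD(1) b c by (intro difference_of_sums) auto
        then show ?thesis
          using yU 1 by (simp only: U.a_closed U.a_inv_closed)
      qed
      then show "x \<in> ?T" using xD by auto
    qed
  qed
  then show ?thesis using ab by auto
qed

text \<open>
  For \<open>x\<close> in \<open>A\<^sub>i\<^sub>j\<close> and \<open>y\<close> in \<open>A\<^sub>i\<^sub>k\<close> the double bracket \<open>[y, [x, u]] = - xuy - yux\<close> has one term in \<open>A\<^sub>i\<^sub>k\<close>
  and one in \<open>A\<^sub>i\<^sub>j\<close>. One more bracket separates them, so both vanish, and primeness shows that \<open>u\<close>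
  has no off-diagonal components. Then \<open>[x, u]\<close> itself is off-diagonal for off-diagonal \<open>x\<close>, hence
  zero, and \<open>u\<close> commutes with a generating set of the ring.
\<close>

lemma no_offdiagonal_central:
  assumes triv: "\<And>i j x. \<lbrakk>i < 3; j < 3; i \<noteq> j; x \<in> peirce i j; x \<in> U\<rbrakk> \<Longrightarrow> x = \<zero>"
    and u: "u \<in> U" and z: "z \<in> carrier R"
  shows "z \<otimes> u = u \<otimes> z"
proof -
  have uc: "u \<in> carrier R" using u by auto
  \<comment> \<open>A bracket with an element of \<open>A\<^sub>k\<^sub>j\<close> kills the component in \<open>A\<^sub>i\<^sub>j\<close> and moves the other one into \<open>A\<^sub>i\<^sub>j\<close>.\<close>
  have pair: "b = \<zero>" if ijk: "i < 3" "j < 3" "k < 3" "i \<noteq> j" "k \<noteq> i" "k \<noteq> j"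
    and a: "a \<in> peirce i j" and b: "b \<in> peirce i k" and ab: "a \<oplus> b \<in> U" for i j k a b
  proof -
    have "b \<otimes> z \<otimes> e j = \<zero>" if z: "z \<in> carrier R" for z
    proof -
      let ?z = "e k \<otimes> z \<otimes> e j"
      have zp: "?z \<in> peirce k j" using z ijk by (intro peirceI)
      note cc = peirceD(1)[OF a] peirceD(1)[OF b] peirceD(1)[OF zp]
      have 0: "?z \<otimes> a = \<zero>" "?z \<otimes> b = \<zero>" "a \<otimes> ?z = \<zero>"
        using peirce_mult_zero[OF zp a] peirce_mult_zero[OF zp b] peirce_mult_zero[OF a zp] ijk by auto
      have "?z \<otimes> (a \<oplus> b) \<ominus> (a \<oplus> b) \<otimes> ?z \<in> U" using ad[OF _ _ _ zp ab] ijk by simp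
      also have "?z \<otimes> (a \<oplus> b) \<ominus> (a \<oplus> b) \<otimes> ?z = \<ominus> (b \<otimes> ?z)"
        using cc 0 by (simp add: l_distr r_distr minus_eq)
      finally have "\<ominus> (\<ominus> (b \<otimes> ?z)) \<in> U" by (rule U.a_inv_closed)
      then have "b \<otimes> ?z \<in> U" using cc by simp
      then have "b \<otimes> ?z = \<zero>" using triv[of i j] peirce_mult[OF b zp] ijk by simp
      also have "b \<otimes> ?z = (b \<otimes> e k) \<otimes> z \<otimes> e j"
        using cc z idem_closed[OF ijk(2)] idem_closed[OF ijk(3)] by (simp add: m_assoc)
      finally show ?thesis using peirceD[OF b] by simp
    qed
    then show "b = \<zero>" using prime_ring[of b "e j"] peirceD[OF b] idem_closed idem_nonzero ijk by blast
  qed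
  have off: "e k \<otimes> u \<otimes> e i = \<zero>" if ki: "k < 3" "i < 3" "k \<noteq> i" for k i
  proof -
    obtain j where j: "j < 3" "j \<noteq> k" "j \<noteq> i" using three_cases[OF ki] by blast
    note c = idem_closed[OF ki(1)] idem_closed[OF ki(2)] idem_closed[OF j(1)]
    have 1: "y \<otimes> u \<otimes> x = \<zero>" if x: "x \<in> peirce i j" and y: "y \<in> peirce i k" for x y
    proof -
      note cc = peirceD(1)[OF x] peirceD(1)[OF y]
      have 0: "y \<otimes> x = \<zero>" "x \<otimes> y = \<zero>"
        using peirce_mult_zero[OF x y] peirce_mult_zero[OF y x] ki j by auto
      have "y \<otimes> (x \<otimes> u \<ominus> u \<otimes> x) \<ominus> (x \<otimes> u \<ominus> u \<otimes> x) \<otimes> y \<in> U"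
        using ad[OF _ _ _ y ad[OF _ _ _ x u]] ki j by simp
      also have "y \<otimes> (x \<otimes> u \<ominus> u \<otimes> x) \<ominus> (x \<otimes> u \<ominus> u \<otimes> x) \<otimes> y =
         (y \<otimes> x) \<otimes> u \<oplus> u \<otimes> (x \<otimes> y) \<oplus> (\<ominus> (x \<otimes> u \<otimes> y) \<oplus> \<ominus> (y \<otimes> u \<otimes> x))"
        using cc uc by (intro double_commutator)
      also have "\<dots> = \<ominus> (x \<otimes> u \<otimes> y) \<oplus> \<ominus> (y \<otimes> u \<otimes> x)" using 0 cc uc by simp
      finally have "\<ominus> (x \<otimes> u \<otimes> y) \<oplus> \<ominus> (y \<otimes> u \<otimes> x) \<in> U" .
      moreover have "\<ominus> (x \<otimes> u \<otimes> y) \<in> peirce i k"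
        using cc uc c peirceD[OF x] peirceD[OF y] by (auto simp: peirce_def l_minus r_minus m_assoc) (metis m_assoc m_closed)
      moreover have "\<ominus> (y \<otimes> u \<otimes> x) \<in> peirce i j"
        using cc uc c peirceD[OF x] peirceD[OF y] by (auto simp: peirce_def l_minus r_minus m_assoc) (metis m_assoc m_closed)
      ultimately have "\<ominus> (y \<otimes> u \<otimes> x) = \<zero>" using pair[of i k j] ki j by simp
      then have "\<ominus> (\<ominus> (y \<otimes> u \<otimes> x)) = \<ominus> \<zero>" by simp
      then show ?thesis using cc uc by simp
    qed
    let ?u = "e k \<otimes> u \<otimes> e i"
    have uc': "?u \<in> carrier R" using uc c by simp
    have "e i \<otimes> s \<otimes> ?u \<otimes> t \<otimes> e j = \<zero>" if st: "s \<in> carrier R" "t \<in> carrier R" for s t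
    proof -
      have "(e i \<otimes> s \<otimes> e k) \<otimes> u \<otimes> (e i \<otimes> t \<otimes> e j) = \<zero>"
        using st ki j by (intro 1 peirceI) auto
      then show ?thesis using st uc c by (simp add: m_assoc)
    qed
    then have "e i \<otimes> s \<otimes> ?u = \<zero>" if "s \<in> carrier R" for s
      using prime_ring[of "e i \<otimes> s \<otimes> ?u" "e j"] that c uc' idem_nonzero[OF j(1)] by auto
    then show ?thesis using prime_ring[of "e i" ?u] c uc' idem_nonzero[OF ki(2)] by auto
  qed
  have com: "x \<otimes> u = u \<otimes> x" if ij: "i < 3" "j < 3" "i \<noteq> j" and x: "x \<in> peirce i j" for i j x
  proof -
    obtain k where k: "k < 3" "k \<noteq> i" "k \<noteq> j" using three_cases[OF ij] by blast
    note xD = peirceD[OF x]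
    have c: "e i \<in> carrier R" "e j \<in> carrier R" "e k \<in> carrier R" using ij k by (auto intro: idem_closed)
    have s: "e i \<oplus> e j \<oplus> e k = \<one>" using idem_sum_distinct ij k by simp
    have "u \<otimes> e i = (e i \<oplus> e j \<oplus> e k) \<otimes> u \<otimes> e i" using s uc c by simp
    also have "\<dots> = e i \<otimes> u \<otimes> e i" using off[of j i] off[of k i] ij k uc c by (simp add: l_distr)
    finally have ui: "u \<otimes> e i = e i \<otimes> u \<otimes> e i" .
    have "e j \<otimes> u = e j \<otimes> u \<otimes> (e i \<oplus> e j \<oplus> e k)" using s uc c by simp
    also have "\<dots> = e j \<otimes> u \<otimes> e j" using off[of j i] off[of j k] ij k uc c by (simp add: r_distr)
    finally have uj: "e j \<otimes> u = e j \<otimes> u \<otimes> e j" .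
    have xu: "x \<otimes> u \<otimes> e j = x \<otimes> u" using xD uc c uj by (metis m_assoc m_closed)
    have ux: "e i \<otimes> (u \<otimes> x) = u \<otimes> x" using xD uc c ui by (metis m_assoc m_closed)
    have "e i \<otimes> (x \<otimes> u) = x \<otimes> u" "u \<otimes> x \<otimes> e j = u \<otimes> x"
      using xD uc c by (metis m_assoc)+
    then have "x \<otimes> u \<ominus> u \<otimes> x \<in> peirce i j"
      using xu ux xD uc c by (simp add: peirce_def r_distr l_distr minus_eq l_minus r_minus)
    then have "x \<otimes> u \<ominus> u \<otimes> x = \<zero>" using triv[OF ij] ad[OF ij x u] by simp
    then show ?thesis using minus_equality[of "x \<otimes> u" "\<ominus> (u \<otimes> x)"] xD(1) uc by (simp add: minus_eq)
  qed
  let ?C = "{z \<in> carrier R. z \<otimes> u = u \<otimes> z}"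
  have "carrier R \<subseteq> ?C"
  proof (rule offdiagonal_generate)
    show "additive_subgroup ?C R"
      using uc by (intro additive_subgroupI) (auto simp: l_distr r_distr l_minus r_minus)
    fix x y assume "x \<in> ?C" "y \<in> ?C"
    with uc show "x \<otimes> y \<in> ?C" by simp (metis m_assoc)
  qed (use com peirceD in auto)
  then show ?thesis using z by auto
qed

theorem lie_ideal_dichotomy:
  "(\<forall>u\<in>U. \<forall>z\<in>carrier R. z \<otimes> u = u \<otimes> z) \<or> (\<forall>a\<in>carrier R. \<forall>b\<in>carrier R. a \<otimes> b \<ominus> b \<otimes> a \<in> U)"
proof (cases "\<exists>i j x. i < 3 \<and> j < 3 \<and> i \<noteq> j \<and> x \<in> peirce i j \<and> x \<in> U \<and> x \<noteq> \<zero>")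
  case True
  then obtain i j x where x: "i < 3" "j < 3" "i \<noteq> j" "x \<in> peirce i j" "x \<in> U" "x \<noteq> \<zero>" by blast
  have "peirce k l \<subseteq> U" if "k < 3" "l < 3" "k \<noteq> l" for k l
    using all_offdiagonal_in_U[OF peirce_in_U[OF x(5,4,6) x(1-3)] x(1-3) that] .
  then show ?thesis using commutators_in_U by blast
next
  case False
  then show ?thesis using no_offdiagonal_central by blast
qed

end

end

section \<open>Corners of simple algebras\<close>

lemma (in abelian_group) a_inv_restrict:
  assumes "abelian_group (G\<lparr>carrier := H\<rparr>)" "x \<in> H" "H \<subseteq> carrier G"
  shows "a_inv (G\<lparr>carrier := H\<rparr>) x = \<ominus> x"
proof -
  interpret H: abelian_group "G\<lparr>carrier := H\<rparr>" by fact
  have "a_inv (G\<lparr>carrier := H\<rparr>) x \<in> H" using H.a_inv_closed[of x] assms(2) by simp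
  moreover have "a_inv (G\<lparr>carrier := H\<rparr>) x \<oplus> x = \<zero>" using H.l_neg[of x] assms(2) by simp
  ultimately have "\<ominus> x = a_inv (G\<lparr>carrier := H\<rparr>) x"
    using assms(2,3) by (intro minus_equality) auto
  then show ?thesis by simp
qed

context assoc_algebra
begin

lemma minus_zero: "\<ominus>\<^bsub>A\<^esub> \<zero>\<^bsub>A\<^esub> = \<zero>\<^bsub>A\<^esub>"
  by (rule M.minus_equality) simp_all

lemma mult_zero_right: "x \<in> carrier A \<Longrightarrow> x \<otimes>\<^bsub>A\<^esub> \<zero>\<^bsub>A\<^esub> = \<zero>\<^bsub>A\<^esub>"
  using mult_r_distr[of "\<zero>\<^bsub>A\<^esub>" "\<zero>\<^bsub>A\<^esub>" x] mult_closed[of x "\<zero>\<^bsub>A\<^esub>"] by simp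

lemma mult_zero_left: "x \<in> carrier A \<Longrightarrow> \<zero>\<^bsub>A\<^esub> \<otimes>\<^bsub>A\<^esub> x = \<zero>\<^bsub>A\<^esub>"
  using mult_l_distr[of "\<zero>\<^bsub>A\<^esub>" "\<zero>\<^bsub>A\<^esub>" x] mult_closed[of "\<zero>\<^bsub>A\<^esub>" x] by simp

lemma mult_minus_right:
  assumes "x \<in> carrier A" "y \<in> carrier A"
  shows "x \<otimes>\<^bsub>A\<^esub> (\<ominus>\<^bsub>A\<^esub> y) = \<ominus>\<^bsub>A\<^esub> (x \<otimes>\<^bsub>A\<^esub> y)"
proof -
  have "x \<otimes>\<^bsub>A\<^esub> (\<ominus>\<^bsub>A\<^esub> y) \<oplus>\<^bsub>A\<^esub> x \<otimes>\<^bsub>A\<^esub> y = \<zero>\<^bsub>A\<^esub>"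
    using mult_r_distr[of "\<ominus>\<^bsub>A\<^esub> y" y x] assms by (simp add: mult_zero_right M.l_neg)
  then show ?thesis
    using M.minus_equality[of "x \<otimes>\<^bsub>A\<^esub> (\<ominus>\<^bsub>A\<^esub> y)" "x \<otimes>\<^bsub>A\<^esub> y"] assms by (simp add: mult_closed)
qed

lemma mult_minus_left:
  assumes "x \<in> carrier A" "y \<in> carrier A"
  shows "(\<ominus>\<^bsub>A\<^esub> x) \<otimes>\<^bsub>A\<^esub> y = \<ominus>\<^bsub>A\<^esub> (x \<otimes>\<^bsub>A\<^esub> y)"
proof -
  have "(\<ominus>\<^bsub>A\<^esub> x) \<otimes>\<^bsub>A\<^esub> y \<oplus>\<^bsub>A\<^esub> x \<otimes>\<^bsub>A\<^esub> y = \<zero>\<^bsub>A\<^esub>"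
    using mult_l_distr[of "\<ominus>\<^bsub>A\<^esub> x" x y] assms by (simp add: mult_zero_left M.l_neg)
  then show ?thesis
    using M.minus_equality[of "(\<ominus>\<^bsub>A\<^esub> x) \<otimes>\<^bsub>A\<^esub> y" "x \<otimes>\<^bsub>A\<^esub> y"] assms by (simp add: mult_closed)
qed

lemmas mult_simps = mult_closed mult_zero_right mult_zero_left mult_minus_right mult_minus_left
  mult_l_distr mult_r_distr

lemma commutator_closed: "x \<in> carrier A \<Longrightarrow> y \<in> carrier A \<Longrightarrow> commutator A x y \<in> carrier A"
  by (simp add: commutator_def mult_closed)

definition corner :: "'c \<Rightarrow> 'c set" where
  "corner p = {x \<in> carrier A. p \<otimes>\<^bsub>A\<^esub> x = x \<and> x \<otimes>\<^bsub>A\<^esub> p = x}"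

text \<open>
  Algebras are not assumed to be unital, whereas a corner \<open>pAp\<close> is a ring with unit \<open>p\<close>. The
  additive and multiplicative operations are those of the algebra, but \<^const>\<open>a_inv\<close> refers to the
  carrier and has to be compared separately.
\<close>

abbreviation corner_ring :: "'c \<Rightarrow> ('a, 'c, 'd) module_scheme" where
  "corner_ring p \<equiv> A\<lparr>carrier := corner p, one := p\<rparr>"

lemma cornerI:
  assumes "x \<in> carrier A" "p \<in> carrier A" "p \<otimes>\<^bsub>A\<^esub> p = p"
  shows "p \<otimes>\<^bsub>A\<^esub> x \<otimes>\<^bsub>A\<^esub> p \<in> corner p"
proof -
  have "p \<otimes>\<^bsub>A\<^esub> (p \<otimes>\<^bsub>A\<^esub> x \<otimes>\<^bsub>A\<^esub> p) = (p \<otimes>\<^bsub>A\<^esub> p) \<otimes>\<^bsub>A\<^esub> x \<otimes>\<^bsub>A\<^esub> p" "p \<otimes>\<^bsub>A\<^esub> x \<otimes>\<^bsub>A\<^esub> p \<otimes>\<^bsub>A\<^esub> p = p \<otimes>\<^bsub>A\<^esub> x \<otimes>\<^bsub>A\<^esub> (p \<otimes>\<^bsub>A\<^esub> p)"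
    using assms(1,2) by (simp_all add: mult_assoc mult_closed)
  then show ?thesis using assms by (simp add: corner_def mult_closed)
qed

lemma ring_corner:
  assumes p: "p \<in> carrier A" "p \<otimes>\<^bsub>A\<^esub> p = p"
  shows "ring (corner_ring p)"
proof (rule ringI)
  show "abelian_group (corner_ring p)"
  proof (rule abelian_groupI)
    fix x assume "x \<in> carrier (corner_ring p)"
    then have "\<ominus>\<^bsub>A\<^esub> x \<in> carrier (corner_ring p)" "\<ominus>\<^bsub>A\<^esub> x \<oplus>\<^bsub>A\<^esub> x = \<zero>\<^bsub>A\<^esub>"
      using p by (auto simp: corner_def mult_simps M.l_neg)
    then show "\<exists>y\<in>carrier (corner_ring p). y \<oplus>\<^bsub>corner_ring p\<^esub> x = \<zero>\<^bsub>corner_ring p\<^esub>" by auto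
  qed (use p in \<open>auto simp: corner_def mult_simps M.a_ac\<close>)
  show "monoid (corner_ring p)"
  proof (rule monoidI)
    fix x y assume xy: "x \<in> carrier (corner_ring p)" "y \<in> carrier (corner_ring p)"
    then have "p \<otimes>\<^bsub>A\<^esub> (x \<otimes>\<^bsub>A\<^esub> y) = p \<otimes>\<^bsub>A\<^esub> x \<otimes>\<^bsub>A\<^esub> y" "x \<otimes>\<^bsub>A\<^esub> y \<otimes>\<^bsub>A\<^esub> p = x \<otimes>\<^bsub>A\<^esub> (y \<otimes>\<^bsub>A\<^esub> p)"
      using p mult_assoc[of p x y] mult_assoc[of x y p] by (auto simp: corner_def)
    then show "x \<otimes>\<^bsub>corner_ring p\<^esub> y \<in> carrier (corner_ring p)"
      using p xy by (simp add: corner_def mult_closed)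
  qed (use p in \<open>auto simp: corner_def mult_assoc\<close>)
qed (use p in \<open>auto simp: corner_def mult_simps\<close>)

lemma a_inv_corner:
  assumes p: "p \<in> carrier A" "p \<otimes>\<^bsub>A\<^esub> p = p" and x: "x \<in> corner p"
  shows "a_inv (corner_ring p) x = \<ominus>\<^bsub>A\<^esub> x"
proof -
  interpret R: ring "corner_ring p" using p by (rule ring_corner)
  have "a_inv (corner_ring p) x \<in> corner p" using R.a_inv_closed[of x] x by simp
  moreover have "a_inv (corner_ring p) x \<oplus>\<^bsub>A\<^esub> x = \<zero>\<^bsub>A\<^esub>" using R.l_neg[of x] x by simp
  ultimately have "\<ominus>\<^bsub>A\<^esub> x = a_inv (corner_ring p) x"
    using x by (intro M.minus_equality) (auto simp: corner_def)
  then show ?thesis by simp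
qed

lemma minus_corner:
  assumes p: "p \<in> carrier A" "p \<otimes>\<^bsub>A\<^esub> p = p" and "x \<in> corner p" "y \<in> corner p"
  shows "x \<ominus>\<^bsub>corner_ring p\<^esub> y = x \<ominus>\<^bsub>A\<^esub> y"
  using assms by (simp add: a_minus_def a_inv_corner)

end

context simple_algebra
begin

text \<open>
  The elements \<open>y\<close> with \<open>p a y b p \<in> H\<close> for all \<open>a\<close> and \<open>b\<close> form an ideal of the whole algebra that
  contains \<open>x\<close>, so simplicity of the algebra passes to the corner.
\<close>

lemma corner_full:
  assumes p: "p \<in> carrier A" "p \<otimes>\<^bsub>A\<^esub> p = p"
    and H: "additive_subgroup H (corner_ring p)"
    and x: "x \<in> corner p" "x \<noteq> \<zero>\<^bsub>A\<^esub>"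
    and m: "\<And>a b. a \<in> corner p \<Longrightarrow> b \<in> corner p \<Longrightarrow> a \<otimes>\<^bsub>A\<^esub> x \<otimes>\<^bsub>A\<^esub> b \<in> H"
  shows "corner p \<subseteq> H"
proof
  fix y assume y: "y \<in> corner p"
  interpret R: ring "corner_ring p" using p by (rule ring_corner)
  interpret H: additive_subgroup H "corner_ring p" by fact
  have zH: "\<zero>\<^bsub>A\<^esub> \<in> H" and aH: "\<And>x y. x \<in> H \<Longrightarrow> y \<in> H \<Longrightarrow> x \<oplus>\<^bsub>A\<^esub> y \<in> H"
    using H.zero_closed H.a_closed by auto
  have mH: "\<ominus>\<^bsub>A\<^esub> x \<in> H" if "x \<in> H" for x
  proof -
    have "x \<in> corner p" using H.a_subset that by auto
    then show ?thesis using H.a_inv_closed[OF that] by (simp only: a_inv_corner[OF p])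
  qed
  let ?I = "{y \<in> carrier A. \<forall>a\<in>carrier A. \<forall>b\<in>carrier A. p \<otimes>\<^bsub>A\<^esub> (a \<otimes>\<^bsub>A\<^esub> y \<otimes>\<^bsub>A\<^esub> b) \<otimes>\<^bsub>A\<^esub> p \<in> H}"
  have "algebra_ideal K A ?I"
    unfolding algebra_ideal_def
  proof (intro conjI ballI submoduleI)
    fix c y assume c: "c \<in> carrier K" and y: "y \<in> ?I"
    have "p \<otimes>\<^bsub>A\<^esub> (a \<otimes>\<^bsub>A\<^esub> (c \<odot>\<^bsub>A\<^esub> y) \<otimes>\<^bsub>A\<^esub> b) \<otimes>\<^bsub>A\<^esub> p = p \<otimes>\<^bsub>A\<^esub> ((c \<odot>\<^bsub>A\<^esub> a) \<otimes>\<^bsub>A\<^esub> y \<otimes>\<^bsub>A\<^esub> b) \<otimes>\<^bsub>A\<^esub> p"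
      if "a \<in> carrier A" "b \<in> carrier A" for a b
      using that c y by (simp add: smult_mult_l smult_mult_r mult_closed)
    then show "c \<odot>\<^bsub>A\<^esub> y \<in> ?I" using c y by simp
  next
    fix x y assume x: "x \<in> carrier A" and y: "y \<in> ?I"
    have "a \<otimes>\<^bsub>A\<^esub> (x \<otimes>\<^bsub>A\<^esub> y) \<otimes>\<^bsub>A\<^esub> b = (a \<otimes>\<^bsub>A\<^esub> x) \<otimes>\<^bsub>A\<^esub> y \<otimes>\<^bsub>A\<^esub> b" "a \<otimes>\<^bsub>A\<^esub> (y \<otimes>\<^bsub>A\<^esub> x) \<otimes>\<^bsub>A\<^esub> b = a \<otimes>\<^bsub>A\<^esub> y \<otimes>\<^bsub>A\<^esub> (x \<otimes>\<^bsub>A\<^esub> b)"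
      if "a \<in> carrier A" "b \<in> carrier A" for a b
      using that x y by (simp_all add: mult_assoc mult_closed)
    then show "x \<otimes>\<^bsub>A\<^esub> y \<in> ?I" "y \<otimes>\<^bsub>A\<^esub> x \<in> ?I" using x y by (simp_all add: mult_closed)
  qed (use p zH aH mH in \<open>auto simp: mult_simps\<close>)
  moreover have "x \<in> ?I"
  proof -
    have "p \<otimes>\<^bsub>A\<^esub> (a \<otimes>\<^bsub>A\<^esub> x \<otimes>\<^bsub>A\<^esub> b) \<otimes>\<^bsub>A\<^esub> p \<in> H" if ab: "a \<in> carrier A" "b \<in> carrier A" for a b
    proof -
      have xc: "x \<in> carrier A" "p \<otimes>\<^bsub>A\<^esub> x = x" "x \<otimes>\<^bsub>A\<^esub> p = x" using x by (auto simp: corner_def)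
      have "(p \<otimes>\<^bsub>A\<^esub> a \<otimes>\<^bsub>A\<^esub> p) \<otimes>\<^bsub>A\<^esub> x \<otimes>\<^bsub>A\<^esub> (p \<otimes>\<^bsub>A\<^esub> b \<otimes>\<^bsub>A\<^esub> p) = p \<otimes>\<^bsub>A\<^esub> a \<otimes>\<^bsub>A\<^esub> (p \<otimes>\<^bsub>A\<^esub> x \<otimes>\<^bsub>A\<^esub> p) \<otimes>\<^bsub>A\<^esub> b \<otimes>\<^bsub>A\<^esub> p"
        using ab p(1) xc(1) by (simp add: mult_assoc mult_closed)
      also have "\<dots> = p \<otimes>\<^bsub>A\<^esub> (a \<otimes>\<^bsub>A\<^esub> x \<otimes>\<^bsub>A\<^esub> b) \<otimes>\<^bsub>A\<^esub> p"
        using ab p(1) xc by (simp add: mult_assoc mult_closed)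
      finally show ?thesis using m[OF cornerI[OF ab(1) p] cornerI[OF ab(2) p]] by simp
    qed
    then show ?thesis using x by (simp add: corner_def)
  qed
  ultimately have "?I = carrier A" using ideal_trivial[of ?I] x(2) by blast
  then have "y \<in> ?I" using y by (simp add: corner_def)
  then have "p \<otimes>\<^bsub>A\<^esub> (p \<otimes>\<^bsub>A\<^esub> y \<otimes>\<^bsub>A\<^esub> p) \<otimes>\<^bsub>A\<^esub> p \<in> H" using p by simp
  then show "y \<in> H" using y by (simp add: corner_def)
qed

end

locale algebra_many_idempotents = simple_algebra K A for K (structure) and A (structure) +
  assumes idempotents: "\<lbrakk>finite F; F \<subseteq> carrier A\<rbrakk> \<Longrightarrow> \<exists>e :: nat \<Rightarrow> 'c.
      (\<forall>i<3. e i \<in> carrier A \<and> e i \<noteq> \<zero>\<^bsub>A\<^esub>) \<and>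
      (\<forall>i<3. \<forall>j<3. e i \<otimes>\<^bsub>A\<^esub> e j = (if i = j then e i else \<zero>\<^bsub>A\<^esub>)) \<and>
      (\<forall>x\<in>F. (e 0 \<oplus>\<^bsub>A\<^esub> e 1 \<oplus>\<^bsub>A\<^esub> e 2) \<otimes>\<^bsub>A\<^esub> x = x \<and> x \<otimes>\<^bsub>A\<^esub> (e 0 \<oplus>\<^bsub>A\<^esub> e 1 \<oplus>\<^bsub>A\<^esub> e 2) = x)"
begin

lemma corner_three_idempotents:
  assumes "finite F" "F \<subseteq> carrier A"
  obtains p e where "p \<in> carrier A" "p \<otimes>\<^bsub>A\<^esub> p = p" "F \<subseteq> corner p" "three_idempotents (corner_ring p) e"
proof -
  obtain e :: "nat \<Rightarrow> 'c" where E: "(\<forall>i<3. e i \<in> carrier A \<and> e i \<noteq> \<zero>\<^bsub>A\<^esub>) \<and>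
      (\<forall>i<3. \<forall>j<3. e i \<otimes>\<^bsub>A\<^esub> e j = (if i = j then e i else \<zero>\<^bsub>A\<^esub>)) \<and>
      (\<forall>x\<in>F. (e 0 \<oplus>\<^bsub>A\<^esub> e 1 \<oplus>\<^bsub>A\<^esub> e 2) \<otimes>\<^bsub>A\<^esub> x = x \<and> x \<otimes>\<^bsub>A\<^esub> (e 0 \<oplus>\<^bsub>A\<^esub> e 1 \<oplus>\<^bsub>A\<^esub> e 2) = x)"
    using idempotents[OF assms] by (elim exE)
  then have e: "\<And>i. i < 3 \<Longrightarrow> e i \<in> carrier A" "\<And>i. i < 3 \<Longrightarrow> e i \<noteq> \<zero>\<^bsub>A\<^esub>"
      "\<And>i j. i < 3 \<Longrightarrow> j < 3 \<Longrightarrow> e i \<otimes>\<^bsub>A\<^esub> e j = (if i = j then e i else \<zero>\<^bsub>A\<^esub>)"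
      "\<And>x. x \<in> F \<Longrightarrow> (e 0 \<oplus>\<^bsub>A\<^esub> e 1 \<oplus>\<^bsub>A\<^esub> e 2) \<otimes>\<^bsub>A\<^esub> x = x \<and> x \<otimes>\<^bsub>A\<^esub> (e 0 \<oplus>\<^bsub>A\<^esub> e 1 \<oplus>\<^bsub>A\<^esub> e 2) = x"
    by (simp_all only: HOL.simp_thms)
  define p where "p = e 0 \<oplus>\<^bsub>A\<^esub> e 1 \<oplus>\<^bsub>A\<^esub> e 2"
  have c: "e 0 \<in> carrier A" "e 1 \<in> carrier A" "e 2 \<in> carrier A" using e(1) by auto
  have p: "p \<in> carrier A" using c by (simp add: p_def)
  have pe: "p \<otimes>\<^bsub>A\<^esub> e i = e i" "e i \<otimes>\<^bsub>A\<^esub> p = e i" if "i < 3" for i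
    using less_3_cases[OF that] c e(3) by (auto simp: p_def mult_l_distr mult_r_distr)
  have "p \<otimes>\<^bsub>A\<^esub> p = p \<otimes>\<^bsub>A\<^esub> e 0 \<oplus>\<^bsub>A\<^esub> p \<otimes>\<^bsub>A\<^esub> e 1 \<oplus>\<^bsub>A\<^esub> p \<otimes>\<^bsub>A\<^esub> e 2"
    unfolding p_def using c by (simp add: mult_r_distr mult_closed)
  then have pp: "p \<otimes>\<^bsub>A\<^esub> p = p" using pe by (simp add: p_def)
  have ec: "e i \<in> corner p" if "i < 3" for i using that pe e(1) by (simp add: corner_def)
  have "three_idempotents (corner_ring p) e"
  proof (intro three_idempotents.intro three_idempotents_axioms.intro ring_corner p pp)
    fix H x assume "additive_subgroup H (corner_ring p)" "x \<in> carrier (corner_ring p)" "x \<noteq> \<zero>\<^bsub>corner_ring p\<^esub>"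
      "\<And>a b. a \<in> carrier (corner_ring p) \<Longrightarrow> b \<in> carrier (corner_ring p) \<Longrightarrow>
         a \<otimes>\<^bsub>corner_ring p\<^esub> x \<otimes>\<^bsub>corner_ring p\<^esub> b \<in> H"
    then show "carrier (corner_ring p) \<subseteq> H" using corner_full[OF p pp, of H x] by simp
  qed (use ec e in \<open>auto simp: p_def\<close>)
  moreover have "F \<subseteq> corner p" using e(4) assms(2) by (auto simp: corner_def p_def)
  ultimately show ?thesis using that p pp by blast
qed

text \<open>
  If \<open>u\<close> in \<open>U\<close> does not commute with \<open>z\<close>, and \<open>[a, b]\<close> is not in \<open>U\<close>, then already the corner that
  contains these four elements contradicts the dichotomy for unital rings. Off-diagonal elements
  of a corner are commutators, \<open>x = [e\<^sub>i, x]\<close>, so it suffices that \<open>U\<close> is stable under commutators.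
\<close>

theorem lie_ideal_dichotomy:
  assumes U: "additive_subgroup U A"
    and ad: "\<And>a b u. \<lbrakk>a \<in> carrier A; b \<in> carrier A; u \<in> U\<rbrakk> \<Longrightarrow> commutator A (commutator A a b) u \<in> U"
  shows "(\<forall>u\<in>U. \<forall>z\<in>carrier A. z \<otimes>\<^bsub>A\<^esub> u = u \<otimes>\<^bsub>A\<^esub> z) \<or> (\<forall>a\<in>carrier A. \<forall>b\<in>carrier A. commutator A a b \<in> U)"
proof (rule ccontr)
  assume neg: "\<not> ?thesis"
  interpret U: additive_subgroup U A by fact
  from neg obtain u z a b where uz: "u \<in> U" "z \<in> carrier A" "z \<otimes>\<^bsub>A\<^esub> u \<noteq> u \<otimes>\<^bsub>A\<^esub> z"
    and ab: "a \<in> carrier A" "b \<in> carrier A" "commutator A a b \<notin> U" by blast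
  obtain p e where p: "p \<in> carrier A" "p \<otimes>\<^bsub>A\<^esub> p = p" and F: "{u, z, a, b} \<subseteq> corner p"
    and three: "three_idempotents (corner_ring p) e"
  proof (rule corner_three_idempotents)
    show "finite {u, z, a, b}" "{u, z, a, b} \<subseteq> carrier A" using uz ab U.a_subset by auto
  qed
  interpret R: three_idempotents "corner_ring p" e by (rule three)
  have sub: "corner p \<subseteq> carrier A" by (auto simp: corner_def)
  let ?U = "U \<inter> corner p"
  have "(\<forall>u\<in>?U. \<forall>z\<in>carrier (corner_ring p). z \<otimes>\<^bsub>corner_ring p\<^esub> u = u \<otimes>\<^bsub>corner_ring p\<^esub> z) \<or>
      (\<forall>a\<in>carrier (corner_ring p). \<forall>b\<in>carrier (corner_ring p).
         a \<otimes>\<^bsub>corner_ring p\<^esub> b \<ominus>\<^bsub>corner_ring p\<^esub> b \<otimes>\<^bsub>corner_ring p\<^esub> a \<in> ?U)"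
  proof (rule R.lie_ideal_dichotomy)
    show "additive_subgroup ?U (corner_ring p)"
    proof (rule R.additive_subgroupI)
      show "\<zero>\<^bsub>corner_ring p\<^esub> \<in> ?U" using U.zero_closed R.zero_closed by simp
      fix x y assume x: "x \<in> ?U" and y: "y \<in> ?U"
      show "x \<oplus>\<^bsub>corner_ring p\<^esub> y \<in> ?U" using x y U.a_closed[of x y] R.a_closed[of x y] by simp
      show "a_inv (corner_ring p) x \<in> ?U"
        using x U.a_inv_closed[of x] R.a_inv_closed[of x] a_inv_corner[OF p, of x] by simp
    qed auto
    fix i j x u assume ij: "i < 3" "j < 3" "i \<noteq> j" and x: "x \<in> R.peirce i j" and u: "u \<in> ?U"
    have xc: "x \<in> corner p" and uc: "u \<in> corner p" and uU: "u \<in> U" using R.peirceD[OF x] u by auto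
    have ei: "e i \<in> corner p" using R.idem_closed[OF ij(1)] by simp
    have "x \<otimes>\<^bsub>A\<^esub> e i = \<zero>\<^bsub>A\<^esub>"
      using R.peirce_mult_zero[OF x R.idem_peirce[OF ij(1)]] ij by simp
    then have "x = commutator A (e i) x"
      using R.peirceD(2)[OF x] xc sub by (auto simp: commutator_def M.minus_eq minus_zero)
    then have "commutator A x u \<in> U" using ad[of "e i" x u] uU xc ei sub by auto
    moreover have "x \<otimes>\<^bsub>A\<^esub> u \<ominus>\<^bsub>corner_ring p\<^esub> u \<otimes>\<^bsub>A\<^esub> x \<in> corner p"
      using R.minus_closed[of "x \<otimes>\<^bsub>A\<^esub> u" "u \<otimes>\<^bsub>A\<^esub> x"] R.m_closed[of x u] R.m_closed[of u x] xc uc by simp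
    moreover have "x \<otimes>\<^bsub>A\<^esub> u \<ominus>\<^bsub>corner_ring p\<^esub> u \<otimes>\<^bsub>A\<^esub> x = commutator A x u"
      using minus_corner[OF p] R.m_closed[of x u] R.m_closed[of u x] xc uc by (simp add: commutator_def)
    ultimately show "x \<otimes>\<^bsub>corner_ring p\<^esub> u \<ominus>\<^bsub>corner_ring p\<^esub> u \<otimes>\<^bsub>corner_ring p\<^esub> x \<in> ?U" by simp
  qed
  then show False
  proof
    assume "\<forall>u\<in>?U. \<forall>z\<in>carrier (corner_ring p). z \<otimes>\<^bsub>corner_ring p\<^esub> u = u \<otimes>\<^bsub>corner_ring p\<^esub> z"
    with uz F show False by simp
  next
    assume "\<forall>a\<in>carrier (corner_ring p). \<forall>b\<in>carrier (corner_ring p).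
         a \<otimes>\<^bsub>corner_ring p\<^esub> b \<ominus>\<^bsub>corner_ring p\<^esub> b \<otimes>\<^bsub>corner_ring p\<^esub> a \<in> ?U"
    then have "a \<otimes>\<^bsub>A\<^esub> b \<ominus>\<^bsub>corner_ring p\<^esub> b \<otimes>\<^bsub>A\<^esub> a \<in> U" using F by simp
    moreover have "a \<otimes>\<^bsub>A\<^esub> b \<ominus>\<^bsub>corner_ring p\<^esub> b \<otimes>\<^bsub>A\<^esub> a = commutator A a b"
      using minus_corner[OF p] R.m_closed[of a b] R.m_closed[of b a] F by (simp add: commutator_def)
    ultimately show False using ab by simp
  qed
qed

text \<open>
  For \<open>x\<close> in \<open>A\<^sub>0\<^sub>1\<close> and \<open>y\<close> in \<open>A\<^sub>1\<^sub>2\<close> we have \<open>x = [e\<^sub>0, x]\<close>, \<open>y = [e\<^sub>1, y]\<close> and \<open>[x, y] = xy\<close>, and primeness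
  provides \<open>x\<close> and \<open>y\<close> with \<open>xy \<noteq> 0\<close>.
\<close>

lemma noncommuting_commutators:
  obtains a b c d where "a \<in> carrier A" "b \<in> carrier A" "c \<in> carrier A" "d \<in> carrier A"
    "commutator A (commutator A a b) (commutator A c d) \<noteq> \<zero>\<^bsub>A\<^esub>"
proof -
  obtain p e where p: "p \<in> carrier A" "p \<otimes>\<^bsub>A\<^esub> p = p"
    and three: "three_idempotents (corner_ring p) e"
    by (rule corner_three_idempotents[of "{}"]) simp_all
  interpret R: three_idempotents "corner_ring p" e by (rule three)
  have sub: "corner p \<subseteq> carrier A" by (auto simp: corner_def)
  have ec: "e i \<in> carrier A" "e i \<in> corner p" if "i < 3" for i using R.idem_closed[OF that] sub by auto
  have ee: "e i \<otimes>\<^bsub>A\<^esub> e j = (if i = j then e i else \<zero>\<^bsub>A\<^esub>)" if "i < 3" "j < 3" for i j using R.idem_mult[OF that] by simp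
  have "\<exists>s\<in>corner p. e 0 \<otimes>\<^bsub>A\<^esub> s \<otimes>\<^bsub>A\<^esub> e 1 \<noteq> \<zero>\<^bsub>A\<^esub>"
    using R.prime_ring[of "e 0" "e 1"] R.idem_closed R.idem_nonzero[of 0] R.idem_nonzero[of 1] by auto
  then obtain x where x: "x \<in> R.peirce 0 1" "x \<noteq> \<zero>\<^bsub>A\<^esub>" using R.peirceI[of _ 0 1] by auto
  have "\<exists>t\<in>corner p. x \<otimes>\<^bsub>A\<^esub> t \<otimes>\<^bsub>A\<^esub> e 2 \<noteq> \<zero>\<^bsub>A\<^esub>"
    using R.prime_ring[of x "e 2"] R.peirceD(1)[OF x(1)] R.idem_closed R.idem_nonzero[of 2] x(2) by auto
  then obtain t where t: "t \<in> corner p" "x \<otimes>\<^bsub>A\<^esub> t \<otimes>\<^bsub>A\<^esub> e 2 \<noteq> \<zero>\<^bsub>A\<^esub>" by blast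
  define y where "y = e 1 \<otimes>\<^bsub>A\<^esub> t \<otimes>\<^bsub>A\<^esub> e 2"
  have y: "y \<in> R.peirce 1 2" using R.peirceI[of t 1 2] t by (simp add: y_def)
  have xc: "x \<in> carrier A" and yc: "y \<in> carrier A" and tA: "t \<in> carrier A"
    using R.peirceD(1)[OF x(1)] R.peirceD(1)[OF y] t(1) sub by auto
  have com: "z = commutator A (e i) z" if "z \<in> R.peirce i j" "i < 3" "j < 3" "i \<noteq> j" for z i j
  proof -
    have "z \<otimes>\<^bsub>A\<^esub> e i = \<zero>\<^bsub>A\<^esub>"
      using R.peirce_mult_zero[OF that(1) R.idem_peirce[OF that(2)]] that by simp
    then show ?thesis
      using R.peirceD[OF that(1)] sub by (auto simp: commutator_def M.minus_eq minus_zero)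
  qed
  have "x \<otimes>\<^bsub>A\<^esub> y = x \<otimes>\<^bsub>A\<^esub> e 1 \<otimes>\<^bsub>A\<^esub> t \<otimes>\<^bsub>A\<^esub> e 2"
    using xc ec(1)[of 1] ec(1)[of 2] tA by (simp add: y_def mult_assoc mult_closed)
  also have "\<dots> = x \<otimes>\<^bsub>A\<^esub> t \<otimes>\<^bsub>A\<^esub> e 2" using R.peirceD(3)[OF x(1)] by simp
  finally have 1: "x \<otimes>\<^bsub>A\<^esub> y \<noteq> \<zero>\<^bsub>A\<^esub>" using t(2) by simp
  have "y \<otimes>\<^bsub>A\<^esub> x = \<zero>\<^bsub>A\<^esub>" using R.peirce_mult_zero[OF y x(1)] by simp
  then have "commutator A x y \<noteq> \<zero>\<^bsub>A\<^esub>"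
    using 1 xc yc by (simp add: commutator_def M.minus_eq mult_closed minus_zero)
  then have "commutator A (commutator A (e 0) x) (commutator A (e 1) y) \<noteq> \<zero>\<^bsub>A\<^esub>"
    using com[OF x(1)] com[OF y] by simp
  then show ?thesis using that[of "e 0" x "e 1" y] ec xc yc by simp
qed

end

section \<open>The Lie algebra of commutators\<close>

context assoc_algebra
begin

lemma commutator_space_submodule: "submodule (commutator_space K A) K A"
proof (rule submoduleI)
  let ?S = "{commutator A x y |x y. x \<in> carrier A \<and> y \<in> carrier A}"
  have S: "?S \<subseteq> carrier A" by (auto simp: commutator_closed)
  have car: "submodule (carrier A) K A" by (rule carrier_is_submodule)
  have sub: "x \<in> N" if "x \<in> commutator_space K A" "submodule N K A" "?S \<subseteq> N" for x N
    using that by (auto simp: commutator_space_def linear_span_def)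
  have mem: "x \<in> commutator_space K A" if "\<And>N. submodule N K A \<Longrightarrow> ?S \<subseteq> N \<Longrightarrow> x \<in> N" for x
    using that by (auto simp: commutator_space_def linear_span_def)
  show "commutator_space K A \<subseteq> carrier A" using sub[OF _ car S] by blast
  show "\<zero>\<^bsub>A\<^esub> \<in> commutator_space K A"
  proof (rule mem)
    fix N assume "submodule N K A"
    then interpret N: submodule N K A .
    show "\<zero>\<^bsub>A\<^esub> \<in> N" using N.one_closed by simp
  qed
  fix x assume x: "x \<in> commutator_space K A"
  show "\<ominus>\<^bsub>A\<^esub> x \<in> commutator_space K A"
    by (rule mem) (use sub[OF x] submoduleE(3) in blast)
  show "c \<odot>\<^bsub>A\<^esub> x \<in> commutator_space K A" if "c \<in> carrier K" for c
    by (rule mem) (use sub[OF x] submoduleE(4) that in blast)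
  fix y assume y: "y \<in> commutator_space K A"
  show "x \<oplus>\<^bsub>A\<^esub> y \<in> commutator_space K A"
    by (rule mem) (use sub[OF x] sub[OF y] submoduleE(5) in blast)
qed

lemma commutator_in_commutator_space:
  "x \<in> carrier A \<Longrightarrow> y \<in> carrier A \<Longrightarrow> commutator A x y \<in> commutator_space K A"
  by (auto simp: commutator_space_def linear_span_def)

lemma commutator_space_subset: "commutator_space K A \<subseteq> carrier A"
  using commutator_space_submodule by (rule submoduleE(1))

lemma commutator_space_least:
  assumes "submodule N K A" "\<And>x y. x \<in> carrier A \<Longrightarrow> y \<in> carrier A \<Longrightarrow> commutator A x y \<in> N"
  shows "commutator_space K A \<subseteq> N"
  using assms by (auto simp: commutator_space_def linear_span_def)

lemma jacobi_commutator:
  assumes x: "x \<in> carrier A" and y: "y \<in> carrier A" and z: "z \<in> carrier A"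
  shows "commutator A x (commutator A y z) \<oplus>\<^bsub>A\<^esub> commutator A y (commutator A z x)
    \<oplus>\<^bsub>A\<^esub> commutator A z (commutator A x y) = \<zero>\<^bsub>A\<^esub>"
proof -
  have expand: "commutator A u (commutator A v w) =
      (u \<otimes>\<^bsub>A\<^esub> v \<otimes>\<^bsub>A\<^esub> w \<oplus>\<^bsub>A\<^esub> w \<otimes>\<^bsub>A\<^esub> v \<otimes>\<^bsub>A\<^esub> u) \<oplus>\<^bsub>A\<^esub> \<ominus>\<^bsub>A\<^esub> (u \<otimes>\<^bsub>A\<^esub> w \<otimes>\<^bsub>A\<^esub> v \<oplus>\<^bsub>A\<^esub> v \<otimes>\<^bsub>A\<^esub> w \<otimes>\<^bsub>A\<^esub> u)"
    if "u \<in> carrier A" "v \<in> carrier A" "w \<in> carrier A" for u v w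
    using that by (simp add: commutator_def M.minus_eq mult_simps M.minus_add mult_assoc M.a_ac)
  have cancel: "(a \<oplus>\<^bsub>A\<^esub> d \<oplus>\<^bsub>A\<^esub> \<ominus>\<^bsub>A\<^esub> (b \<oplus>\<^bsub>A\<^esub> c)) \<oplus>\<^bsub>A\<^esub> (c \<oplus>\<^bsub>A\<^esub> b \<oplus>\<^bsub>A\<^esub> \<ominus>\<^bsub>A\<^esub> (f \<oplus>\<^bsub>A\<^esub> g)) \<oplus>\<^bsub>A\<^esub> (g \<oplus>\<^bsub>A\<^esub> f \<oplus>\<^bsub>A\<^esub> \<ominus>\<^bsub>A\<^esub> (d \<oplus>\<^bsub>A\<^esub> a)) = \<zero>\<^bsub>A\<^esub>"
    if "a \<in> carrier A" "b \<in> carrier A" "c \<in> carrier A" "d \<in> carrier A" "f \<in> carrier A" "g \<in> carrier A" for a b c d f g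
  proof -
    have "(a \<oplus>\<^bsub>A\<^esub> d \<oplus>\<^bsub>A\<^esub> \<ominus>\<^bsub>A\<^esub> (b \<oplus>\<^bsub>A\<^esub> c)) \<oplus>\<^bsub>A\<^esub> (c \<oplus>\<^bsub>A\<^esub> b \<oplus>\<^bsub>A\<^esub> \<ominus>\<^bsub>A\<^esub> (f \<oplus>\<^bsub>A\<^esub> g)) \<oplus>\<^bsub>A\<^esub> (g \<oplus>\<^bsub>A\<^esub> f \<oplus>\<^bsub>A\<^esub> \<ominus>\<^bsub>A\<^esub> (d \<oplus>\<^bsub>A\<^esub> a)) =
      (a \<oplus>\<^bsub>A\<^esub> b \<oplus>\<^bsub>A\<^esub> c \<oplus>\<^bsub>A\<^esub> d \<oplus>\<^bsub>A\<^esub> f \<oplus>\<^bsub>A\<^esub> g) \<oplus>\<^bsub>A\<^esub> \<ominus>\<^bsub>A\<^esub> (a \<oplus>\<^bsub>A\<^esub> b \<oplus>\<^bsub>A\<^esub> c \<oplus>\<^bsub>A\<^esub> d \<oplus>\<^bsub>A\<^esub> f \<oplus>\<^bsub>A\<^esub> g)"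
      using that by (simp add: M.minus_add M.a_ac)
    then show ?thesis using that by (simp add: M.r_neg)
  qed
  show ?thesis
    unfolding expand[OF x y z] expand[OF y z x] expand[OF z x y]
    using x y z by (intro cancel mult_closed)
qed

lemma lie_algebra_commutator_space:
  "lie_algebra K (A\<lparr>carrier := commutator_space K A\<rparr>) (commutator A)"
proof -
  let ?L = "commutator_space K A"
  have c: "x \<in> carrier A" if "x \<in> ?L" for x using that commutator_space_subset by blast
  interpret N: submodule ?L K A by (rule commutator_space_submodule)
  have mod: "Module.module K A" by unfold_locales
  show ?thesis
  proof (intro lie_algebra.intro lie_algebra_axioms.intro N.submodule_is_module mod)
    fix x y z a assume "x \<in> carrier (A\<lparr>carrier := ?L\<rparr>)" "y \<in> carrier (A\<lparr>carrier := ?L\<rparr>)" "z \<in> carrier (A\<lparr>carrier := ?L\<rparr>)"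
    then have xyz: "x \<in> carrier A" "y \<in> carrier A" "z \<in> carrier A" using c by simp_all
    show "commutator A x y \<in> carrier (A\<lparr>carrier := ?L\<rparr>)"
      using xyz by (simp add: commutator_in_commutator_space)
    show "commutator A (x \<oplus>\<^bsub>A\<lparr>carrier := ?L\<rparr>\<^esub> y) z = commutator A x z \<oplus>\<^bsub>A\<lparr>carrier := ?L\<rparr>\<^esub> commutator A y z"
      using xyz by (simp add: commutator_def M.minus_eq mult_simps M.minus_add M.a_ac)
    show "commutator A z (x \<oplus>\<^bsub>A\<lparr>carrier := ?L\<rparr>\<^esub> y) = commutator A z x \<oplus>\<^bsub>A\<lparr>carrier := ?L\<rparr>\<^esub> commutator A z y"
      using xyz by (simp add: commutator_def M.minus_eq mult_simps M.minus_add M.a_ac)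
    show "commutator A x x = \<zero>\<^bsub>A\<lparr>carrier := ?L\<rparr>\<^esub>"
      using xyz by (simp add: commutator_def M.minus_eq M.r_neg mult_closed)
    show "commutator A x (commutator A y z) \<oplus>\<^bsub>A\<lparr>carrier := ?L\<rparr>\<^esub> commutator A y (commutator A z x)
        \<oplus>\<^bsub>A\<lparr>carrier := ?L\<rparr>\<^esub> commutator A z (commutator A x y) = \<zero>\<^bsub>A\<lparr>carrier := ?L\<rparr>\<^esub>"
      using jacobi_commutator[OF xyz] by simp
    assume a: "a \<in> carrier K"
    show "commutator A (a \<odot>\<^bsub>A\<lparr>carrier := ?L\<rparr>\<^esub> x) y = a \<odot>\<^bsub>A\<lparr>carrier := ?L\<rparr>\<^esub> commutator A x y"
      "commutator A x (a \<odot>\<^bsub>A\<lparr>carrier := ?L\<rparr>\<^esub> y) = a \<odot>\<^bsub>A\<lparr>carrier := ?L\<rparr>\<^esub> commutator A x y"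
      using xyz a by (simp_all add: commutator_def M.minus_eq smult_mult_l smult_mult_r smult_r_distr smult_r_minus mult_closed)
  qed
qed

end

context algebra_many_idempotents
begin

lemma zero_carrier_update: "\<zero>\<^bsub>A\<lparr>carrier := H\<rparr>\<^esub> = \<zero>\<^bsub>A\<^esub>"
  by simp

text \<open>
  A Lie ideal of \<open>[A,A]\<close> is central, hence zero by assumption, or it contains all commutators.
\<close>

theorem simple_lie_commutator_space:
  assumes centre: "\<And>z. \<lbrakk>z \<in> commutator_space K A; \<And>a. a \<in> carrier A \<Longrightarrow> a \<otimes>\<^bsub>A\<^esub> z = z \<otimes>\<^bsub>A\<^esub> a\<rbrakk> \<Longrightarrow> z = \<zero>\<^bsub>A\<^esub>"
  shows "simple_lie_algebra K (A\<lparr>carrier := commutator_space K A\<rparr>) (commutator A)"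
proof -
  let ?L = "commutator_space K A" and ?M = "A\<lparr>carrier := commutator_space K A\<rparr>"
  interpret L: lie_algebra K ?M "commutator A" by (rule lie_algebra_commutator_space)
  show ?thesis
  proof (intro simple_lie_algebra.intro simple_lie_algebra_axioms.intro lie_algebra_commutator_space)
    obtain a b c d where abcd: "a \<in> carrier A" "b \<in> carrier A" "c \<in> carrier A" "d \<in> carrier A"
      and n: "commutator A (commutator A a b) (commutator A c d) \<noteq> \<zero>\<^bsub>A\<^esub>"
      by (rule noncommuting_commutators)
    have "commutator A (commutator A a b) (commutator A c d) \<in>
      linear_span K ?M {commutator A x y |x y. x \<in> carrier ?M \<and> y \<in> carrier ?M}"
      unfolding linear_span_def
    proof (rule InterI)
      fix N assume "N \<in> {N. submodule N K ?M \<and> {commutator A x y |x y. x \<in> carrier ?M \<and> y \<in> carrier ?M} \<subseteq> N}"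
      then have N: "{commutator A x y |x y. x \<in> carrier ?M \<and> y \<in> carrier ?M} \<subseteq> N" by simp
      have "commutator A a b \<in> carrier ?M" "commutator A c d \<in> carrier ?M"
        using abcd by (simp_all add: commutator_in_commutator_space)
      then show "commutator A (commutator A a b) (commutator A c d) \<in> N"
        by (intro subsetD[OF N] CollectI)
          (rule exI[of _ "commutator A a b"], rule exI[of _ "commutator A c d"], simp only: simp_thms)
    qed
    then show "linear_span K ?M {commutator A x y |x y. x \<in> carrier ?M \<and> y \<in> carrier ?M} \<noteq> {\<zero>\<^bsub>?M\<^esub>}"
      using n by (metis singletonD zero_carrier_update)
  next
    fix I assume "lie_ideal K ?M (commutator A) I"
    then have I: "submodule I K ?M" and ad: "\<And>x u. x \<in> ?L \<Longrightarrow> u \<in> I \<Longrightarrow> commutator A x u \<in> I"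
      by (simp_all add: lie_ideal_def)
    have IL: "I \<subseteq> ?L" using L.submoduleE(1)[OF I] by simp
    have "Module.module K (?M\<lparr>carrier := I\<rparr>)"
      using I by (rule submodule.submodule_is_module) unfold_locales
    then have IA: "submodule I K A"
      using IL commutator_space_subset by (intro module_incl_imp_submodule) auto
    have "additive_subgroup I A"
      using IA by (intro additive_subgroup.intro) (rule submodule.axioms(1))
    then have "(\<forall>u\<in>I. \<forall>z\<in>carrier A. z \<otimes>\<^bsub>A\<^esub> u = u \<otimes>\<^bsub>A\<^esub> z) \<or> (\<forall>a\<in>carrier A. \<forall>b\<in>carrier A. commutator A a b \<in> I)"
      by (rule lie_ideal_dichotomy) (intro ad commutator_in_commutator_space)
    then show "I = {\<zero>\<^bsub>?M\<^esub>} \<or> I = carrier ?M"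
    proof
      assume Z: "\<forall>u\<in>I. \<forall>z\<in>carrier A. z \<otimes>\<^bsub>A\<^esub> u = u \<otimes>\<^bsub>A\<^esub> z"
      have "u \<in> {\<zero>\<^bsub>A\<^esub>}" if "u \<in> I" for u
        unfolding singleton_iff
      proof (rule centre)
        show "u \<in> ?L" using that IL by blast
        show "a \<otimes>\<^bsub>A\<^esub> u = u \<otimes>\<^bsub>A\<^esub> a" if "a \<in> carrier A" for a using Z that \<open>u \<in> I\<close> by blast
      qed
      moreover have "\<zero>\<^bsub>A\<^esub> \<in> I" using subgroup.one_closed[OF submodule.axioms(1)[OF IA]] by simp
      ultimately have "I = {\<zero>\<^bsub>A\<^esub>}" by blast
      then show ?thesis by simp
    next
      assume "\<forall>a\<in>carrier A. \<forall>b\<in>carrier A. commutator A a b \<in> I"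
      then have "?L \<subseteq> I" by (intro commutator_space_least IA) simp
      then show ?thesis using IL by simp
    qed
  qed
qed

end

text \<open>
  If the unit \<open>u\<close> were in \<open>[A,A]\<close>, its multiples would form a non-zero Lie ideal. By simplicity they
  would be all of \<open>[A,A]\<close>, and all brackets of \<open>[A,A]\<close> would vanish.
\<close>

lemma (in assoc_algebra) simple_lie_imp_unit_notin_commutator_space:
  assumes simple: "simple_lie_algebra K (A\<lparr>carrier := commutator_space K A\<rparr>) (commutator A)"
    and u: "u \<in> carrier A" "u \<noteq> \<zero>\<^bsub>A\<^esub>" "\<And>a. a \<in> carrier A \<Longrightarrow> a \<otimes>\<^bsub>A\<^esub> u = a \<and> u \<otimes>\<^bsub>A\<^esub> a = a"
  shows "u \<notin> commutator_space K A"
proof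
  let ?L = "commutator_space K A" and ?M = "A\<lparr>carrier := commutator_space K A\<rparr>"
  assume uL: "u \<in> ?L"
  interpret L: simple_lie_algebra K ?M "commutator A" by fact
  have com: "commutator A x (c \<odot>\<^bsub>A\<^esub> u) = \<zero>\<^bsub>A\<^esub>" if "x \<in> carrier A" "c \<in> carrier K" for x c
    using that u by (simp add: commutator_def smult_mult_l smult_mult_r M.minus_eq M.r_neg)
  let ?I = "(\<lambda>c. c \<odot>\<^bsub>A\<^esub> u) ` carrier K"
  have sub: "?I \<subseteq> ?L" using submoduleE(4)[OF commutator_space_submodule] uL by auto
  have "submodule ?I K ?M"
  proof (rule L.submoduleI)
    show "\<zero>\<^bsub>?M\<^esub> \<in> ?I" using u by (intro image_eqI[of _ _ "\<zero>\<^bsub>K\<^esub>"]) auto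
    fix a b assume "a \<in> ?I" "b \<in> ?I"
    then obtain c d where c: "c \<in> carrier K" "a = c \<odot>\<^bsub>A\<^esub> u" and d: "d \<in> carrier K" "b = d \<odot>\<^bsub>A\<^esub> u" by auto
    show "a \<oplus>\<^bsub>?M\<^esub> b \<in> ?I" using u c d by (intro image_eqI[of _ _ "c \<oplus>\<^bsub>K\<^esub> d"]) (auto simp: smult_l_distr)
    have "a_inv ?M a = \<ominus>\<^bsub>A\<^esub> a"
      using sub \<open>a \<in> ?I\<close> commutator_space_subset by (intro M.a_inv_restrict L.abelian_group_axioms) auto
    also have "\<dots> = (\<ominus>\<^bsub>K\<^esub> c) \<odot>\<^bsub>A\<^esub> u" using c u by (simp add: smult_l_minus)
    finally show "a_inv ?M a \<in> ?I" using c by auto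
  next
    fix c a assume "c \<in> carrier K" "a \<in> ?I"
    then show "c \<odot>\<^bsub>?M\<^esub> a \<in> ?I" using u by (auto simp: smult_assoc1[symmetric])
  qed (use sub in auto)
  moreover have "commutator A x a \<in> ?I" if "x \<in> ?L" "a \<in> ?I" for x a
  proof -
    have "commutator A x a = \<zero>\<^bsub>A\<^esub>" using com that commutator_space_subset by auto
    also have "\<dots> = \<zero>\<^bsub>K\<^esub> \<odot>\<^bsub>A\<^esub> u" using u by simp
    finally show ?thesis by auto
  qed
  ultimately have "lie_ideal K ?M (commutator A) ?I" by (auto simp: lie_ideal_def)
  then have "?I = {\<zero>\<^bsub>A\<^esub>} \<or> ?I = ?L" using L.lie_ideal_trivial by fastforce
  moreover have "u \<in> ?I" using u by (intro image_eqI[of _ _ "\<one>\<^bsub>K\<^esub>"]) auto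
  ultimately have L: "?L = ?I" using u(2) by auto
  have "commutator A x y = \<zero>\<^bsub>A\<^esub>" if "x \<in> ?L" "y \<in> ?L" for x y
    using that com commutator_space_subset unfolding L by auto
  then have S: "{commutator A x y |x y. x \<in> carrier ?M \<and> y \<in> carrier ?M} = {\<zero>\<^bsub>A\<^esub>}"
    using uL by (auto intro!: exI[of _ u])
  have "linear_span K ?M {\<zero>\<^bsub>A\<^esub>} = {\<zero>\<^bsub>A\<^esub>}"
  proof -
    have "submodule {\<zero>\<^bsub>A\<^esub>} K ?M"
    proof (rule L.submoduleI)
      have z: "\<zero>\<^bsub>A\<^esub> \<in> ?L"
        using subgroup.one_closed[OF submodule.axioms(1)[OF commutator_space_submodule]] by simp
      then show "{\<zero>\<^bsub>A\<^esub>} \<subseteq> carrier ?M" by simp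
      show "a_inv ?M a \<in> {\<zero>\<^bsub>A\<^esub>}" if "a \<in> {\<zero>\<^bsub>A\<^esub>}" for a
        using that z M.a_inv_restrict[OF L.abelian_group_axioms, of "\<zero>\<^bsub>A\<^esub>"] commutator_space_subset minus_zero by simp
    qed simp_all
    moreover have "\<zero>\<^bsub>A\<^esub> \<in> N" if "submodule N K ?M" for N
      using subgroup.one_closed[OF submodule.axioms(1)[OF that]] by simp
    ultimately show ?thesis by (auto simp: linear_span_def)
  qed
  then show False using L.derived_nontrivial S by simp
qed

section \<open>The action on infinite paths\<close>

locale self_similar_graph =
  graph_action G E \<sigma>\<^sub>0 \<sigma>\<^sub>1 + K: field K
  for K :: "('k, 'm) ring_scheme" (structure)
    and G :: "('g, 'n) monoid_scheme" and E :: "('v, 'e) pre_digraph"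
    and \<sigma>\<^sub>0 :: "'g \<Rightarrow> 'v \<Rightarrow> 'v" and \<sigma>\<^sub>1 :: "'g \<Rightarrow> 'e \<Rightarrow> 'e" +
  fixes \<phi> :: "'g \<Rightarrow> 'e \<Rightarrow> 'g"
  assumes row_finite: "row_finite E" and no_sources: "no_sources E"
    and cocycle: "one_cocycle G (arcs E) \<sigma>\<^sub>1 \<phi>"
    and cocycle_vertex: "\<lbrakk>g \<in> carrier G; e \<in> arcs E; v \<in> verts E\<rbrakk> \<Longrightarrow> \<sigma>\<^sub>0 (\<phi> g e) v = \<sigma>\<^sub>0 g v"
begin

sublocale G: group G
  using V.group_hom by (rule group_hom.axioms)

lemma vertex_closed: "g \<in> carrier G \<Longrightarrow> v \<in> verts E \<Longrightarrow> \<sigma>\<^sub>0 g v \<in> verts E"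
  using V.element_image by blast

lemma edge_closed: "g \<in> carrier G \<Longrightarrow> e \<in> arcs E \<Longrightarrow> \<sigma>\<^sub>1 g e \<in> arcs E"
  using A.element_image by blast

lemma vertex_mult: "g \<in> carrier G \<Longrightarrow> h \<in> carrier G \<Longrightarrow> v \<in> verts E \<Longrightarrow> \<sigma>\<^sub>0 (g \<otimes>\<^bsub>G\<^esub> h) v = \<sigma>\<^sub>0 g (\<sigma>\<^sub>0 h v)"
  by (rule V.composition_rule)

lemma edge_mult: "g \<in> carrier G \<Longrightarrow> h \<in> carrier G \<Longrightarrow> e \<in> arcs E \<Longrightarrow> \<sigma>\<^sub>1 (g \<otimes>\<^bsub>G\<^esub> h) e = \<sigma>\<^sub>1 g (\<sigma>\<^sub>1 h e)"
  by (rule A.composition_rule)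

lemma vertex_one: "v \<in> verts E \<Longrightarrow> \<sigma>\<^sub>0 \<one>\<^bsub>G\<^esub> v = v"
  using V.id_eq_one by (metis restrict_apply')

lemma edge_one: "e \<in> arcs E \<Longrightarrow> \<sigma>\<^sub>1 \<one>\<^bsub>G\<^esub> e = e"
  using A.id_eq_one by (metis restrict_apply')

lemma cocycle_closed: "g \<in> carrier G \<Longrightarrow> e \<in> arcs E \<Longrightarrow> \<phi> g e \<in> carrier G"
  using cocycle by (auto simp: one_cocycle_def)

lemma cocycle_mult:
  "\<lbrakk>g \<in> carrier G; h \<in> carrier G; e \<in> arcs E\<rbrakk> \<Longrightarrow> \<phi> (g \<otimes>\<^bsub>G\<^esub> h) e = \<phi> g (\<sigma>\<^sub>1 h e) \<otimes>\<^bsub>G\<^esub> \<phi> h e"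
  using cocycle by (auto simp: one_cocycle_def)

lemma cocycle_one: "e \<in> arcs E \<Longrightarrow> \<phi> \<one>\<^bsub>G\<^esub> e = \<one>\<^bsub>G\<^esub>"
  using cocycle_mult[of "\<one>\<^bsub>G\<^esub>" "\<one>\<^bsub>G\<^esub>" e] edge_one[of e] cocycle_closed[of "\<one>\<^bsub>G\<^esub>" e]
  by (simp add: G.r_cancel_one)

lemma vertex_inv_eq_iff:
  assumes "g \<in> carrier G" "v \<in> verts E" "w \<in> verts E"
  shows "\<sigma>\<^sub>0 (inv\<^bsub>G\<^esub> g) v = w \<longleftrightarrow> v = \<sigma>\<^sub>0 g w"
  using assms vertex_mult[of g "inv\<^bsub>G\<^esub> g" v] vertex_mult[of "inv\<^bsub>G\<^esub> g" g w] vertex_one by auto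

lemma edge_inv_eq_iff:
  assumes "g \<in> carrier G" "e \<in> arcs E" "f \<in> arcs E"
  shows "\<sigma>\<^sub>1 (inv\<^bsub>G\<^esub> g) e = f \<longleftrightarrow> e = \<sigma>\<^sub>1 g f"
  using assms edge_mult[of g "inv\<^bsub>G\<^esub> g" e] edge_mult[of "inv\<^bsub>G\<^esub> g" g f] edge_one by auto

lemma vertex_eq_iff:
  assumes "g \<in> carrier G" "v \<in> verts E" "w \<in> verts E"
  shows "\<sigma>\<^sub>0 g v = \<sigma>\<^sub>0 g w \<longleftrightarrow> v = w"
  using assms vertex_inv_eq_iff[of g "\<sigma>\<^sub>0 g v" w] vertex_inv_eq_iff[of g "\<sigma>\<^sub>0 g v" v] vertex_closed by metis

lemma cocycle_inv:
  assumes "g \<in> carrier G" "e \<in> arcs E"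
  shows "\<phi> (inv\<^bsub>G\<^esub> g) (\<sigma>\<^sub>1 g e) = inv\<^bsub>G\<^esub> (\<phi> g e)"
proof -
  have "\<phi> (inv\<^bsub>G\<^esub> g) (\<sigma>\<^sub>1 g e) \<otimes>\<^bsub>G\<^esub> \<phi> g e = \<one>\<^bsub>G\<^esub>"
    using assms cocycle_mult[of "inv\<^bsub>G\<^esub> g" g e] by (simp add: cocycle_one)
  then show ?thesis
    using assms by (intro G.inv_equality[symmetric]) (simp_all add: cocycle_closed edge_closed)
qed

definition inf_paths :: "(nat \<Rightarrow> 'e) set" where
  "inf_paths = {x. \<forall>n. x n \<in> arcs E \<and> tail E (x n) = head E (x (Suc n))}"

definition inf_range :: "(nat \<Rightarrow> 'e) \<Rightarrow> 'v" where
  "inf_range x = head E (x 0)"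

definition shift :: "(nat \<Rightarrow> 'e) \<Rightarrow> nat \<Rightarrow> 'e" where
  "shift x = (\<lambda>n. x (Suc n))"

definition extend :: "'e \<Rightarrow> (nat \<Rightarrow> 'e) \<Rightarrow> nat \<Rightarrow> 'e" where
  "extend e x = case_nat e x"

text \<open>
  The action on an infinite path is that of a transducer: when \<open>g\<close> has read the first \<open>n\<close> edges of
  \<open>x\<close>, it goes on as \<open>state g x n\<close>, which is \<open>\<phi>(g, x\<^sub>0 \<dots> x\<^sub>n\<^sub>-\<^sub>1)\<close>.
\<close>

primrec state :: "'g \<Rightarrow> (nat \<Rightarrow> 'e) \<Rightarrow> nat \<Rightarrow> 'g" where
  "state g x 0 = g"
| "state g x (Suc n) = \<phi> (state g x n) (x n)"

definition inf_act :: "'g \<Rightarrow> (nat \<Rightarrow> 'e) \<Rightarrow> nat \<Rightarrow> 'e" where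
  "inf_act g x n = \<sigma>\<^sub>1 (state g x n) (x n)"

lemma inf_pathsD:
  assumes "x \<in> inf_paths"
  shows "x n \<in> arcs E" "tail E (x n) = head E (x (Suc n))"
  using assms by (auto simp: inf_paths_def)

lemma rng_in_verts: "x \<in> inf_paths \<Longrightarrow> inf_range x \<in> verts E"
  by (simp add: inf_range_def inf_pathsD)

lemma shift_infpath: "x \<in> inf_paths \<Longrightarrow> shift x \<in> inf_paths"
  by (simp add: inf_paths_def shift_def)

lemma rng_shift: "x \<in> inf_paths \<Longrightarrow> inf_range (shift x) = tail E (x 0)"
  by (simp add: inf_range_def shift_def inf_pathsD)

lemma extend_simps [simp]: "extend e x 0 = e" "extend e x (Suc n) = x n" "shift (extend e x) = x"
    "extend (x 0) (shift x) = x" "inf_range (extend e x) = head E e"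
  by (auto simp: extend_def shift_def inf_range_def split: nat.split)

lemma extend_infpath:
  assumes "e \<in> arcs E" "x \<in> inf_paths" "inf_range x = tail E e"
  shows "extend e x \<in> inf_paths"
  unfolding inf_paths_def
proof (intro CollectI allI)
  fix n show "extend e x n \<in> arcs E \<and> tail E (extend e x n) = head E (extend e x (Suc n))"
    using assms by (cases n) (auto simp: inf_pathsD inf_range_def)
qed

lemma state_closed: "g \<in> carrier G \<Longrightarrow> x \<in> inf_paths \<Longrightarrow> state g x n \<in> carrier G"
  by (induction n) (auto simp: cocycle_closed inf_pathsD)

text \<open>
  Passing from \<open>g\<close> to \<open>\<phi>(g,e)\<close> does not change the action on vertices; this is why \<open>g\<close> maps infinite
  paths to infinite paths.
\<close>

lemma state_vertex: "\<lbrakk>g \<in> carrier G; x \<in> inf_paths; v \<in> verts E\<rbrakk> \<Longrightarrow> \<sigma>\<^sub>0 (state g x n) v = \<sigma>\<^sub>0 g v"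
  by (induction n) (auto simp: cocycle_vertex inf_pathsD state_closed)

lemma act_infpath:
  assumes "g \<in> carrier G" "x \<in> inf_paths"
  shows "inf_act g x \<in> inf_paths"
  unfolding inf_paths_def
proof (intro CollectI allI conjI)
  fix n
  note x = inf_pathsD[OF assms(2)] and s = state_closed[OF assms]
  show "inf_act g x n \<in> arcs E" using x s by (simp add: inf_act_def edge_closed)
  have "tail E (inf_act g x n) = \<sigma>\<^sub>0 g (tail E (x n))"
    using x s assms by (simp add: inf_act_def tail_equivariant state_vertex)
  moreover have "head E (inf_act g x (Suc n)) = \<sigma>\<^sub>0 g (head E (x (Suc n)))"
    using x s[of "Suc n"] state_vertex[OF assms, of _ "Suc n"]
    by (simp add: inf_act_def head_equivariant del: state.simps)
  ultimately show "tail E (inf_act g x n) = head E (inf_act g x (Suc n))" using x by simp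
qed

lemma rng_act: "g \<in> carrier G \<Longrightarrow> x \<in> inf_paths \<Longrightarrow> inf_range (inf_act g x) = \<sigma>\<^sub>0 g (inf_range x)"
  by (simp add: inf_range_def inf_act_def head_equivariant inf_pathsD)

lemma state_mult:
  "\<lbrakk>g \<in> carrier G; h \<in> carrier G; x \<in> inf_paths\<rbrakk> \<Longrightarrow> state (g \<otimes>\<^bsub>G\<^esub> h) x n = state g (inf_act h x) n \<otimes>\<^bsub>G\<^esub> state h x n"
  by (induction n) (auto simp: cocycle_mult inf_act_def state_closed inf_pathsD act_infpath)

lemma act_mult:
  assumes "g \<in> carrier G" "h \<in> carrier G" "x \<in> inf_paths"
  shows "inf_act (g \<otimes>\<^bsub>G\<^esub> h) x = inf_act g (inf_act h x)"
  using assms by (auto simp: fun_eq_iff inf_act_def state_mult edge_mult state_closed act_infpath inf_pathsD)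

lemma state_one: "x \<in> inf_paths \<Longrightarrow> state \<one>\<^bsub>G\<^esub> x n = \<one>\<^bsub>G\<^esub>"
  by (induction n) (auto simp: cocycle_one inf_pathsD)

lemma act_one: "x \<in> inf_paths \<Longrightarrow> inf_act \<one>\<^bsub>G\<^esub> x = x"
  by (auto simp: fun_eq_iff inf_act_def state_one edge_one inf_pathsD)

lemma act_inv [simp]:
  assumes "g \<in> carrier G" "x \<in> inf_paths"
  shows "inf_act (inv\<^bsub>G\<^esub> g) (inf_act g x) = x" "inf_act g (inf_act (inv\<^bsub>G\<^esub> g) x) = x"
  using assms act_mult[of "inv\<^bsub>G\<^esub> g" g x] act_mult[of g "inv\<^bsub>G\<^esub> g" x] by (simp_all add: act_one)

lemma state_extend: "state g (extend e x) (Suc n) = state (\<phi> g e) x n"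
  by (induction n) auto

lemma act_extend: "inf_act g (extend e x) = extend (\<sigma>\<^sub>1 g e) (inf_act (\<phi> g e) x)"
proof
  fix n show "inf_act g (extend e x) n = extend (\<sigma>\<^sub>1 g e) (inf_act (\<phi> g e) x) n"
    by (cases n) (simp_all add: inf_act_def state_extend del: state.simps(2))
qed

lemma act_first: "inf_act g x 0 = \<sigma>\<^sub>1 g (x 0)"
  by (simp add: inf_act_def)

lemma shift_act: "shift (inf_act g x) = inf_act (\<phi> g (x 0)) (shift x)"
  using act_extend[of g "x 0" "shift x"] by simp

lemma ex_infpath:
  assumes "v \<in> verts E"
  obtains x where "x \<in> inf_paths" "inf_range x = v"
proof -
  define pick where "pick w = (SOME e. e \<in> in_arcs E w)" for w
  have pick: "pick w \<in> in_arcs E w" if "w \<in> verts E" for w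
  proof -
    have "in_arcs E w \<noteq> {}" using no_sources that by (simp add: no_sources_def)
    then show ?thesis unfolding pick_def by (rule some_in_eq[THEN iffD2])
  qed
  define x where "x = rec_nat (pick v) (\<lambda>n e. pick (tail E e))"
  have arc: "x n \<in> arcs E" for n
    using pick assms by (induction n) (auto simp: x_def)
  have "x (Suc n) \<in> in_arcs E (tail E (x n))" for n
    using pick[of "tail E (x n)"] arc[of n] by (simp add: x_def)
  then have "x \<in> inf_paths" using arc by (auto simp: inf_paths_def)
  moreover have "inf_range x = v" using pick[OF assms] by (simp add: inf_range_def x_def)
  ultimately show ?thesis using that by blast
qed


section \<open>Operators for generators and terms\<close>

definition K_valued :: "((nat \<Rightarrow> 'e) \<Rightarrow> 'i \<Rightarrow> 'k) set" where
  "K_valued = {\<xi>. \<forall>x i. \<xi> x i \<in> carrier K}"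

lemma K_valuedD: "\<xi> \<in> K_valued \<Longrightarrow> \<xi> x i \<in> carrier K"
  by (simp add: K_valued_def)

text \<open>
  The operators act on functions of an infinite path and an index of an arbitrary type, on which
  every edge acts by a permutation \<open>\<tau>\<close>. A one-point index type gives the natural representation on
  functions of paths, and the shift of the integers gives one that records the degree of
  elements. The operators \<open>edge_op \<tau> e g\<close> and \<open>edge_op_adj \<tau> e g\<close> transport functions along a partial
  bijection of pairs and along its inverse.
\<close>

definition vertex_op :: "'v \<Rightarrow> 'g \<Rightarrow> ((nat \<Rightarrow> 'e) \<Rightarrow> 'i \<Rightarrow> 'k) \<Rightarrow> (nat \<Rightarrow> 'e) \<Rightarrow> 'i \<Rightarrow> 'k" where
  "vertex_op v f \<xi> = (\<lambda>x i. if x \<in> inf_paths \<and> inf_range x = v then \<xi> (inf_act (inv\<^bsub>G\<^esub> f) x) i else \<zero>)"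

definition edge_op :: "('i \<Rightarrow> 'i) \<Rightarrow> 'e \<Rightarrow> 'g \<Rightarrow> ((nat \<Rightarrow> 'e) \<Rightarrow> 'i \<Rightarrow> 'k) \<Rightarrow> (nat \<Rightarrow> 'e) \<Rightarrow> 'i \<Rightarrow> 'k" where
  "edge_op \<tau> e g \<xi> = (\<lambda>x i. if x \<in> inf_paths \<and> x 0 = e then \<xi> (inf_act (inv\<^bsub>G\<^esub> g) (shift x)) (\<tau> i) else \<zero>)"

definition edge_op_adj :: "('i \<Rightarrow> 'i) \<Rightarrow> 'e \<Rightarrow> 'g \<Rightarrow> ((nat \<Rightarrow> 'e) \<Rightarrow> 'i \<Rightarrow> 'k) \<Rightarrow> (nat \<Rightarrow> 'e) \<Rightarrow> 'i \<Rightarrow> 'k" where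
  "edge_op_adj \<tau> e g \<xi> = (\<lambda>x i. if x \<in> inf_paths \<and> \<sigma>\<^sub>0 g (inf_range x) = tail E e
     then \<xi> (extend e (inf_act g x)) (inv_into UNIV \<tau> i) else \<zero>)"

primrec gen_op :: "('i \<Rightarrow> 'i) \<Rightarrow> ('v, 'e, 'g) ep_generator \<Rightarrow> bool \<Rightarrow>
    ((nat \<Rightarrow> 'e) \<Rightarrow> 'i \<Rightarrow> 'k) \<Rightarrow> (nat \<Rightarrow> 'e) \<Rightarrow> 'i \<Rightarrow> 'k" where
  "gen_op \<tau> (PGen v f) b = (if b then vertex_op (\<sigma>\<^sub>0 (inv\<^bsub>G\<^esub> f) v) (inv\<^bsub>G\<^esub> f) else vertex_op v f)"
| "gen_op \<tau> (SGen e g) b = (if b then edge_op_adj \<tau> e g else edge_op \<tau> e g)"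

text \<open>
  The operator of a term for \<open>b = False\<close> and its adjoint for \<open>b = True\<close>. With both of them at hand
  the involution just swaps the flag, and no formula for the adjoint of an arbitrary operator is
  needed.
\<close>

primrec term_op :: "('i \<Rightarrow> 'i) \<Rightarrow> ('k, ('v, 'e, 'g) ep_generator) star_term \<Rightarrow> bool \<Rightarrow>
    ((nat \<Rightarrow> 'e) \<Rightarrow> 'i \<Rightarrow> 'k) \<Rightarrow> (nat \<Rightarrow> 'e) \<Rightarrow> 'i \<Rightarrow> 'k" where
  "term_op \<tau> (Gen a) b \<xi> = gen_op \<tau> a b \<xi>"
| "term_op \<tau> Null b \<xi> = (\<lambda>x i. \<zero>)"
| "term_op \<tau> (s \<^bold>+ t) b \<xi> = (\<lambda>x i. term_op \<tau> s b \<xi> x i \<oplus> term_op \<tau> t b \<xi> x i)"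
| "term_op \<tau> (Neg t) b \<xi> = (\<lambda>x i. \<ominus> term_op \<tau> t b \<xi> x i)"
| "term_op \<tau> (s \<^bold>* t) b \<xi> = (if b then term_op \<tau> t b (term_op \<tau> s b \<xi>) else term_op \<tau> s b (term_op \<tau> t b \<xi>))"
| "term_op \<tau> (c \<^bold>\<cdot> t) b \<xi> = (\<lambda>x i. c \<otimes> term_op \<tau> t b \<xi> x i)"
| "term_op \<tau> (t\<^sup>\<star>) b \<xi> = term_op \<tau> t (\<not> b) \<xi>"

abbreviation terms :: "('k, ('v, 'e, 'g) ep_generator) star_term set" where
  "terms \<equiv> star_terms K (ep_generators G E)"

lemma gen_op_closed: "\<xi> \<in> K_valued \<Longrightarrow> gen_op \<tau> a b \<xi> \<in> K_valued"
  by (cases a) (auto simp: K_valued_def vertex_op_def edge_op_def edge_op_adj_def)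

lemma term_op_closed: "t \<in> terms \<Longrightarrow> \<xi> \<in> K_valued \<Longrightarrow> term_op \<tau> t b \<xi> \<in> K_valued"
proof (induction t arbitrary: b \<xi> rule: star_terms.induct)
  case (1 x) then show ?case using gen_op_closed by simp
next
  case (3 s t) then show ?case by (simp add: K_valued_def)
next
  case (6 c t) then show ?case by (simp add: K_valued_def)
qed (auto simp: K_valued_def)

lemma term_op_val [simp]: "t \<in> terms \<Longrightarrow> \<xi> \<in> K_valued \<Longrightarrow> term_op \<tau> t b \<xi> x i \<in> carrier K"
  by (rule K_valuedD[OF term_op_closed])

lemma term_op_add:
  "t \<in> terms \<Longrightarrow> \<xi> \<in> K_valued \<Longrightarrow> \<eta> \<in> K_valued \<Longrightarrow> term_op \<tau> t b (\<lambda>x i. \<xi> x i \<oplus> \<eta> x i) = (\<lambda>x i. term_op \<tau> t b \<xi> x i \<oplus> term_op \<tau> t b \<eta> x i)"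
proof (induction t arbitrary: b \<xi> \<eta> rule: star_terms.induct)
  case (1 a)
  show ?case by (cases a) (auto simp: vertex_op_def edge_op_def edge_op_adj_def fun_eq_iff)
next
  case (3 s t)
  show ?case
  proof (intro ext)
    fix x i
    have "term_op \<tau> s b \<xi> x i \<in> carrier K" "term_op \<tau> s b \<eta> x i \<in> carrier K"
      "term_op \<tau> t b \<xi> x i \<in> carrier K" "term_op \<tau> t b \<eta> x i \<in> carrier K"
      using 3 by simp_all
    then show "term_op \<tau> (s \<^bold>+ t) b (\<lambda>x i. \<xi> x i \<oplus> \<eta> x i) x i = term_op \<tau> (s \<^bold>+ t) b \<xi> x i \<oplus> term_op \<tau> (s \<^bold>+ t) b \<eta> x i"
      unfolding term_op.simps 3(3)[OF 3(5,6)] 3(4)[OF 3(5,6)] by (simp add: K.a_ac)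
  qed
next
  case (4 t)
  show ?case
    unfolding term_op.simps 4(2)[OF 4(3,4)] by (intro ext K.minus_add term_op_val 4)
next
  case (5 s t)
  show ?case
    unfolding term_op.simps 5(3)[OF 5(5,6)] 5(4)[OF 5(5,6)]
      5(3)[OF term_op_closed[OF 5(2,5)] term_op_closed[OF 5(2,6)]] 5(4)[OF term_op_closed[OF 5(1,5)] term_op_closed[OF 5(1,6)]]
    by (cases b) simp_all
next
  case (6 c t)
  show ?case
    unfolding term_op.simps 6(3)[OF 6(4,5)] by (intro ext K.r_distr term_op_val 6)
qed simp_all

lemma term_op_scale:
  "t \<in> terms \<Longrightarrow> \<xi> \<in> K_valued \<Longrightarrow> c \<in> carrier K \<Longrightarrow> term_op \<tau> t b (\<lambda>x i. c \<otimes> \<xi> x i) = (\<lambda>x i. c \<otimes> term_op \<tau> t b \<xi> x i)"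
proof (induction t arbitrary: b \<xi> rule: star_terms.induct)
  case (1 a)
  show ?case using 1(3) by (cases a) (auto simp: vertex_op_def edge_op_def edge_op_adj_def fun_eq_iff)
next
  case (3 s t)
  show ?case
    unfolding term_op.simps 3(3)[OF 3(5,6)] 3(4)[OF 3(5,6)] by (intro ext K.r_distr[symmetric] term_op_val 3)
next
  case (4 t)
  show ?case
    unfolding term_op.simps 4(2)[OF 4(3,4)] by (intro ext K.r_minus[symmetric] term_op_val 4)
next
  case (5 s t)
  show ?case
    unfolding term_op.simps 5(3)[OF 5(5,6)] 5(4)[OF 5(5,6)]
      5(3)[OF term_op_closed[OF 5(2,5)] 5(6)] 5(4)[OF term_op_closed[OF 5(1,5)] 5(6)]
    by (cases b) simp_all
next
  case (6 d t)
  show ?case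
    unfolding term_op.simps 6(3)[OF 6(4,5)] by (intro ext K.m_lcomm term_op_val 6)
qed simp_all

lemma vertex_op_mult:
  assumes "v \<in> verts E" "f \<in> carrier G" "w \<in> verts E" "h \<in> carrier G"
  shows "vertex_op v f (vertex_op w h \<xi>) = (if v = \<sigma>\<^sub>0 f w then vertex_op v (f \<otimes>\<^bsub>G\<^esub> h) \<xi> else (\<lambda>x i. \<zero>))"
proof (intro ext)
  fix x i
  have "inf_range (inf_act (inv\<^bsub>G\<^esub> f) x) = w \<longleftrightarrow> inf_range x = \<sigma>\<^sub>0 f w" if "x \<in> inf_paths"
    using that assms by (simp add: rng_act vertex_inv_eq_iff rng_in_verts)
  then show "vertex_op v f (vertex_op w h \<xi>) x i = (if v = \<sigma>\<^sub>0 f w then vertex_op v (f \<otimes>\<^bsub>G\<^esub> h) \<xi> else (\<lambda>x i. \<zero>)) x i"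
    using assms by (auto simp: vertex_op_def act_infpath act_mult G.inv_mult_group)
qed

lemma vertex_op_one: "vertex_op v \<one>\<^bsub>G\<^esub> \<xi> = (\<lambda>x i. if x \<in> inf_paths \<and> inf_range x = v then \<xi> x i else \<zero>)"
  by (auto simp: vertex_op_def fun_eq_iff act_one)

lemma edge_op_one: "edge_op \<tau> e \<one>\<^bsub>G\<^esub> \<xi> = (\<lambda>x i. if x \<in> inf_paths \<and> x 0 = e then \<xi> (shift x) (\<tau> i) else \<zero>)"
  by (auto simp: edge_op_def fun_eq_iff act_one shift_infpath)

lemma edge_op_adj_one: "edge_op_adj \<tau> e \<one>\<^bsub>G\<^esub> \<xi> = (\<lambda>x i. if x \<in> inf_paths \<and> inf_range x = tail E e then \<xi> (extend e x) (inv_into UNIV \<tau> i) else \<zero>)"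
  by (auto simp: edge_op_adj_def fun_eq_iff act_one vertex_one rng_in_verts)

text \<open>
  The cocycle enters through \<open>\<phi>(f\<^sup>-\<^sup>1, f e) = \<phi>(f, e)\<^sup>-\<^sup>1\<close>: it describes what \<open>f\<^sup>-\<^sup>1\<close> does to the rest
  of a path that starts with \<open>f e\<close>.
\<close>

lemma vertex_op_edge_op:
  assumes "v \<in> verts E" "f \<in> carrier G" "e \<in> arcs E" "g \<in> carrier G"
  shows "vertex_op v f (edge_op \<tau> e g \<xi>) =
    (if v = head E (\<sigma>\<^sub>1 f e) then edge_op \<tau> (\<sigma>\<^sub>1 f e) (\<phi> f e \<otimes>\<^bsub>G\<^esub> g) \<xi> else (\<lambda>x i. \<zero>))"
proof (intro ext)
  fix x i
  have fe: "\<phi> f e \<in> carrier G" using assms by (simp add: cocycle_closed)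
  show "vertex_op v f (edge_op \<tau> e g \<xi>) x i =
    (if v = head E (\<sigma>\<^sub>1 f e) then edge_op \<tau> (\<sigma>\<^sub>1 f e) (\<phi> f e \<otimes>\<^bsub>G\<^esub> g) \<xi> else (\<lambda>x i. \<zero>)) x i"
  proof (cases "x \<in> inf_paths \<and> inf_range x = v \<and> x 0 = \<sigma>\<^sub>1 f e")
    case True
    then have "shift (inf_act (inv\<^bsub>G\<^esub> f) x) = inf_act (inv\<^bsub>G\<^esub> (\<phi> f e)) (shift x)"
      using assms by (simp add: shift_act cocycle_inv)
    moreover have "inf_act (inv\<^bsub>G\<^esub> f) x 0 = e"
      using True assms by (simp add: act_first edge_inv_eq_iff edge_closed)
    ultimately show ?thesis
      using True assms fe
      by (auto simp: vertex_op_def edge_op_def act_infpath G.inv_mult_group act_mult shift_infpath inf_range_def)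
  next
    case False
    moreover have "inf_act (inv\<^bsub>G\<^esub> f) x 0 = e \<longleftrightarrow> x 0 = \<sigma>\<^sub>1 f e" if "x \<in> inf_paths"
      using that assms by (simp add: act_first edge_inv_eq_iff inf_pathsD)
    ultimately show ?thesis
      by (auto simp: vertex_op_def edge_op_def inf_range_def)
  qed
qed

lemma edge_op_adj_vertex_op:
  assumes "v \<in> verts E" "f \<in> carrier G" "e \<in> arcs E" "g \<in> carrier G"
  shows "edge_op_adj \<tau> e g (vertex_op (\<sigma>\<^sub>0 (inv\<^bsub>G\<^esub> f) v) (inv\<^bsub>G\<^esub> f) \<xi>) =
    (if v = head E (\<sigma>\<^sub>1 f e) then edge_op_adj \<tau> (\<sigma>\<^sub>1 f e) (\<phi> f e \<otimes>\<^bsub>G\<^esub> g) \<xi> else (\<lambda>x i. \<zero>))"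
proof (intro ext)
  fix x i
  have fe: "\<phi> f e \<in> carrier G" using assms by (simp add: cocycle_closed)
  have v: "head E e = \<sigma>\<^sub>0 (inv\<^bsub>G\<^esub> f) v \<longleftrightarrow> v = head E (\<sigma>\<^sub>1 f e)"
    using assms vertex_inv_eq_iff[of f v "head E e"] by (auto simp: head_equivariant)
  have t: "\<sigma>\<^sub>0 (\<phi> f e \<otimes>\<^bsub>G\<^esub> g) (inf_range x) = tail E (\<sigma>\<^sub>1 f e) \<longleftrightarrow> \<sigma>\<^sub>0 g (inf_range x) = tail E e" if "x \<in> inf_paths"
    using that assms fe
    by (simp add: vertex_mult tail_equivariant cocycle_vertex vertex_closed rng_in_verts vertex_eq_iff)
  have "inf_act f (extend e (inf_act g x)) = extend (\<sigma>\<^sub>1 f e) (inf_act (\<phi> f e \<otimes>\<^bsub>G\<^esub> g) x)" if "x \<in> inf_paths"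
    using that assms fe by (simp add: act_extend act_mult)
  moreover have "extend e (inf_act g x) \<in> inf_paths" if "x \<in> inf_paths" "\<sigma>\<^sub>0 g (inf_range x) = tail E e"
    using that assms by (intro extend_infpath) (simp_all add: act_infpath rng_act)
  ultimately show "edge_op_adj \<tau> e g (vertex_op (\<sigma>\<^sub>0 (inv\<^bsub>G\<^esub> f) v) (inv\<^bsub>G\<^esub> f) \<xi>) x i =
    (if v = head E (\<sigma>\<^sub>1 f e) then edge_op_adj \<tau> (\<sigma>\<^sub>1 f e) (\<phi> f e \<otimes>\<^bsub>G\<^esub> g) \<xi> else (\<lambda>x i. \<zero>)) x i"
    using assms v t by (auto simp: vertex_op_def edge_op_adj_def)
qed

lemma edge_op_vertex_op:
  assumes "e \<in> arcs E" "g \<in> carrier G" "v \<in> verts E" "f \<in> carrier G"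
  shows "edge_op \<tau> e g (vertex_op v f \<xi>) =
    (if \<sigma>\<^sub>0 g v = tail E e then edge_op \<tau> e (g \<otimes>\<^bsub>G\<^esub> f) \<xi> else (\<lambda>x i. \<zero>))"
proof (intro ext)
  fix x i
  have "inf_range (inf_act (inv\<^bsub>G\<^esub> g) (shift x)) = v \<longleftrightarrow> \<sigma>\<^sub>0 g v = tail E (x 0)" if "x \<in> inf_paths"
    using that assms
    by (auto simp: rng_act shift_infpath rng_shift vertex_inv_eq_iff inf_pathsD)
  then show "edge_op \<tau> e g (vertex_op v f \<xi>) x i =
    (if \<sigma>\<^sub>0 g v = tail E e then edge_op \<tau> e (g \<otimes>\<^bsub>G\<^esub> f) \<xi> else (\<lambda>x i. \<zero>)) x i"
    using assms
    by (auto simp: vertex_op_def edge_op_def act_infpath act_mult shift_infpath G.inv_mult_group)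
qed

lemma vertex_op_edge_op_adj:
  assumes "e \<in> arcs E" "g \<in> carrier G" "v \<in> verts E" "f \<in> carrier G"
  shows "vertex_op (\<sigma>\<^sub>0 (inv\<^bsub>G\<^esub> f) v) (inv\<^bsub>G\<^esub> f) (edge_op_adj \<tau> e g \<xi>) =
    (if \<sigma>\<^sub>0 g v = tail E e then edge_op_adj \<tau> e (g \<otimes>\<^bsub>G\<^esub> f) \<xi> else (\<lambda>x i. \<zero>))"
proof (intro ext)
  fix x i
  have *: "inf_range x = \<sigma>\<^sub>0 (inv\<^bsub>G\<^esub> f) v \<longleftrightarrow> v = \<sigma>\<^sub>0 f (inf_range x)" if "x \<in> inf_paths"
    using that assms vertex_inv_eq_iff[of f v "inf_range x"] rng_in_verts by auto
  have "\<sigma>\<^sub>0 (g \<otimes>\<^bsub>G\<^esub> f) (inf_range x) = \<sigma>\<^sub>0 g (\<sigma>\<^sub>0 f (inf_range x))" if "x \<in> inf_paths"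
    using that assms by (simp add: vertex_mult rng_in_verts)
  moreover have "\<sigma>\<^sub>0 g (\<sigma>\<^sub>0 f (inf_range x)) = \<sigma>\<^sub>0 g v \<longleftrightarrow> \<sigma>\<^sub>0 f (inf_range x) = v" if "x \<in> inf_paths"
    using that assms by (simp add: vertex_eq_iff vertex_closed rng_in_verts)
  ultimately show "vertex_op (\<sigma>\<^sub>0 (inv\<^bsub>G\<^esub> f) v) (inv\<^bsub>G\<^esub> f) (edge_op_adj \<tau> e g \<xi>) x i =
    (if \<sigma>\<^sub>0 g v = tail E e then edge_op_adj \<tau> e (g \<otimes>\<^bsub>G\<^esub> f) \<xi> else (\<lambda>x i. \<zero>)) x i"
    using assms * by (auto simp: vertex_op_def edge_op_adj_def act_infpath rng_act act_mult)
qed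

lemma edge_op_adj_edge_op:
  assumes "bij \<tau>" "e \<in> arcs E" "f \<in> arcs E"
  shows "edge_op_adj \<tau> e \<one>\<^bsub>G\<^esub> (edge_op \<tau> f \<one>\<^bsub>G\<^esub> \<xi>) = (if e = f then vertex_op (tail E e) \<one>\<^bsub>G\<^esub> \<xi> else (\<lambda>x i. \<zero>))"
proof -
  have "extend e x \<in> inf_paths" if "x \<in> inf_paths" "inf_range x = tail E e" for x
    using that assms by (intro extend_infpath)
  then show ?thesis
    using assms surj_f_inv_f[OF bij_is_surj[OF assms(1)]]
    by (auto simp: edge_op_adj_one edge_op_one vertex_op_one fun_eq_iff)
qed

lemma edge_op_edge_op_adj:
  assumes "bij \<tau>" "e \<in> arcs E"
  shows "edge_op \<tau> e \<one>\<^bsub>G\<^esub> (edge_op_adj \<tau> e \<one>\<^bsub>G\<^esub> \<xi>) = (\<lambda>x i. if x \<in> inf_paths \<and> x 0 = e then \<xi> x i else \<zero>)"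
  using assms inv_f_f[OF bij_is_inj[OF assms(1)]]
  by (auto simp: edge_op_adj_one edge_op_one fun_eq_iff shift_infpath rng_shift)

text \<open>
  The operators \<open>s\<^sub>e s\<^sub>e\<^sup>*\<close> are the projections onto the paths that start with \<open>e\<close>. Those for the
  edges with range \<open>v\<close> partition the paths with range \<open>v\<close>.
\<close>

lemma term_op_range_sum:
  assumes "bij \<tau>" "distinct es" "set es \<subseteq> arcs E" "\<xi> \<in> K_valued"
  shows "term_op \<tau> (foldr Sum (map (\<lambda>e. S_term e \<one>\<^bsub>G\<^esub> \<^bold>* (S_term e \<one>\<^bsub>G\<^esub>)\<^sup>\<star>) es) Null) b \<xi> =
    (\<lambda>x i. if x \<in> inf_paths \<and> x 0 \<in> set es then \<xi> x i else \<zero>)"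
  using assms(2,3)
proof (induction es)
  case (Cons e es)
  then show ?case using assms(1,4) by (auto simp: edge_op_edge_op_adj fun_eq_iff K_valuedD)
qed simp

lemma term_op_relation:
  assumes "bij \<tau>" "(s, t) \<in> ep_relations G E \<sigma>\<^sub>0 \<sigma>\<^sub>1 \<phi>" "\<xi> \<in> K_valued"
  shows "term_op \<tau> s b \<xi> = term_op \<tau> t b \<xi>"
  using assms(2)
proof cases
  case (a_sum v es)
  have "set es \<subseteq> arcs E" unfolding a_sum(6) by auto
  then have "term_op \<tau> t b \<xi> = (\<lambda>x i. if x \<in> inf_paths \<and> x 0 \<in> set es then \<xi> x i else \<zero>)"
    unfolding a_sum(2) by (rule term_op_range_sum[OF assms(1) a_sum(5) _ assms(3)])
  also have "\<dots> = term_op \<tau> s b \<xi>"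
    using a_sum by (auto simp: vertex_op_one fun_eq_iff inf_range_def inf_pathsD vertex_one)
  finally show ?thesis by simp
next
  case (a_pp v w)
  then show ?thesis using vertex_op_mult[of v "\<one>\<^bsub>G\<^esub>" w "\<one>\<^bsub>G\<^esub>" \<xi>] vertex_op_mult[of w "\<one>\<^bsub>G\<^esub>" v "\<one>\<^bsub>G\<^esub>" \<xi>] by (auto simp: vertex_one)
next
  case (a_ps e)
  then show ?thesis
    using vertex_op_edge_op[of "head E e" "\<one>\<^bsub>G\<^esub>" e "\<one>\<^bsub>G\<^esub>" \<tau> \<xi>] edge_op_adj_vertex_op[of "head E e" "\<one>\<^bsub>G\<^esub>" e "\<one>\<^bsub>G\<^esub>" \<tau> \<xi>]
    by (auto simp: vertex_one edge_one cocycle_one)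
next
  case (a_sp e)
  then show ?thesis
    using edge_op_vertex_op[of e "\<one>\<^bsub>G\<^esub>" "tail E e" "\<one>\<^bsub>G\<^esub>" \<tau> \<xi>] vertex_op_edge_op_adj[of e "\<one>\<^bsub>G\<^esub>" "tail E e" "\<one>\<^bsub>G\<^esub>" \<tau> \<xi>]
    by (auto simp: vertex_one)
next
  case (a_pst e)
  then show ?thesis
    using edge_op_vertex_op[of e "\<one>\<^bsub>G\<^esub>" "tail E e" "\<one>\<^bsub>G\<^esub>" \<tau> \<xi>] vertex_op_edge_op_adj[of e "\<one>\<^bsub>G\<^esub>" "tail E e" "\<one>\<^bsub>G\<^esub>" \<tau> \<xi>]
    by (auto simp: vertex_one)
next
  case (a_stp e)
  then show ?thesis
    using vertex_op_edge_op[of "head E e" "\<one>\<^bsub>G\<^esub>" e "\<one>\<^bsub>G\<^esub>" \<tau> \<xi>] edge_op_adj_vertex_op[of "head E e" "\<one>\<^bsub>G\<^esub>" e "\<one>\<^bsub>G\<^esub>" \<tau> \<xi>]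
    by (auto simp: vertex_one edge_one cocycle_one)
next
  case (a_sts e f)
  then show ?thesis
    using edge_op_adj_edge_op[OF assms(1), of e f \<xi>] edge_op_adj_edge_op[OF assms(1), of f e \<xi>] by (auto simp: vertex_one)
next
  case (b v f)
  then show ?thesis by (auto simp: vertex_mult[symmetric] vertex_one)
next
  case (c v f w h)
  have k: "\<sigma>\<^sub>0 (inv\<^bsub>G\<^esub> h) w = \<sigma>\<^sub>0 (inv\<^bsub>G\<^esub> h) (\<sigma>\<^sub>0 (inv\<^bsub>G\<^esub> f) v) \<longleftrightarrow> v = \<sigma>\<^sub>0 f w"
    using c vertex_eq_iff[of "inv\<^bsub>G\<^esub> h" w "\<sigma>\<^sub>0 (inv\<^bsub>G\<^esub> f) v"] vertex_inv_eq_iff[of f v w] vertex_closed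
    by (metis G.inv_closed)
  have l: "\<sigma>\<^sub>0 (inv\<^bsub>G\<^esub> (f \<otimes>\<^bsub>G\<^esub> h)) v = \<sigma>\<^sub>0 (inv\<^bsub>G\<^esub> h) w" if "v = \<sigma>\<^sub>0 f w"
  proof -
    have "\<sigma>\<^sub>0 (inv\<^bsub>G\<^esub> f) (\<sigma>\<^sub>0 f w) = w" using c vertex_inv_eq_iff[of f "\<sigma>\<^sub>0 f w" w] vertex_closed by simp
    then show ?thesis using c that by (simp add: G.inv_mult_group vertex_mult vertex_closed)
  qed
  show ?thesis
  proof (cases b)
    case True
    have "vertex_op (\<sigma>\<^sub>0 (inv\<^bsub>G\<^esub> h) w) (inv\<^bsub>G\<^esub> h) (vertex_op (\<sigma>\<^sub>0 (inv\<^bsub>G\<^esub> f) v) (inv\<^bsub>G\<^esub> f) \<xi>) =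
      (if v = \<sigma>\<^sub>0 f w then vertex_op (\<sigma>\<^sub>0 (inv\<^bsub>G\<^esub> h) w) (inv\<^bsub>G\<^esub> h \<otimes>\<^bsub>G\<^esub> inv\<^bsub>G\<^esub> f) \<xi> else (\<lambda>x i. \<zero>))"
      using c by (subst vertex_op_mult) (simp_all add: vertex_closed k)
    then show ?thesis using True c l by (auto simp: G.inv_mult_group)
  next
    case False
    then show ?thesis using c vertex_op_mult[of v f w h \<xi>] by auto
  qed
next
  case (d v f e g)
  then show ?thesis
    using vertex_op_edge_op[of v f e g \<tau> \<xi>] edge_op_adj_vertex_op[of v f e g \<tau> \<xi>] by auto
next
  case (e e g v f)
  then show ?thesis
    using edge_op_vertex_op[of e g v f \<tau> \<xi>] vertex_op_edge_op_adj[of e g v f \<tau> \<xi>] by auto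
qed

text \<open>
  The operators respect the defining congruence of the algebra. Their linearity
  accounts for the laws about products with a sum or with a scalar multiple.
\<close>

lemma term_op_star_eq:
  assumes "bij \<tau>" "star_eq K (ep_generators G E) (ep_relations G E \<sigma>\<^sub>0 \<sigma>\<^sub>1 \<phi>) s t" "\<xi> \<in> K_valued"
  shows "term_op \<tau> s b \<xi> = term_op \<tau> t b \<xi>"
  using assms(2,3)
proof (induction arbitrary: b \<xi> rule: star_eq.induct)
  case (relation s t)
  then show ?case using term_op_relation[OF assms(1)] by blast
next
  case (cong_prod s s' t t')
  then show ?case
    using star_eq_terms[OF K.is_cring cong_prod(1)] star_eq_terms[OF K.is_cring cong_prod(2)]
    by (simp add: term_op_closed)
next
  case (distrib_l s t u)
  then show ?case by (simp add: term_op_add term_op_closed)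
next
  case (distrib_r s t u)
  then show ?case by (simp add: term_op_add term_op_closed)
next
  case (scale_prod_l c s t)
  then show ?case by (simp add: term_op_scale term_op_closed)
next
  case (scale_prod_r c s t)
  then show ?case by (simp add: term_op_scale term_op_closed)
next
  case (sum_assoc s t u)
  then show ?case by (simp add: K.a_assoc)
next
  case (sum_comm s t)
  then show ?case by (simp add: K.a_comm)
next
  case (scale_mult c d t)
  then show ?case by (simp add: K.m_assoc)
next
  case (scale_add c d t)
  then show ?case by (simp add: K.l_distr)
next
  case (scale_sum c s t)
  then show ?case by (simp add: K.r_distr)
next
  case (sum_neg t)
  then show ?case by (simp add: K.l_neg)
qed simp_all

section \<open>Locality and support of the operators\<close>

lemma P_term_in [intro]: "v \<in> verts E \<Longrightarrow> f \<in> carrier G \<Longrightarrow> P_term v f \<in> terms"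
  by (rule star_terms.intros) (auto simp: ep_generators_def)

lemma S_term_in [intro]: "e \<in> arcs E \<Longrightarrow> g \<in> carrier G \<Longrightarrow> S_term e g \<in> terms"
  by (rule star_terms.intros) (auto simp: ep_generators_def)

text \<open>
  Every generator moves points along a partial bijection, so a value of the result is determined
  by finitely many values of the argument, although the argument is an arbitrary function. This
  replaces finite rows of matrices.
\<close>

lemma term_op_local:
  fixes \<tau> :: "'i \<Rightarrow> 'i"
  shows "t \<in> terms \<Longrightarrow> \<exists>D. finite D \<and> (\<forall>\<xi>\<in>K_valued. \<forall>\<eta>\<in>K_valued. (\<forall>(y, j)\<in>D. \<xi> y j = \<eta> y j) \<longrightarrow> term_op \<tau> t b \<xi> x i = term_op \<tau> t b \<eta> x i)"
proof (induction t arbitrary: b x i rule: star_terms.induct)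
  case (1 a)
  show ?case
  proof (cases a)
    case (PGen v f)
    show ?thesis unfolding PGen
      by (rule exI[of _ "{(inf_act (inv\<^bsub>G\<^esub> f) x, i), (inf_act f x, i), (inf_act (inv\<^bsub>G\<^esub> (inv\<^bsub>G\<^esub> f)) x, i)}"]) (auto simp: vertex_op_def)
  next
    case (SGen e g)
    show ?thesis unfolding SGen
      by (rule exI[of _ "{(inf_act (inv\<^bsub>G\<^esub> g) (shift x), \<tau> i), (extend e (inf_act g x), inv_into UNIV \<tau> i)}"])
        (auto simp: edge_op_def edge_op_adj_def)
  qed
next
  case 2
  show ?case by (rule exI[of _ "{}"]) simp
next
  case (3 s t)
  obtain D1 where D1: "finite D1" "\<forall>\<xi>\<in>K_valued. \<forall>\<eta>\<in>K_valued. (\<forall>(y, j)\<in>D1. \<xi> y j = \<eta> y j) \<longrightarrow> term_op \<tau> s b \<xi> x i = term_op \<tau> s b \<eta> x i"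
    using 3(3)[of b x i] by (elim exE conjE)
  obtain D2 where D2: "finite D2" "\<forall>\<xi>\<in>K_valued. \<forall>\<eta>\<in>K_valued. (\<forall>(y, j)\<in>D2. \<xi> y j = \<eta> y j) \<longrightarrow> term_op \<tau> t b \<xi> x i = term_op \<tau> t b \<eta> x i"
    using 3(4)[of b x i] by (elim exE conjE)
  show ?case
  proof (intro exI[of _ "D1 \<union> D2"] conjI ballI impI)
    fix \<xi> \<eta> :: "(nat \<Rightarrow> 'e) \<Rightarrow> 'i \<Rightarrow> 'k"
    assume "\<xi> \<in> K_valued" "\<eta> \<in> K_valued" "\<forall>(y, j)\<in>D1 \<union> D2. \<xi> y j = \<eta> y j"
    then have "term_op \<tau> s b \<xi> x i = term_op \<tau> s b \<eta> x i" "term_op \<tau> t b \<xi> x i = term_op \<tau> t b \<eta> x i"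
      using D1(2)[rule_format, of \<xi> \<eta>] D2(2)[rule_format, of \<xi> \<eta>] by simp_all
    then show "term_op \<tau> (s \<^bold>+ t) b \<xi> x i = term_op \<tau> (s \<^bold>+ t) b \<eta> x i" by simp
  qed (use D1 D2 in simp)
next
  case (4 t)
  obtain D where D: "finite D" "\<forall>\<xi>\<in>K_valued. \<forall>\<eta>\<in>K_valued. (\<forall>(y, j)\<in>D. \<xi> y j = \<eta> y j) \<longrightarrow> term_op \<tau> t b \<xi> x i = term_op \<tau> t b \<eta> x i"
    using 4(2)[of b x i] by (elim exE conjE)
  show ?case
  proof (intro exI[of _ D] conjI D(1) ballI impI)
    fix \<xi> \<eta> :: "(nat \<Rightarrow> 'e) \<Rightarrow> 'i \<Rightarrow> 'k"
    assume "\<xi> \<in> K_valued" "\<eta> \<in> K_valued" "\<forall>(y, j)\<in>D. \<xi> y j = \<eta> y j"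
    then have "term_op \<tau> t b \<xi> x i = term_op \<tau> t b \<eta> x i" by (rule D(2)[THEN bspec, THEN bspec, THEN mp])
    then show "term_op \<tau> (Neg t) b \<xi> x i = term_op \<tau> (Neg t) b \<eta> x i" by simp
  qed
next
  case (5 s t)
  have comp: "\<exists>D. finite D \<and> (\<forall>\<xi>\<in>K_valued. \<forall>\<eta>\<in>K_valued. (\<forall>(y, j)\<in>D. \<xi> y j = \<eta> y j) \<longrightarrow>
      term_op \<tau> p b (term_op \<tau> q b \<xi>) x i = term_op \<tau> p b (term_op \<tau> q b \<eta>) x i)"
    if p: "\<exists>D. finite D \<and> (\<forall>\<xi>\<in>K_valued. \<forall>\<eta>\<in>K_valued. (\<forall>(y, j)\<in>D. \<xi> y j = \<eta> y j) \<longrightarrow> term_op \<tau> p b \<xi> x i = term_op \<tau> p b \<eta> x i)"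
      and q: "\<And>y j. \<exists>D. finite D \<and> (\<forall>\<xi>\<in>K_valued. \<forall>\<eta>\<in>K_valued. (\<forall>(z, k)\<in>D. \<xi> z k = \<eta> z k) \<longrightarrow> term_op \<tau> q b \<xi> y j = term_op \<tau> q b \<eta> y j)"
      and qt: "q \<in> terms" for p q
  proof -
    obtain D where D: "finite D" "\<forall>\<xi>\<in>K_valued. \<forall>\<eta>\<in>K_valued. (\<forall>(y, j)\<in>D. \<xi> y j = \<eta> y j) \<longrightarrow> term_op \<tau> p b \<xi> x i = term_op \<tau> p b \<eta> x i"
      using p by (elim exE conjE)
    define C where "C y j = (SOME D. finite D \<and> (\<forall>\<xi>\<in>K_valued. \<forall>\<eta>\<in>K_valued. (\<forall>(z, k)\<in>D. \<xi> z k = \<eta> z k) \<longrightarrow>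
        term_op \<tau> q b \<xi> y j = term_op \<tau> q b \<eta> y j))" for y j
    have C: "finite (C y j) \<and> (\<forall>\<xi>\<in>K_valued. \<forall>\<eta>\<in>K_valued. (\<forall>(z, k)\<in>C y j. \<xi> z k = \<eta> z k) \<longrightarrow>
        term_op \<tau> q b \<xi> y j = term_op \<tau> q b \<eta> y j)" for y j
      unfolding C_def by (rule someI_ex[OF q])
    show ?thesis
    proof (intro exI[of _ "\<Union>(y, j)\<in>D. C y j"] conjI ballI impI)
      show "finite (\<Union>(y, j)\<in>D. C y j)" using D(1) C by auto
      fix \<xi> \<eta> :: "(nat \<Rightarrow> 'e) \<Rightarrow> 'i \<Rightarrow> 'k"
      assume \<xi>: "\<xi> \<in> K_valued" and \<eta>: "\<eta> \<in> K_valued" and eq: "\<forall>(z, k)\<in>(\<Union>(y, j)\<in>D. C y j). \<xi> z k = \<eta> z k"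
      have "term_op \<tau> q b \<xi> y j = term_op \<tau> q b \<eta> y j" if "(y, j) \<in> D" for y j
      proof -
        have "\<forall>(z, k)\<in>C y j. \<xi> z k = \<eta> z k" using eq that by blast
        then show ?thesis by (rule C[of y j, THEN conjunct2, THEN bspec, THEN bspec, THEN mp, OF \<xi> \<eta>])
      qed
      then have "\<forall>(y, j)\<in>D. term_op \<tau> q b \<xi> y j = term_op \<tau> q b \<eta> y j" by auto
      then show "term_op \<tau> p b (term_op \<tau> q b \<xi>) x i = term_op \<tau> p b (term_op \<tau> q b \<eta>) x i"
        by (rule D(2)[THEN bspec, THEN bspec, THEN mp, OF term_op_closed[OF qt \<xi>] term_op_closed[OF qt \<eta>]])
    qed
  qed
  show ?case
  proof (cases b)
    case True
    show ?thesis using comp[OF 5(4) 5(3) 5(1)] True by simp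
  next
    case False
    show ?thesis using comp[OF 5(3) 5(4) 5(2)] False by simp
  qed
next
  case (6 c t)
  obtain D where D: "finite D" "\<forall>\<xi>\<in>K_valued. \<forall>\<eta>\<in>K_valued. (\<forall>(y, j)\<in>D. \<xi> y j = \<eta> y j) \<longrightarrow> term_op \<tau> t b \<xi> x i = term_op \<tau> t b \<eta> x i"
    using 6(3)[of b x i] by (elim exE conjE)
  show ?case
  proof (intro exI[of _ D] conjI D(1) ballI impI)
    fix \<xi> \<eta> :: "(nat \<Rightarrow> 'e) \<Rightarrow> 'i \<Rightarrow> 'k"
    assume "\<xi> \<in> K_valued" "\<eta> \<in> K_valued" "\<forall>(y, j)\<in>D. \<xi> y j = \<eta> y j"
    then have "term_op \<tau> t b \<xi> x i = term_op \<tau> t b \<eta> x i" by (rule D(2)[THEN bspec, THEN bspec, THEN mp])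
    then show "term_op \<tau> (c \<^bold>\<cdot> t) b \<xi> x i = term_op \<tau> (c \<^bold>\<cdot> t) b \<eta> x i" by simp
  qed
next
  case (7 t)
  show ?case using 7(2)[of "\<not> b" x i] by simp
qed

definition cut :: "'v set \<Rightarrow> ((nat \<Rightarrow> 'e) \<Rightarrow> 'i \<Rightarrow> 'k) \<Rightarrow> (nat \<Rightarrow> 'e) \<Rightarrow> 'i \<Rightarrow> 'k" where
  "cut W \<xi> = (\<lambda>x i. if x \<in> inf_paths \<and> inf_range x \<in> W then \<xi> x i else \<zero>)"

lemma cut_closed: "\<xi> \<in> K_valued \<Longrightarrow> cut W \<xi> \<in> K_valued"
  by (simp add: K_valued_def cut_def)

text \<open>
  A term involves finitely many generators, so it sees only the paths with range in a finite set
  of vertices. Below this yields local units.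
\<close>

lemma term_op_support:
  fixes \<tau> :: "'i \<Rightarrow> 'i"
  shows "t \<in> terms \<Longrightarrow> \<exists>V. finite V \<and> V \<subseteq> verts E \<and>
     (\<forall>W b. \<forall>\<xi>\<in>K_valued. V \<subseteq> W \<longrightarrow> cut W (term_op \<tau> t b \<xi>) = term_op \<tau> t b \<xi> \<and> term_op \<tau> t b (cut W \<xi>) = term_op \<tau> t b \<xi>)"
proof (induction t rule: star_terms.induct)
  case (1 a)
  then consider (P) v f where "a = PGen v f" "v \<in> verts E" "f \<in> carrier G"
    | (S) e g where "a = SGen e g" "e \<in> arcs E" "g \<in> carrier G"
    by (auto simp: ep_generators_def)
  then show ?case
  proof cases
    case P
    then have fv: "\<sigma>\<^sub>0 (inv\<^bsub>G\<^esub> f) v \<in> verts E" by (simp add: vertex_closed)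
    have r: "\<sigma>\<^sub>0 f (\<sigma>\<^sub>0 (inv\<^bsub>G\<^esub> f) v) = v" using P vertex_inv_eq_iff[of f v "\<sigma>\<^sub>0 (inv\<^bsub>G\<^esub> f) v"] fv by simp
    show ?thesis
      unfolding P(1)
    proof (intro exI[of _ "{v, \<sigma>\<^sub>0 (inv\<^bsub>G\<^esub> f) v}"] conjI allI ballI impI)
      fix W b and \<xi> :: "(nat \<Rightarrow> 'e) \<Rightarrow> 'i \<Rightarrow> 'k" assume W: "{v, \<sigma>\<^sub>0 (inv\<^bsub>G\<^esub> f) v} \<subseteq> W"
      show "cut W (term_op \<tau> (P_term v f) b \<xi>) = term_op \<tau> (P_term v f) b \<xi>"
        using W by (auto simp: cut_def vertex_op_def fun_eq_iff)
      show "term_op \<tau> (P_term v f) b (cut W \<xi>) = term_op \<tau> (P_term v f) b \<xi>"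
        using W P(2,3) r by (auto simp: cut_def vertex_op_def fun_eq_iff act_infpath rng_act)
    qed (use P fv in auto)
  next
    case S
    have r: "\<sigma>\<^sub>0 (inv\<^bsub>G\<^esub> g) (tail E e) \<in> verts E" using S by (simp add: vertex_closed)
    show ?thesis
      unfolding S(1)
    proof (intro exI[of _ "{head E e, \<sigma>\<^sub>0 (inv\<^bsub>G\<^esub> g) (tail E e)}"] conjI allI ballI impI)
      fix W b and \<xi> :: "(nat \<Rightarrow> 'e) \<Rightarrow> 'i \<Rightarrow> 'k" assume W: "{head E e, \<sigma>\<^sub>0 (inv\<^bsub>G\<^esub> g) (tail E e)} \<subseteq> W"
      have u: "inf_range x = \<sigma>\<^sub>0 (inv\<^bsub>G\<^esub> g) (tail E e)" if "x \<in> inf_paths" "\<sigma>\<^sub>0 g (inf_range x) = tail E e" for x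
        using that S vertex_inv_eq_iff[of g "tail E e" "inf_range x"] rng_in_verts[of x] by auto
      show "cut W (term_op \<tau> (S_term e g) b \<xi>) = term_op \<tau> (S_term e g) b \<xi>"
        using W u by (auto simp: cut_def edge_op_def edge_op_adj_def fun_eq_iff) (auto simp: inf_range_def)
      have i: "extend e (inf_act g x) \<in> inf_paths" if "x \<in> inf_paths" "\<sigma>\<^sub>0 g (inf_range x) = tail E e" for x
        using that S by (intro extend_infpath) (simp_all add: act_infpath rng_act)
      show "term_op \<tau> (S_term e g) b (cut W \<xi>) = term_op \<tau> (S_term e g) b \<xi>"
        using W S(2,3) i
        by (auto simp: cut_def edge_op_def edge_op_adj_def fun_eq_iff act_infpath rng_act shift_infpath rng_shift)
    qed (use S r in auto)
  qed
next
  case 2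
  show ?case by (rule exI[of _ "{}"]) (simp add: cut_def)
next
  case (3 s t)
  obtain V1 where V1: "finite V1" "V1 \<subseteq> verts E"
    "\<forall>W b. \<forall>\<xi>\<in>K_valued. V1 \<subseteq> W \<longrightarrow> cut W (term_op \<tau> s b \<xi>) = term_op \<tau> s b \<xi> \<and> term_op \<tau> s b (cut W \<xi>) = term_op \<tau> s b \<xi>"
    using 3(3) by (elim exE conjE)
  obtain V2 where V2: "finite V2" "V2 \<subseteq> verts E"
    "\<forall>W b. \<forall>\<xi>\<in>K_valued. V2 \<subseteq> W \<longrightarrow> cut W (term_op \<tau> t b \<xi>) = term_op \<tau> t b \<xi> \<and> term_op \<tau> t b (cut W \<xi>) = term_op \<tau> t b \<xi>"
    using 3(4) by (elim exE conjE)
  show ?case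
  proof (intro exI[of _ "V1 \<union> V2"] conjI allI ballI impI)
    fix W b and \<xi> :: "(nat \<Rightarrow> 'e) \<Rightarrow> 'i \<Rightarrow> 'k" assume \<xi>: "\<xi> \<in> K_valued" and W: "V1 \<union> V2 \<subseteq> W"
    have s: "cut W (term_op \<tau> s b \<xi>) = term_op \<tau> s b \<xi>" "term_op \<tau> s b (cut W \<xi>) = term_op \<tau> s b \<xi>"
      and t: "cut W (term_op \<tau> t b \<xi>) = term_op \<tau> t b \<xi>" "term_op \<tau> t b (cut W \<xi>) = term_op \<tau> t b \<xi>"
      using V1(3) V2(3) \<xi> W by simp_all
    show "term_op \<tau> (s \<^bold>+ t) b (cut W \<xi>) = term_op \<tau> (s \<^bold>+ t) b \<xi>" using s t by simp
    have "cut W (term_op \<tau> (s \<^bold>+ t) b \<xi>) = (\<lambda>x i. cut W (term_op \<tau> s b \<xi>) x i \<oplus> cut W (term_op \<tau> t b \<xi>) x i)"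
      by (auto simp: cut_def fun_eq_iff)
    then show "cut W (term_op \<tau> (s \<^bold>+ t) b \<xi>) = term_op \<tau> (s \<^bold>+ t) b \<xi>" using s t by simp
  qed (use V1 V2 in auto)
next
  case (4 t)
  obtain V where V: "finite V" "V \<subseteq> verts E"
    "\<forall>W b. \<forall>\<xi>\<in>K_valued. V \<subseteq> W \<longrightarrow> cut W (term_op \<tau> t b \<xi>) = term_op \<tau> t b \<xi> \<and> term_op \<tau> t b (cut W \<xi>) = term_op \<tau> t b \<xi>"
    using 4(2) by (elim exE conjE)
  have "cut W (term_op \<tau> (Neg t) b \<xi>) = (\<lambda>x i. \<ominus> cut W (term_op \<tau> t b \<xi>) x i)" for W b \<xi>
    by (auto simp: cut_def fun_eq_iff)
  then show ?case using V by (intro exI[of _ V]) (simp add: fun_eq_iff)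
next
  case (5 s t)
  obtain V1 where V1: "finite V1" "V1 \<subseteq> verts E"
    "\<forall>W b. \<forall>\<xi>\<in>K_valued. V1 \<subseteq> W \<longrightarrow> cut W (term_op \<tau> s b \<xi>) = term_op \<tau> s b \<xi> \<and> term_op \<tau> s b (cut W \<xi>) = term_op \<tau> s b \<xi>"
    using 5(3) by (elim exE conjE)
  obtain V2 where V2: "finite V2" "V2 \<subseteq> verts E"
    "\<forall>W b. \<forall>\<xi>\<in>K_valued. V2 \<subseteq> W \<longrightarrow> cut W (term_op \<tau> t b \<xi>) = term_op \<tau> t b \<xi> \<and> term_op \<tau> t b (cut W \<xi>) = term_op \<tau> t b \<xi>"
    using 5(4) by (elim exE conjE)
  show ?case
  proof (intro exI[of _ "V1 \<union> V2"] conjI allI ballI impI)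
    fix W b and \<xi> :: "(nat \<Rightarrow> 'e) \<Rightarrow> 'i \<Rightarrow> 'k" assume \<xi>: "\<xi> \<in> K_valued" and W: "V1 \<union> V2 \<subseteq> W"
    have s: "cut W (term_op \<tau> s b \<zeta>) = term_op \<tau> s b \<zeta>" "term_op \<tau> s b (cut W \<zeta>) = term_op \<tau> s b \<zeta>"
      and t: "cut W (term_op \<tau> t b \<zeta>) = term_op \<tau> t b \<zeta>" "term_op \<tau> t b (cut W \<zeta>) = term_op \<tau> t b \<zeta>" if "\<zeta> \<in> K_valued" for \<zeta>
      using V1(3) V2(3) W that by simp_all
    have c: "term_op \<tau> s b \<xi> \<in> K_valued" "term_op \<tau> t b \<xi> \<in> K_valued" using term_op_closed 5(1,2) \<xi> by auto
    show "cut W (term_op \<tau> (s \<^bold>* t) b \<xi>) = term_op \<tau> (s \<^bold>* t) b \<xi>"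
      using s(1)[OF c(2)] t(1)[OF c(1)] by (cases b) simp_all
    show "term_op \<tau> (s \<^bold>* t) b (cut W \<xi>) = term_op \<tau> (s \<^bold>* t) b \<xi>"
      using s(2)[OF \<xi>] t(2)[OF \<xi>] by (cases b) simp_all
  qed (use V1 V2 in auto)
next
  case (6 c t)
  obtain V where V: "finite V" "V \<subseteq> verts E"
    "\<forall>W b. \<forall>\<xi>\<in>K_valued. V \<subseteq> W \<longrightarrow> cut W (term_op \<tau> t b \<xi>) = term_op \<tau> t b \<xi> \<and> term_op \<tau> t b (cut W \<xi>) = term_op \<tau> t b \<xi>"
    using 6(3) by (elim exE conjE)
  have "cut W (term_op \<tau> (c \<^bold>\<cdot> t) b \<xi>) = (\<lambda>x i. c \<otimes> cut W (term_op \<tau> t b \<xi>) x i)" for W b \<xi>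
    using 6(1) by (auto simp: cut_def fun_eq_iff)
  then show ?case using V by (intro exI[of _ V]) (simp add: fun_eq_iff)
next
  case (7 t)
  obtain V where V: "finite V" "V \<subseteq> verts E"
    "\<forall>W b. \<forall>\<xi>\<in>K_valued. V \<subseteq> W \<longrightarrow> cut W (term_op \<tau> t b \<xi>) = term_op \<tau> t b \<xi> \<and> term_op \<tau> t b (cut W \<xi>) = term_op \<tau> t b \<xi>"
    using 7(2) by (elim exE conjE)
  then show ?case by (intro exI[of _ V]) simp
qed

section \<open>Cylinder sets and prefixes\<close>

definition cylinder :: "nat \<Rightarrow> (nat \<Rightarrow> 'e) \<Rightarrow> (nat \<Rightarrow> 'e) set" where
  "cylinder n x = {y \<in> inf_paths. inf_range y = inf_range x \<and> (\<forall>m<n. y m = x m)}"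

lemma cylinder_Suc:
  assumes "x \<in> inf_paths"
  shows "y \<in> cylinder (Suc n) x \<longleftrightarrow> y \<in> inf_paths \<and> y 0 = x 0 \<and> shift y \<in> cylinder n (shift x)"
proof
  assume y: "y \<in> cylinder (Suc n) x"
  then have "y \<in> inf_paths" "\<forall>m<Suc n. y m = x m" by (auto simp: cylinder_def)
  then show "y \<in> inf_paths \<and> y 0 = x 0 \<and> shift y \<in> cylinder n (shift x)"
    using assms by (auto simp: cylinder_def shift_infpath rng_shift) (simp add: shift_def)
next
  assume y: "y \<in> inf_paths \<and> y 0 = x 0 \<and> shift y \<in> cylinder n (shift x)"
  then have "y m = x m" if "m < Suc n" for m
    using that by (cases m) (auto simp: cylinder_def shift_def)
  then show "y \<in> cylinder (Suc n) x" using y by (auto simp: cylinder_def inf_range_def)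
qed

text \<open>
  For the prefix \<open>\<alpha>\<close> of \<open>x\<close> of length \<open>n\<close>, these are the terms \<open>s\<^sub>\<alpha> s\<^sub>\<alpha>\<^sup>*\<close> and, below, \<open>s\<^sub>\<alpha>\<close>.
\<close>

primrec cylinder_term :: "nat \<Rightarrow> (nat \<Rightarrow> 'e) \<Rightarrow> ('k, ('v, 'e, 'g) ep_generator) star_term" where
  "cylinder_term 0 x = P_term (inf_range x) \<one>\<^bsub>G\<^esub>"
| "cylinder_term (Suc n) x = S_term (x 0) \<one>\<^bsub>G\<^esub> \<^bold>* cylinder_term n (shift x) \<^bold>* (S_term (x 0) \<one>\<^bsub>G\<^esub>)\<^sup>\<star>"

primrec prefix_term :: "nat \<Rightarrow> (nat \<Rightarrow> 'e) \<Rightarrow> ('k, ('v, 'e, 'g) ep_generator) star_term" where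
  "prefix_term 0 x = P_term (inf_range x) \<one>\<^bsub>G\<^esub>"
| "prefix_term (Suc n) x = S_term (x 0) \<one>\<^bsub>G\<^esub> \<^bold>* prefix_term n (shift x)"

lemma cylinder_term_in: "x \<in> inf_paths \<Longrightarrow> cylinder_term n x \<in> terms"
  by (induction n arbitrary: x)
    (auto simp: rng_in_verts shift_infpath inf_pathsD intro!: star_terms.intros(5,7))

lemma prefix_term_in: "x \<in> inf_paths \<Longrightarrow> prefix_term n x \<in> terms"
  by (induction n arbitrary: x)
    (auto simp: rng_in_verts shift_infpath inf_pathsD intro!: star_terms.intros(5))

lemma extend_shift: "y 0 = e \<Longrightarrow> extend e (shift y) = y"
  by auto

lemma term_op_cylinder_term:
  assumes "bij \<tau>" "x \<in> inf_paths"
  shows "term_op \<tau> (cylinder_term n x) False \<xi> = (\<lambda>y i. if y \<in> cylinder n x then \<xi> y i else \<zero>)"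
  using assms(2)
proof (induction n arbitrary: x \<xi>)
  case 0
  then show ?case by (auto simp: vertex_op_one cylinder_def fun_eq_iff)
next
  case (Suc n)
  have i: "inv_into UNIV \<tau> (\<tau> i) = i" for i using inv_f_f[OF bij_is_inj[OF assms(1)]] .
  show ?case
    using Suc shift_infpath[OF Suc.prems]
    by (auto simp: fun_eq_iff cylinder_Suc edge_op_one edge_op_adj_one i shift_infpath rng_shift extend_shift)
qed

lemma term_op_prefix_term:
  assumes "x \<in> inf_paths"
  shows "term_op \<tau> (prefix_term n x) False \<xi> =
    (\<lambda>y i. if y \<in> cylinder n x then \<xi> (\<lambda>m. y (m + n)) ((\<tau> ^^ n) i) else \<zero>)"
  using assms
proof (induction n arbitrary: x \<xi>)
  case 0
  then show ?case by (auto simp: vertex_op_one cylinder_def fun_eq_iff)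
next
  case (Suc n)
  have "(\<lambda>m. shift y (m + n)) = (\<lambda>m. y (m + Suc n))" for y by (simp add: shift_def)
  then show ?case
    using Suc shift_infpath[OF Suc.prems]
    by (auto simp: fun_eq_iff cylinder_Suc edge_op_one shift_infpath funpow_swap1)
qed

section \<open>The algebra and its representation\<close>

abbreviation L :: "('k, ('k, ('v, 'e, 'g) ep_generator) star_term set) star_algebra" where
  "L \<equiv> exel_pardo_algebra K G E \<sigma>\<^sub>0 \<sigma>\<^sub>1 \<phi>"

definition term_class :: "('k, ('v, 'e, 'g) ep_generator) star_term \<Rightarrow> ('k, ('v, 'e, 'g) ep_generator) star_term set" where
  "term_class t = star_rel K (ep_generators G E) (ep_relations G E \<sigma>\<^sub>0 \<sigma>\<^sub>1 \<phi>) `` {t}"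

sublocale L: assoc_algebra K L
  by (rule assoc_algebra_exel_pardo_algebra[OF K.is_cring])

lemma carrier_L: "carrier L = term_class ` terms"
  by (auto simp: exel_pardo_algebra_def Let_def presented_algebra_def quotient_def term_class_def)

lemma term_class_closed [intro, simp]: "t \<in> terms \<Longrightarrow> term_class t \<in> carrier L"
  by (simp add: carrier_L)

lemma term_class_Null: "\<zero>\<^bsub>L\<^esub> = term_class Null"
  by (simp add: exel_pardo_algebra_def Let_def presented_algebra_def term_class_def)

lemma term_class_add: "s \<in> terms \<Longrightarrow> t \<in> terms \<Longrightarrow> term_class s \<oplus>\<^bsub>L\<^esub> term_class t = term_class (s \<^bold>+ t)"
  using presented_algebra_ops(1)[OF K.is_cring] by (simp add: exel_pardo_algebra_def Let_def term_class_def)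

lemma term_class_mult: "s \<in> terms \<Longrightarrow> t \<in> terms \<Longrightarrow> term_class s \<otimes>\<^bsub>L\<^esub> term_class t = term_class (s \<^bold>* t)"
  using presented_algebra_ops(2)[OF K.is_cring] by (simp add: exel_pardo_algebra_def Let_def term_class_def)

lemma term_class_smult: "c \<in> carrier K \<Longrightarrow> t \<in> terms \<Longrightarrow> c \<odot>\<^bsub>L\<^esub> term_class t = term_class (c \<^bold>\<cdot> t)"
  using presented_algebra_ops(3)[OF K.is_cring] by (simp add: exel_pardo_algebra_def Let_def term_class_def)

lemma one_L: "\<one>\<^bsub>L\<^esub> = finsum L (\<lambda>v. term_class (P_term v \<one>\<^bsub>G\<^esub>)) (verts E)"
  by (simp add: exel_pardo_algebra_def Let_def term_class_def finsum_def)

lemma term_class_eqI: "star_eq K (ep_generators G E) (ep_relations G E \<sigma>\<^sub>0 \<sigma>\<^sub>1 \<phi>) s t \<Longrightarrow> term_class s = term_class t"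
  unfolding term_class_def
  by (intro equiv_class_eq[OF equiv_star_rel[OF K.is_cring]]) (simp add: star_rel_def)

lemma term_class_eqD:
  assumes "term_class s = term_class t" "t \<in> terms"
  shows "star_eq K (ep_generators G E) (ep_relations G E \<sigma>\<^sub>0 \<sigma>\<^sub>1 \<phi>) s t"
  using eq_equiv_class[OF assms(1)[unfolded term_class_def] equiv_star_rel[OF K.is_cring] assms(2)]
  by (simp add: star_rel_def)

lemma term_class_minus:
  assumes "t \<in> terms"
  shows "\<ominus>\<^bsub>L\<^esub> term_class t = term_class (Neg t)"
proof (rule L.M.minus_equality)
  show "term_class (Neg t) \<oplus>\<^bsub>L\<^esub> term_class t = \<zero>\<^bsub>L\<^esub>"
    using assms by (simp add: term_class_add term_class_Null star_terms.intros term_class_eqI star_eq.sum_neg)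
qed (use assms in \<open>simp_all add: star_terms.intros\<close>)

text \<open>
  A congruence class acts through any of its representatives; on functions with values in the
  field the choice makes no difference.
\<close>

definition path_rep :: "('i \<Rightarrow> 'i) \<Rightarrow> ('k, ('v, 'e, 'g) ep_generator) star_term set \<Rightarrow>
    ((nat \<Rightarrow> 'e) \<Rightarrow> 'i \<Rightarrow> 'k) \<Rightarrow> (nat \<Rightarrow> 'e) \<Rightarrow> 'i \<Rightarrow> 'k" where
  "path_rep \<tau> a = term_op \<tau> (SOME t. t \<in> terms \<and> term_class t = a) False"

lemma path_rep_term_class:
  assumes "bij \<tau>" "t \<in> terms" "\<xi> \<in> K_valued"
  shows "path_rep \<tau> (term_class t) \<xi> = term_op \<tau> t False \<xi>"
proof -
  have "(SOME s. s \<in> terms \<and> term_class s = term_class t) \<in> terms \<and> term_class (SOME s. s \<in> terms \<and> term_class s = term_class t) = term_class t"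
    by (rule someI[of _ t]) (use assms in simp)
  then show ?thesis
    unfolding path_rep_def using term_op_star_eq[OF assms(1) term_class_eqD assms(3)] assms(2) by blast
qed

lemma path_rep_closed: "bij \<tau> \<Longrightarrow> a \<in> carrier L \<Longrightarrow> \<xi> \<in> K_valued \<Longrightarrow> path_rep \<tau> a \<xi> \<in> K_valued"
  by (auto simp: carrier_L path_rep_term_class term_op_closed)

lemma path_rep_val: "bij \<tau> \<Longrightarrow> a \<in> carrier L \<Longrightarrow> \<xi> \<in> K_valued \<Longrightarrow> path_rep \<tau> a \<xi> x i \<in> carrier K"
  by (rule K_valuedD[OF path_rep_closed])

lemma path_rep_zero: "bij \<tau> \<Longrightarrow> \<xi> \<in> K_valued \<Longrightarrow> path_rep \<tau> \<zero>\<^bsub>L\<^esub> \<xi> = (\<lambda>x i. \<zero>)"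
  by (simp add: term_class_Null path_rep_term_class star_terms.intros)

lemma path_rep_add:
  "bij \<tau> \<Longrightarrow> a \<in> carrier L \<Longrightarrow> b \<in> carrier L \<Longrightarrow> \<xi> \<in> K_valued \<Longrightarrow>
    path_rep \<tau> (a \<oplus>\<^bsub>L\<^esub> b) \<xi> = (\<lambda>x i. path_rep \<tau> a \<xi> x i \<oplus> path_rep \<tau> b \<xi> x i)"
  by (auto simp: carrier_L term_class_add path_rep_term_class star_terms.intros)

lemma path_rep_minus:
  "bij \<tau> \<Longrightarrow> a \<in> carrier L \<Longrightarrow> \<xi> \<in> K_valued \<Longrightarrow> path_rep \<tau> (\<ominus>\<^bsub>L\<^esub> a) \<xi> = (\<lambda>x i. \<ominus> path_rep \<tau> a \<xi> x i)"
  by (auto simp: carrier_L term_class_minus path_rep_term_class star_terms.intros)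

lemma path_rep_mult:
  "bij \<tau> \<Longrightarrow> a \<in> carrier L \<Longrightarrow> b \<in> carrier L \<Longrightarrow> \<xi> \<in> K_valued \<Longrightarrow> path_rep \<tau> (a \<otimes>\<^bsub>L\<^esub> b) \<xi> = path_rep \<tau> a (path_rep \<tau> b \<xi>)"
  by (auto simp: carrier_L term_class_mult path_rep_term_class star_terms.intros term_op_closed)

lemma path_rep_smult:
  "bij \<tau> \<Longrightarrow> c \<in> carrier K \<Longrightarrow> a \<in> carrier L \<Longrightarrow> \<xi> \<in> K_valued \<Longrightarrow>
    path_rep \<tau> (c \<odot>\<^bsub>L\<^esub> a) \<xi> = (\<lambda>x i. c \<otimes> path_rep \<tau> a \<xi> x i)"
  by (auto simp: carrier_L term_class_smult path_rep_term_class star_terms.intros)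

lemma path_rep_scale:
  assumes "bij \<tau>" "a \<in> carrier L" "c \<in> carrier K" "\<xi> \<in> K_valued"
  shows "path_rep \<tau> a (\<lambda>x i. c \<otimes> \<xi> x i) = (\<lambda>x i. c \<otimes> path_rep \<tau> a \<xi> x i)"
proof -
  have "(\<lambda>x i. c \<otimes> \<xi> x i) \<in> K_valued" using assms by (simp add: K_valued_def)
  then show ?thesis using assms by (auto simp: carrier_L path_rep_term_class term_op_scale)
qed

lemma path_rep_fn_zero:
  assumes "bij \<tau>" "a \<in> carrier L"
  shows "path_rep \<tau> a (\<lambda>x i. \<zero>) = (\<lambda>x i. \<zero>)"
proof -
  have z: "(\<lambda>x i. \<zero>) \<in> K_valued" by (simp add: K_valued_def)
  have "path_rep \<tau> a (\<lambda>x i. \<zero> \<otimes> \<zero>) = (\<lambda>x i. \<zero> \<otimes> path_rep \<tau> a (\<lambda>x i. \<zero>) x i)"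
    using path_rep_scale[OF assms K.zero_closed z] .
  then show ?thesis using path_rep_val[OF assms z] by simp
qed

definition one_fn :: "(nat \<Rightarrow> 'e) \<Rightarrow> 'i \<Rightarrow> 'k" where
  "one_fn = (\<lambda>x i. \<one>)"

lemma one_fn_closed: "one_fn \<in> K_valued"
  by (simp add: one_fn_def K_valued_def)

text \<open>
  Elements that act as the projection onto a set of paths. In a simple algebra such an element is
  determined by its set, so computations with projections become computations with sets.
\<close>

definition diagonal :: "('k, ('v, 'e, 'g) ep_generator) star_term set \<Rightarrow> (nat \<Rightarrow> 'e) set \<Rightarrow> bool" where
  "diagonal a S \<longleftrightarrow> a \<in> carrier L \<and>
     (\<forall>\<xi> :: (nat \<Rightarrow> 'e) \<Rightarrow> unit \<Rightarrow> 'k. \<xi> \<in> K_valued \<longrightarrow> path_rep id a \<xi> = (\<lambda>x i. if x \<in> S then \<xi> x i else \<zero>))"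

lemma diagonalD:
  assumes "diagonal a S"
  shows "a \<in> carrier L" "\<xi> \<in> K_valued \<Longrightarrow> path_rep id a \<xi> = (\<lambda>x (i :: unit). if x \<in> S then \<xi> x i else \<zero>)"
  using assms by (auto simp: diagonal_def)

lemma restrict_closed: "\<xi> \<in> K_valued \<Longrightarrow> (\<lambda>x i. if x \<in> S then \<xi> x i else \<zero>) \<in> K_valued"
  by (simp add: K_valued_def)

lemma diagonal_mult:
  assumes "diagonal a S" "diagonal b T"
  shows "diagonal (a \<otimes>\<^bsub>L\<^esub> b) (S \<inter> T)"
  unfolding diagonal_def
proof (intro conjI allI impI)
  show "a \<otimes>\<^bsub>L\<^esub> b \<in> carrier L" using diagonalD(1) assms L.mult_closed by blast
  fix \<xi> :: "(nat \<Rightarrow> 'e) \<Rightarrow> unit \<Rightarrow> 'k" assume "\<xi> \<in> K_valued"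
  then show "path_rep id (a \<otimes>\<^bsub>L\<^esub> b) \<xi> = (\<lambda>x i. if x \<in> S \<inter> T then \<xi> x i else \<zero>)"
    using diagonalD(1)[OF assms(1)] diagonalD(1)[OF assms(2)] restrict_closed[of \<xi> T]
    by (simp add: path_rep_mult diagonalD(2)[OF assms(1)] diagonalD(2)[OF assms(2)] fun_eq_iff)
qed

lemma diagonal_add:
  assumes "diagonal a S" "diagonal b T" "S \<inter> T = {}"
  shows "diagonal (a \<oplus>\<^bsub>L\<^esub> b) (S \<union> T)"
  unfolding diagonal_def
proof (intro conjI allI impI)
  show "a \<oplus>\<^bsub>L\<^esub> b \<in> carrier L" using diagonalD(1)[OF assms(1)] diagonalD(1)[OF assms(2)] by simp
  fix \<xi> :: "(nat \<Rightarrow> 'e) \<Rightarrow> unit \<Rightarrow> 'k" assume \<xi>: "\<xi> \<in> K_valued"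
  then show "path_rep id (a \<oplus>\<^bsub>L\<^esub> b) \<xi> = (\<lambda>x i. if x \<in> S \<union> T then \<xi> x i else \<zero>)"
    using diagonalD(1)[OF assms(1)] diagonalD(1)[OF assms(2)] K_valuedD[OF \<xi>] assms(3)
    by (auto simp: path_rep_add diagonalD(2)[OF assms(1)] diagonalD(2)[OF assms(2)] fun_eq_iff)
qed

lemma diagonal_diff:
  assumes "diagonal a S" "diagonal b T" "T \<subseteq> S"
  shows "diagonal (a \<oplus>\<^bsub>L\<^esub> \<ominus>\<^bsub>L\<^esub> b) (S - T)"
  unfolding diagonal_def
proof (intro conjI allI impI)
  show "a \<oplus>\<^bsub>L\<^esub> \<ominus>\<^bsub>L\<^esub> b \<in> carrier L" using diagonalD(1)[OF assms(1)] diagonalD(1)[OF assms(2)] by simp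
  fix \<xi> :: "(nat \<Rightarrow> 'e) \<Rightarrow> unit \<Rightarrow> 'k" assume \<xi>: "\<xi> \<in> K_valued"
  then show "path_rep id (a \<oplus>\<^bsub>L\<^esub> \<ominus>\<^bsub>L\<^esub> b) \<xi> = (\<lambda>x i. if x \<in> S - T then \<xi> x i else \<zero>)"
    using diagonalD(1)[OF assms(1)] diagonalD(1)[OF assms(2)] K_valuedD[OF \<xi>] assms(3)
    by (auto simp: path_rep_add path_rep_minus diagonalD(2)[OF assms(1)] diagonalD(2)[OF assms(2)] fun_eq_iff K.r_neg)
qed

lemma diagonal_nonzero:
  assumes "diagonal a S" "x \<in> S"
  shows "a \<noteq> \<zero>\<^bsub>L\<^esub>"
proof
  assume "a = \<zero>\<^bsub>L\<^esub>"
  then have "(if x \<in> S then one_fn x () else \<zero>) = \<zero>"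
    using fun_cong[OF fun_cong[OF diagonalD(2)[OF assms(1) one_fn_closed]], of x "()"]
      fun_cong[OF fun_cong[OF path_rep_zero[OF bij_id one_fn_closed]], of x "()"]
    by simp
  then show False using assms(2) by (simp add: one_fn_def)
qed

lemma diagonal_zero: "diagonal \<zero>\<^bsub>L\<^esub> {}"
  by (simp add: diagonal_def path_rep_zero)

lemma diagonal_vertex: "v \<in> verts E \<Longrightarrow> diagonal (term_class (P_term v \<one>\<^bsub>G\<^esub>)) {x \<in> inf_paths. inf_range x = v}"
  by (simp add: diagonal_def path_rep_term_class P_term_in vertex_op_one)

lemma diagonal_cylinder: "x \<in> inf_paths \<Longrightarrow> diagonal (term_class (cylinder_term n x)) (cylinder n x)"
  by (simp add: diagonal_def path_rep_term_class cylinder_term_in term_op_cylinder_term)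

definition vertex_sum :: "'v set \<Rightarrow> ('k, ('v, 'e, 'g) ep_generator) star_term set" where
  "vertex_sum W = finsum L (\<lambda>v. term_class (P_term v \<one>\<^bsub>G\<^esub>)) W"

lemma diagonal_vertex_sum:
  assumes "finite W" "W \<subseteq> verts E"
  shows "diagonal (vertex_sum W) {x \<in> inf_paths. inf_range x \<in> W}"
  using assms
proof (induction W rule: finite_induct)
  case empty
  then show ?case by (simp add: vertex_sum_def diagonal_zero)
next
  case (insert v W)
  have "vertex_sum (insert v W) = term_class (P_term v \<one>\<^bsub>G\<^esub>) \<oplus>\<^bsub>L\<^esub> vertex_sum W"
    unfolding vertex_sum_def using insert by (intro L.M.finsum_insert) (auto simp: P_term_in)
  moreover have "diagonal (term_class (P_term v \<one>\<^bsub>G\<^esub>) \<oplus>\<^bsub>L\<^esub> vertex_sum W)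
      ({x \<in> inf_paths. inf_range x = v} \<union> {x \<in> inf_paths. inf_range x \<in> W})"
    using insert by (intro diagonal_add diagonal_vertex) auto
  moreover have "{x \<in> inf_paths. inf_range x = v} \<union> {x \<in> inf_paths. inf_range x \<in> W} = {x \<in> inf_paths. inf_range x \<in> insert v W}"
    by auto
  ultimately show ?case by simp
qed

end

locale simple_self_similar_graph = self_similar_graph K G E \<sigma>\<^sub>0 \<sigma>\<^sub>1 \<phi>
  for K :: "('k, 'm) ring_scheme" (structure)
    and G :: "('g, 'n) monoid_scheme" and E :: "('v, 'e) pre_digraph"
    and \<sigma>\<^sub>0 :: "'g \<Rightarrow> 'v \<Rightarrow> 'v" and \<sigma>\<^sub>1 :: "'g \<Rightarrow> 'e \<Rightarrow> 'e" and \<phi> :: "'g \<Rightarrow> 'e \<Rightarrow> 'g" +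
  assumes simple: "simple_algebra K L"
begin

sublocale S: simple_algebra K L
  by (rule simple)

text \<open>
  Without vertices there are no generators, and all terms are congruent to zero.
\<close>

lemma verts_nonempty: "verts E \<noteq> {}"
proof
  assume V: "verts E = {}"
  then have "arcs E = {}" using wellformed by blast
  with V have gen: "ep_generators G E = {}" by (auto simp: ep_generators_def)
  have "term_class t = \<zero>\<^bsub>L\<^esub>" if "t \<in> terms" for t
    using that
  proof (induction t rule: star_terms.induct)
    case (1 x) then show ?case by (simp add: gen)
  next
    case 2 then show ?case by (simp add: term_class_Null)
  next
    case (3 s t) then show ?case by (simp add: term_class_add[symmetric])
  next
    case (4 t) then show ?case by (simp add: term_class_minus[symmetric] L.minus_zero)
  next
    case (5 s t) then show ?case by (simp add: term_class_mult[symmetric] L.mult_zero_right)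
  next
    case (6 c t) then show ?case by (simp add: term_class_smult[symmetric])
  next
    case (7 t)
    have n: "Null \<in> terms" by (rule star_terms.intros)
    have "star_eq K (ep_generators G E) (ep_relations G E \<sigma>\<^sub>0 \<sigma>\<^sub>1 \<phi>) t (\<zero> \<^bold>\<cdot> Null)"
      using 7 n by (intro term_class_eqD star_terms.intros) (simp_all add: term_class_smult[symmetric])
    then have "term_class (t\<^sup>\<star>) = term_class ((\<zero> \<^bold>\<cdot> Null)\<^sup>\<star>)" by (intro term_class_eqI star_eq.cong_star)
    also have "\<dots> = term_class (\<zero> \<^bold>\<cdot> Null\<^sup>\<star>)" using n by (intro term_class_eqI star_eq.star_scale) simp_all
    also have "\<dots> = \<zero>\<^bsub>L\<^esub>" using n by (simp add: term_class_smult[symmetric] star_terms.intros)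
    finally show ?case .
  qed
  then have "a = \<zero>\<^bsub>L\<^esub>" if "a \<in> carrier L" for a using that unfolding carrier_L by blast
  then show False using S.mult_nontrivial L.mult_closed by metis
qed

text \<open>
  The kernel of the representation is an ideal. It is proper, since the projection of a vertex \<open>v\<close>
  does not annihilate the constant function \<open>1\<close> at an infinite path with range \<open>v\<close>.
\<close>

lemma faithful:
  fixes \<tau> :: "'i \<Rightarrow> 'i"
  assumes \<tau>: "bij \<tau>" and ab: "a \<in> carrier L" "b \<in> carrier L"
    and eq: "\<And>\<xi>. \<xi> \<in> K_valued \<Longrightarrow> path_rep \<tau> a \<xi> = path_rep \<tau> b \<xi>"
  shows "a = b"
proof -
  let ?I = "{a \<in> carrier L. \<forall>\<xi>\<in>K_valued. path_rep \<tau> a \<xi> = (\<lambda>x i. \<zero>)}"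
  have "algebra_ideal K L ?I"
    unfolding algebra_ideal_def
    by (intro conjI ballI L.submoduleI)
      (use \<tau> in \<open>auto simp: path_rep_add path_rep_minus path_rep_smult path_rep_mult path_rep_zero path_rep_fn_zero path_rep_closed L.mult_closed\<close>)
  moreover have "?I \<noteq> carrier L"
  proof
    assume I: "?I = carrier L"
    obtain v where v: "v \<in> verts E" using verts_nonempty by auto
    obtain x where x: "x \<in> inf_paths" "inf_range x = v" using ex_infpath[OF v] .
    have "term_class (P_term v \<one>\<^bsub>G\<^esub>) \<in> ?I" unfolding I using v by (simp add: P_term_in)
    then have "\<forall>\<xi>\<in>K_valued. path_rep \<tau> (term_class (P_term v \<one>\<^bsub>G\<^esub>)) \<xi> = (\<lambda>x i. \<zero>)" by simp
    from fun_cong[OF fun_cong[OF bspec[OF this one_fn_closed]], of x undefined]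
    have "path_rep \<tau> (term_class (P_term v \<one>\<^bsub>G\<^esub>)) one_fn x undefined = \<zero>" .
    then show False
      using x v by (simp add: path_rep_term_class[OF \<tau>] P_term_in vertex_op_one one_fn_closed) (simp add: one_fn_def)
  qed
  ultimately have I: "?I = {\<zero>\<^bsub>L\<^esub>}" using S.ideal_trivial by blast
  have "path_rep \<tau> (a \<oplus>\<^bsub>L\<^esub> \<ominus>\<^bsub>L\<^esub> b) \<xi> = (\<lambda>x i. \<zero>)" if "\<xi> \<in> K_valued" for \<xi>
    using ab eq[OF that] that by (simp add: path_rep_add path_rep_minus \<tau> K.r_neg path_rep_val)
  then have "a \<oplus>\<^bsub>L\<^esub> \<ominus>\<^bsub>L\<^esub> b \<in> ?I" using ab by simp
  then have "a \<oplus>\<^bsub>L\<^esub> \<ominus>\<^bsub>L\<^esub> b = \<zero>\<^bsub>L\<^esub>" unfolding I by simp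
  then have "\<ominus>\<^bsub>L\<^esub> (\<ominus>\<^bsub>L\<^esub> b) = a" using ab by (intro L.M.minus_equality) auto
  then show ?thesis using ab by simp
qed

lemma diagonal_unique:
  assumes "diagonal a S" "diagonal b S"
  shows "a = b"
  using diagonalD[OF assms(1)] diagonalD[OF assms(2)]
  by (intro faithful[of "id :: unit \<Rightarrow> unit"]) auto

text \<open>
  On a finite path space only finitely many partial maps of the form \<open>\<alpha>y \<mapsto> y\<close>, for prefixes \<open>\<alpha>\<close> of
  a fixed path \<open>x\<close>, are different. By faithfulness \<open>s\<^sub>\<alpha> = s\<^sub>\<beta>\<close> for two prefixes of different lengths,
  in contradiction to the representation that shifts an integer.
\<close>

lemma infinite_inf_paths: "infinite inf_paths"
proof
  assume fin: "finite inf_paths"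
  obtain v where "v \<in> verts E" using verts_nonempty by auto
  then obtain x where x: "x \<in> inf_paths" using ex_infpath by metis
  define f where "f n = (\<lambda>y\<in>inf_paths. if y \<in> cylinder n x then Some (\<lambda>m. y (m + n)) else None)" for n
  have drop: "(\<lambda>m. y (m + n)) \<in> inf_paths" if "y \<in> inf_paths" for y n
    using that by (simp add: inf_paths_def)
  have "range f \<subseteq> (inf_paths \<rightarrow>\<^sub>E insert None (Some ` inf_paths))"
    using drop by (auto simp: f_def)
  moreover have "finite (inf_paths \<rightarrow>\<^sub>E insert None (Some ` inf_paths))"
    using fin by (intro finite_PiE) auto
  ultimately have "finite (range f)" by (rule finite_subset)
  then have "\<not> inj f" using finite_imageD[of f UNIV] by auto
  then obtain m n where mn: "m \<noteq> n" "f m = f n" by (auto simp: inj_def)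
  have "term_op id (prefix_term m x) False \<xi> = term_op id (prefix_term n x) False (\<xi> :: (nat \<Rightarrow> 'e) \<Rightarrow> unit \<Rightarrow> 'k)" for \<xi>
  proof (intro ext)
    fix y i
    show "term_op id (prefix_term m x) False \<xi> y i = term_op id (prefix_term n x) False \<xi> y i"
    proof (cases "y \<in> inf_paths")
      case True
      then have "(if y \<in> cylinder m x then Some (\<lambda>k. y (k + m)) else None) =
          (if y \<in> cylinder n x then Some (\<lambda>k. y (k + n)) else None)"
        using fun_cong[OF mn(2), of y] by (simp add: f_def)
      then show ?thesis by (auto simp: term_op_prefix_term[OF x] split: if_splits)
    next
      case False
      then show ?thesis by (simp add: term_op_prefix_term[OF x] cylinder_def)
    qed
  qed
  then have "term_class (prefix_term m x) = term_class (prefix_term n x)"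
    using prefix_term_in[OF x] by (intro faithful[of "id :: unit \<Rightarrow> unit"]) (auto simp: path_rep_term_class)
  then have eq: "star_eq K (ep_generators G E) (ep_relations G E \<sigma>\<^sub>0 \<sigma>\<^sub>1 \<phi>) (prefix_term m x) (prefix_term n x)"
    using prefix_term_in[OF x] by (rule term_class_eqD)
  \<comment> \<open>The prefix term of length \<open>k\<close> moves the integer coordinate by \<open>k\<close>, which separates \<open>m\<close> from \<open>n\<close>.\<close>
  define \<tau> :: "int \<Rightarrow> int" where "\<tau> i = i + 1" for i
  have \<tau>: "bij \<tau>" unfolding \<tau>_def by (rule bij_betw_byWitness[of _ "\<lambda>i. i - 1"]) auto
  have pow: "(\<tau> ^^ k) i = i + int k" for k i by (induction k) (auto simp: \<tau>_def)
  define \<xi> :: "(nat \<Rightarrow> 'e) \<Rightarrow> int \<Rightarrow> 'k" where "\<xi> = (\<lambda>y i. if i = int m then \<one> else \<zero>)"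
  have "\<xi> \<in> K_valued" by (simp add: K_valued_def \<xi>_def)
  from term_op_star_eq[OF \<tau> eq this, of False]
  have "term_op \<tau> (prefix_term m x) False \<xi> x 0 = term_op \<tau> (prefix_term n x) False \<xi> x 0" by simp
  moreover have "x \<in> cylinder k x" for k using x by (simp add: cylinder_def)
  ultimately show False using mn(1) by (simp add: term_op_prefix_term[OF x] pow \<xi>_def)
qed

lemma local_unit:
  assumes "a \<in> carrier L"
  shows "\<exists>V. finite V \<and> V \<subseteq> verts E \<and> (\<forall>W. finite W \<and> V \<subseteq> W \<and> W \<subseteq> verts E \<longrightarrow>
    vertex_sum W \<otimes>\<^bsub>L\<^esub> a = a \<and> a \<otimes>\<^bsub>L\<^esub> vertex_sum W = a)"
proof -
  obtain t where t: "t \<in> terms" "a = term_class t" using assms carrier_L by auto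
  obtain V where V: "finite V" "V \<subseteq> verts E" and
    cut: "\<forall>W b. \<forall>\<xi>\<in>K_valued. V \<subseteq> W \<longrightarrow>
       cut W (term_op (id :: unit \<Rightarrow> unit) t b \<xi>) = term_op id t b \<xi> \<and> term_op id t b (cut W \<xi>) = term_op id t b \<xi>"
    using term_op_support[OF t(1), of "id :: unit \<Rightarrow> unit"] by (elim exE conjE)
  have "vertex_sum W \<otimes>\<^bsub>L\<^esub> a = a \<and> a \<otimes>\<^bsub>L\<^esub> vertex_sum W = a" if W: "finite W" "V \<subseteq> W" "W \<subseteq> verts E" for W
  proof -
    have d: "diagonal (vertex_sum W) {x \<in> inf_paths. inf_range x \<in> W}" using W by (intro diagonal_vertex_sum)
    have p: "path_rep id (vertex_sum W) \<xi> = cut W \<xi>" if "\<xi> \<in> K_valued" for \<xi> :: "(nat \<Rightarrow> 'e) \<Rightarrow> unit \<Rightarrow> 'k"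
      using diagonalD(2)[OF d that] by (simp add: cut_def)
    have r: "cut W (path_rep id a \<xi>) = path_rep id a \<xi>" "path_rep id a (cut W \<xi>) = path_rep id a \<xi>" if "\<xi> \<in> K_valued"
      for \<xi> :: "(nat \<Rightarrow> 'e) \<Rightarrow> unit \<Rightarrow> 'k"
      using cut W that cut_closed[OF that, of W] by (simp_all add: t(2) path_rep_term_class[OF _ t(1)])
    note pc = diagonalD(1)[OF d]
    show ?thesis
    proof
      show "vertex_sum W \<otimes>\<^bsub>L\<^esub> a = a"
        by (rule faithful[of "id :: unit \<Rightarrow> unit"])
          (use pc assms p r in \<open>simp_all add: L.mult_closed path_rep_mult path_rep_closed\<close>)
      show "a \<otimes>\<^bsub>L\<^esub> vertex_sum W = a"
        by (rule faithful[of "id :: unit \<Rightarrow> unit"])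
          (use pc assms p r in \<open>simp_all add: L.mult_closed path_rep_mult path_rep_closed\<close>)
    qed
  qed
  then show ?thesis using V by (intro exI[of _ V]) simp
qed

lemma local_unit_finite:
  assumes "finite F" "F \<subseteq> carrier L"
  shows "\<exists>V. finite V \<and> V \<subseteq> verts E \<and> (\<forall>W. finite W \<and> V \<subseteq> W \<and> W \<subseteq> verts E \<longrightarrow>
    (\<forall>a\<in>F. vertex_sum W \<otimes>\<^bsub>L\<^esub> a = a \<and> a \<otimes>\<^bsub>L\<^esub> vertex_sum W = a))"
  using assms
proof (induction F rule: finite_induct)
  case empty
  show ?case by (rule exI[of _ "{}"]) simp
next
  case (insert a F)
  obtain V1 where V1: "finite V1" "V1 \<subseteq> verts E"
    "\<forall>W. finite W \<and> V1 \<subseteq> W \<and> W \<subseteq> verts E \<longrightarrow> vertex_sum W \<otimes>\<^bsub>L\<^esub> a = a \<and> a \<otimes>\<^bsub>L\<^esub> vertex_sum W = a"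
    using local_unit[of a] insert(4) by auto
  obtain V2 where V2: "finite V2" "V2 \<subseteq> verts E"
    "\<forall>W. finite W \<and> V2 \<subseteq> W \<and> W \<subseteq> verts E \<longrightarrow> (\<forall>a\<in>F. vertex_sum W \<otimes>\<^bsub>L\<^esub> a = a \<and> a \<otimes>\<^bsub>L\<^esub> vertex_sum W = a)"
    using insert by auto
  show ?case
    by (rule exI[of _ "V1 \<union> V2"]) (use V1 V2 in simp)
qed


text \<open>
  Three different paths have different prefixes of some common length \<open>n\<close>. Two of the idempotents are
  the cylinder projections of the first two paths; the third one is the rest of a local unit whose
  vertices include the ranges of all three paths, and it is non-zero because of the third path.
\<close>

lemma idempotents:
  assumes F: "finite F" "F \<subseteq> carrier L"
  shows "\<exists>e :: nat \<Rightarrow> _. (\<forall>i<3. e i \<in> carrier L \<and> e i \<noteq> \<zero>\<^bsub>L\<^esub>) \<and>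
      (\<forall>i<3. \<forall>j<3. e i \<otimes>\<^bsub>L\<^esub> e j = (if i = j then e i else \<zero>\<^bsub>L\<^esub>)) \<and>
      (\<forall>x\<in>F. (e 0 \<oplus>\<^bsub>L\<^esub> e 1 \<oplus>\<^bsub>L\<^esub> e 2) \<otimes>\<^bsub>L\<^esub> x = x \<and> x \<otimes>\<^bsub>L\<^esub> (e 0 \<oplus>\<^bsub>L\<^esub> e 1 \<oplus>\<^bsub>L\<^esub> e 2) = x)"
proof -
  obtain V where V: "finite V" "V \<subseteq> verts E"
    "\<forall>W. finite W \<and> V \<subseteq> W \<and> W \<subseteq> verts E \<longrightarrow> (\<forall>a\<in>F. vertex_sum W \<otimes>\<^bsub>L\<^esub> a = a \<and> a \<otimes>\<^bsub>L\<^esub> vertex_sum W = a)"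
    using local_unit_finite[OF F] by (elim exE conjE)
  obtain B where B: "B \<subseteq> inf_paths" "card B = 3"
    using infinite_arbitrarily_large[OF infinite_inf_paths, of 3] by blast
  then obtain x y z where xyz: "B = {x, y, z}" "x \<noteq> y" "x \<noteq> z" "y \<noteq> z" unfolding card_3_iff by blast
  have inf: "x \<in> inf_paths" "y \<in> inf_paths" "z \<in> inf_paths" using B xyz by auto
  have "\<exists>i. x i \<noteq> y i" "\<exists>i. x i \<noteq> z i" "\<exists>i. y i \<noteq> z i"
    using xyz(2-4) by (simp_all add: fun_eq_iff)
  then obtain i j k where ijk: "x i \<noteq> y i" "x j \<noteq> z j" "y k \<noteq> z k" by (elim exE)
  define n where "n = Suc (i + j + k)"
  define W where "W = V \<union> {inf_range x, inf_range y, inf_range z}"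
  have W: "finite W" "V \<subseteq> W" "W \<subseteq> verts E" using V inf rng_in_verts by (auto simp: W_def)
  define S where "S = (\<lambda>i :: nat. if i = 0 then cylinder n x else if i = 1 then cylinder n y
      else {x \<in> inf_paths. inf_range x \<in> W} - (cylinder n x \<union> cylinder n y))"
  define e where "e = (\<lambda>i :: nat. if i = 0 then term_class (cylinder_term n x) else if i = 1 then term_class (cylinder_term n y)
      else vertex_sum W \<oplus>\<^bsub>L\<^esub> \<ominus>\<^bsub>L\<^esub> (term_class (cylinder_term n x) \<oplus>\<^bsub>L\<^esub> term_class (cylinder_term n y)))"
  have lt: "i < n" "j < n" "k < n" by (auto simp: n_def)
  have xy: "cylinder n x \<inter> cylinder n y = {}"
    using ijk(1) lt(1) by (auto simp: cylinder_def)
  have zc: "z \<notin> cylinder n x" "z \<notin> cylinder n y"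
    using ijk(2,3) lt(2,3) by (auto simp: cylinder_def)
  have sub: "cylinder n x \<union> cylinder n y \<subseteq> {x \<in> inf_paths. inf_range x \<in> W}"
    by (auto simp: cylinder_def W_def)
  have dx: "diagonal (term_class (cylinder_term n x)) (cylinder n x)"
    and dy: "diagonal (term_class (cylinder_term n y)) (cylinder n y)"
    using inf by (simp_all add: diagonal_cylinder)
  have "diagonal (e 2) (S 2)"
    using diagonal_diff[OF diagonal_vertex_sum[OF W(1,3)] diagonal_add[OF dx dy xy] sub]
    by (simp add: e_def S_def)
  then have d: "diagonal (e i) (S i)" for i
    using dx dy by (simp add: e_def S_def)
  have ne: "\<exists>w. w \<in> S i" if "i < 3" for i
    using less_3_cases[OF that] inf zc by (auto simp: S_def cylinder_def W_def)
  have disj: "S i \<inter> S j = {}" if "i < 3" "j < 3" "i \<noteq> j" for i j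
    using less_3_cases[OF that(1)] less_3_cases[OF that(2)] that(3) xy by (auto simp: S_def)
  have "diagonal (e 0 \<oplus>\<^bsub>L\<^esub> e 1 \<oplus>\<^bsub>L\<^esub> e 2) (S 0 \<union> S 1 \<union> S 2)"
    using disj[of 0 1] disj[of 0 2] disj[of 1 2] by (intro diagonal_add d) auto
  moreover have "S 0 \<union> S 1 \<union> S 2 = {x \<in> inf_paths. inf_range x \<in> W}" using sub by (auto simp: S_def)
  ultimately have "diagonal (e 0 \<oplus>\<^bsub>L\<^esub> e 1 \<oplus>\<^bsub>L\<^esub> e 2) {x \<in> inf_paths. inf_range x \<in> W}" by simp
  then have sum: "e 0 \<oplus>\<^bsub>L\<^esub> e 1 \<oplus>\<^bsub>L\<^esub> e 2 = vertex_sum W"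
    by (rule diagonal_unique[OF _ diagonal_vertex_sum[OF W(1,3)]])
  show ?thesis
  proof (intro exI[of _ e] conjI allI impI)
    fix i j :: nat assume i: "i < 3" and j: "j < 3"
    show "e i \<in> carrier L" using diagonalD(1)[OF d] .
    show "e i \<noteq> \<zero>\<^bsub>L\<^esub>" using ne[OF i] diagonal_nonzero[OF d] by blast
    have m: "diagonal (e i \<otimes>\<^bsub>L\<^esub> e j) (S i \<inter> S j)" by (intro diagonal_mult d)
    show "e i \<otimes>\<^bsub>L\<^esub> e j = (if i = j then e i else \<zero>\<^bsub>L\<^esub>)"
    proof (cases "i = j")
      case True
      then show ?thesis using diagonal_unique[OF _ d, of "e i \<otimes>\<^bsub>L\<^esub> e j" i] m by simp
    next
      case False
      then show ?thesis using diagonal_unique[OF m] disj[OF i j False] diagonal_zero by simp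
    qed
  next
    show "\<forall>x\<in>F. (e 0 \<oplus>\<^bsub>L\<^esub> e 1 \<oplus>\<^bsub>L\<^esub> e 2) \<otimes>\<^bsub>L\<^esub> x = x \<and> x \<otimes>\<^bsub>L\<^esub> (e 0 \<oplus>\<^bsub>L\<^esub> e 1 \<oplus>\<^bsub>L\<^esub> e 2) = x"
      unfolding sum using V(3) W by blast
  qed
qed

sublocale I: algebra_many_idempotents K L
  by unfold_locales (rule idempotents)

text \<open>
  If \<open>w\<close> vanishes at \<open>x\<close>, then so does \<open>awb = w(ab)\<close>. Hence the elements \<open>y\<close> for which all \<open>ayb\<close> vanish
  at \<open>x\<close> form an ideal that contains \<open>w\<close>, but not the projection of the range of \<open>x\<close>.
\<close>

lemma central_zero:
  assumes w: "w \<in> carrier L" and central: "\<And>a. a \<in> carrier L \<Longrightarrow> a \<otimes>\<^bsub>L\<^esub> w = w \<otimes>\<^bsub>L\<^esub> a"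
    and x: "x \<in> inf_paths" and van: "\<And>\<xi> :: (nat \<Rightarrow> 'e) \<Rightarrow> unit \<Rightarrow> 'k. \<xi> \<in> K_valued \<Longrightarrow> path_rep id w \<xi> x () = \<zero>"
  shows "w = \<zero>\<^bsub>L\<^esub>"
proof (rule ccontr)
  assume nz: "w \<noteq> \<zero>\<^bsub>L\<^esub>"
  let ?I = "{y \<in> carrier L. \<forall>a\<in>carrier L. \<forall>b\<in>carrier L. \<forall>\<xi> :: (nat \<Rightarrow> 'e) \<Rightarrow> unit \<Rightarrow> 'k.
    \<xi> \<in> K_valued \<longrightarrow> path_rep id (a \<otimes>\<^bsub>L\<^esub> y \<otimes>\<^bsub>L\<^esub> b) \<xi> x () = \<zero>}"
  have "algebra_ideal K L ?I"
    unfolding algebra_ideal_def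
  proof (intro conjI ballI L.submoduleI)
    fix c y assume c: "c \<in> carrier K" and y: "y \<in> ?I"
    have "a \<otimes>\<^bsub>L\<^esub> (c \<odot>\<^bsub>L\<^esub> y) \<otimes>\<^bsub>L\<^esub> b = (c \<odot>\<^bsub>L\<^esub> a) \<otimes>\<^bsub>L\<^esub> y \<otimes>\<^bsub>L\<^esub> b" if "a \<in> carrier L" "b \<in> carrier L" for a b
      using that c y by (simp add: L.smult_mult_l L.smult_mult_r)
    then show "c \<odot>\<^bsub>L\<^esub> y \<in> ?I" using c y by simp
  next
    fix a y assume a: "a \<in> carrier L" and y: "y \<in> ?I"
    have "b \<otimes>\<^bsub>L\<^esub> (a \<otimes>\<^bsub>L\<^esub> y) \<otimes>\<^bsub>L\<^esub> c = (b \<otimes>\<^bsub>L\<^esub> a) \<otimes>\<^bsub>L\<^esub> y \<otimes>\<^bsub>L\<^esub> c"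
      "b \<otimes>\<^bsub>L\<^esub> (y \<otimes>\<^bsub>L\<^esub> a) \<otimes>\<^bsub>L\<^esub> c = b \<otimes>\<^bsub>L\<^esub> y \<otimes>\<^bsub>L\<^esub> (a \<otimes>\<^bsub>L\<^esub> c)"
      if "b \<in> carrier L" "c \<in> carrier L" for b c
      using that a y by (simp_all add: L.mult_assoc L.mult_closed)
    then show "a \<otimes>\<^bsub>L\<^esub> y \<in> ?I" "y \<otimes>\<^bsub>L\<^esub> a \<in> ?I" using a y by (simp_all add: L.mult_closed)
  qed (auto simp: L.mult_simps path_rep_add path_rep_minus path_rep_zero)
  moreover have "w \<in> ?I"
  proof -
    have "a \<otimes>\<^bsub>L\<^esub> w \<otimes>\<^bsub>L\<^esub> b = w \<otimes>\<^bsub>L\<^esub> (a \<otimes>\<^bsub>L\<^esub> b)" if "a \<in> carrier L" "b \<in> carrier L" for a b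
      using that w by (simp add: central L.mult_assoc)
    then show ?thesis using w van by (auto simp: path_rep_mult path_rep_closed L.mult_closed)
  qed
  ultimately have I: "?I = carrier L" using S.ideal_trivial[of ?I] nz by blast
  let ?p = "term_class (P_term (inf_range x) \<one>\<^bsub>G\<^esub>)"
  have d: "diagonal ?p {y \<in> inf_paths. inf_range y = inf_range x}" using x by (intro diagonal_vertex rng_in_verts)
  have "diagonal (?p \<otimes>\<^bsub>L\<^esub> ?p \<otimes>\<^bsub>L\<^esub> ?p) {y \<in> inf_paths. inf_range y = inf_range x}"
    using diagonal_mult[OF diagonal_mult[OF d d] d] by simp
  then have "path_rep id (?p \<otimes>\<^bsub>L\<^esub> ?p \<otimes>\<^bsub>L\<^esub> ?p) one_fn x () = \<one>"
    using x by (simp add: diagonalD(2)[OF _ one_fn_closed]) (simp add: one_fn_def)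
  moreover have "?p \<in> ?I" unfolding I using diagonalD(1)[OF d] .
  ultimately show False using diagonalD(1)[OF d] one_fn_closed by fastforce
qed

text \<open>
  The value of \<open>z\<xi>\<close> at \<open>x\<close> depends on finitely many values of \<open>\<xi>\<close>. Some cylinder around \<open>x\<close> contains none
  of these points other than \<open>x\<close>, and since \<open>z\<close> commutes with its projection, \<open>\<xi>\<close> may be cut down to
  it. So only the value of \<open>\<xi>\<close> at \<open>x\<close> is left.
\<close>

lemma central_scalar:
  assumes z: "z \<in> carrier L" and central: "\<And>a. a \<in> carrier L \<Longrightarrow> a \<otimes>\<^bsub>L\<^esub> z = z \<otimes>\<^bsub>L\<^esub> a"
    and x: "x \<in> inf_paths"
  shows "\<exists>c\<in>carrier K. \<forall>\<xi> :: (nat \<Rightarrow> 'e) \<Rightarrow> unit \<Rightarrow> 'k. \<xi> \<in> K_valued \<longrightarrow> path_rep id z \<xi> x () = \<xi> x () \<otimes> c"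
proof -
  obtain t where t: "t \<in> terms" "z = term_class t" using z carrier_L by auto
  obtain D :: "((nat \<Rightarrow> 'e) \<times> unit) set" where D: "finite D"
    "\<forall>\<xi>\<in>K_valued. \<forall>\<eta>\<in>K_valued. (\<forall>(y, j)\<in>D. \<xi> y j = \<eta> y j) \<longrightarrow> term_op id t False \<xi> x () = term_op id t False \<eta> x ()"
    using term_op_local[OF t(1), of "id :: unit \<Rightarrow> unit" False x "()"] by (elim exE conjE)
  have dep: "path_rep id z \<xi> x () = path_rep id z \<eta> x ()" if "\<xi> \<in> K_valued" "\<eta> \<in> K_valued" "\<forall>(y, j)\<in>D. \<xi> y j = \<eta> y j" for \<xi> \<eta>
    unfolding t(2) path_rep_term_class[OF bij_id t(1) that(1)] path_rep_term_class[OF bij_id t(1) that(2)]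
    by (rule D(2)[THEN bspec, THEN bspec, THEN mp, OF that])
  have "\<exists>n. \<forall>(y, j)\<in>D. y \<in> cylinder n x \<longrightarrow> y = x"
    using D(1)
  proof (induction D rule: finite_induct)
    case (insert d D)
    then obtain n where n: "\<forall>(y, j)\<in>D. y \<in> cylinder n x \<longrightarrow> y = x" by blast
    obtain y j where d: "d = (y, j)" by (cases d)
    have "\<exists>m. y \<in> cylinder m x \<longrightarrow> y = x"
    proof (cases "y = x")
      case False
      then obtain m where "y m \<noteq> x m" by auto
      then have "y \<notin> cylinder (Suc m) x" by (auto simp: cylinder_def)
      then show ?thesis by blast
    qed simp
    then obtain m where m: "y \<in> cylinder m x \<longrightarrow> y = x" by blast
    have "cylinder (m + n) x \<subseteq> cylinder m x \<inter> cylinder n x" by (auto simp: cylinder_def)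
    then show ?case using n m d by (intro exI[of _ "m + n"]) auto
  qed simp
  then obtain n where n: "\<forall>(y, j)\<in>D. y \<in> cylinder n x \<longrightarrow> y = x" by blast
  let ?q = "term_class (cylinder_term n x)"
  have d: "diagonal ?q (cylinder n x)" by (rule diagonal_cylinder[OF x])
  have xc: "x \<in> cylinder n x" using x by (simp add: cylinder_def)
  note qc = diagonalD(1)[OF d]
  have comm: "path_rep id z \<xi> x () = path_rep id z (\<lambda>y i. if y \<in> cylinder n x then \<xi> y i else \<zero>) x ()"
    if \<xi>: "\<xi> \<in> K_valued" for \<xi> :: "(nat \<Rightarrow> 'e) \<Rightarrow> unit \<Rightarrow> 'k"
  proof -
    have "path_rep id z \<xi> x () = path_rep id ?q (path_rep id z \<xi>) x ()"
      using xc by (simp add: diagonalD(2)[OF d path_rep_closed[OF bij_id z \<xi>]])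
    also have "\<dots> = path_rep id (z \<otimes>\<^bsub>L\<^esub> ?q) \<xi> x ()"
      using central[OF qc] by (simp add: path_rep_mult[OF bij_id qc z \<xi>, symmetric])
    finally show ?thesis by (simp add: path_rep_mult[OF bij_id z qc \<xi>] diagonalD(2)[OF d \<xi>])
  qed
  let ?c = "path_rep id z (one_fn :: (nat \<Rightarrow> 'e) \<Rightarrow> unit \<Rightarrow> 'k) x ()"
  have c: "?c \<in> carrier K" by (rule path_rep_val[OF bij_id z one_fn_closed])
  have "path_rep id z \<xi> x () = \<xi> x () \<otimes> ?c" if \<xi>: "\<xi> \<in> K_valued" for \<xi> :: "(nat \<Rightarrow> 'e) \<Rightarrow> unit \<Rightarrow> 'k"
  proof -
    let ?r = "\<lambda>\<zeta> :: (nat \<Rightarrow> 'e) \<Rightarrow> unit \<Rightarrow> 'k. \<lambda>y i. if y \<in> cylinder n x then \<zeta> y i else \<zero>"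
    have r1: "?r one_fn \<in> K_valued" by (rule restrict_closed[OF one_fn_closed])
    have sc: "(\<lambda>y i. \<xi> x () \<otimes> ?r one_fn y i) \<in> K_valued"
      using K_valuedD[OF \<xi>] K_valuedD[OF r1] by (simp add: K_valued_def)
    have "path_rep id z \<xi> x () = path_rep id z (?r \<xi>) x ()" by (rule comm[OF \<xi>])
    also have "\<dots> = path_rep id z (\<lambda>y i. \<xi> x () \<otimes> ?r one_fn y i) x ()"
    proof (rule dep[OF restrict_closed[OF \<xi>] sc])
      show "\<forall>(y, j)\<in>D. ?r \<xi> y j = \<xi> x () \<otimes> ?r one_fn y j"
        using n K_valuedD[OF \<xi>] by (auto simp: one_fn_def)
    qed
    also have "\<dots> = \<xi> x () \<otimes> path_rep id z (?r one_fn) x ()"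
      using path_rep_scale[OF bij_id z K_valuedD[OF \<xi>] r1] by simp
    also have "path_rep id z (?r one_fn) x () = ?c" by (rule comm[OF one_fn_closed, symmetric])
    finally show ?thesis .
  qed
  then show ?thesis using c by blast
qed

text \<open>
  Some vertex lies outside the finite support of \<open>z\<close>, and \<open>z\<close> vanishes at all paths with that range.
\<close>

lemma central_infinite:
  assumes "infinite (verts E)" and z: "z \<in> carrier L" and central: "\<And>a. a \<in> carrier L \<Longrightarrow> a \<otimes>\<^bsub>L\<^esub> z = z \<otimes>\<^bsub>L\<^esub> a"
  shows "z = \<zero>\<^bsub>L\<^esub>"
proof -
  obtain V where V12: "finite V" "V \<subseteq> verts E" and all: "\<forall>W. finite W \<and> V \<subseteq> W \<and> W \<subseteq> verts E \<longrightarrow>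
      vertex_sum W \<otimes>\<^bsub>L\<^esub> z = z \<and> z \<otimes>\<^bsub>L\<^esub> vertex_sum W = z"
    using local_unit[OF z] by (elim exE conjE)
  have V: "finite V" "V \<subseteq> verts E" "vertex_sum V \<otimes>\<^bsub>L\<^esub> z = z" using V12 all[THEN spec, of V] by simp_all
  have "\<not> verts E \<subseteq> V" using assms(1) finite_subset[OF _ V(1)] by blast
  then obtain v where v: "v \<in> verts E" "v \<notin> V" by blast
  obtain x where x: "x \<in> inf_paths" "inf_range x = v" using ex_infpath[OF v(1)] .
  have d: "diagonal (vertex_sum V) {x \<in> inf_paths. inf_range x \<in> V}" by (rule diagonal_vertex_sum[OF V(1,2)])
  have van: "path_rep id z \<xi> x () = \<zero>" if \<xi>: "\<xi> \<in> K_valued" for \<xi> :: "(nat \<Rightarrow> 'e) \<Rightarrow> unit \<Rightarrow> 'k"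
  proof -
    have "path_rep id z \<xi> x () = path_rep id (vertex_sum V) (path_rep id z \<xi>) x ()"
      using V(3) path_rep_mult[OF bij_id diagonalD(1)[OF d] z \<xi>] by simp
    then show ?thesis using v x by (simp add: diagonalD(2)[OF d path_rep_closed[OF bij_id z \<xi>]])
  qed
  show ?thesis by (rule central_zero[OF z _ x(1)]) (erule central, erule van)
qed

lemma one_is_unit:
  assumes "finite (verts E)"
  shows "\<one>\<^bsub>L\<^esub> \<in> carrier L" "\<one>\<^bsub>L\<^esub> \<noteq> \<zero>\<^bsub>L\<^esub>" "a \<in> carrier L \<Longrightarrow> a \<otimes>\<^bsub>L\<^esub> \<one>\<^bsub>L\<^esub> = a \<and> \<one>\<^bsub>L\<^esub> \<otimes>\<^bsub>L\<^esub> a = a"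
proof -
  have one: "\<one>\<^bsub>L\<^esub> = vertex_sum (verts E)" by (simp add: one_L vertex_sum_def)
  have d: "diagonal \<one>\<^bsub>L\<^esub> {x \<in> inf_paths. inf_range x \<in> verts E}"
    unfolding one using assms by (intro diagonal_vertex_sum) auto
  then show "\<one>\<^bsub>L\<^esub> \<in> carrier L" by (rule diagonalD(1))
  obtain v where "v \<in> verts E" using verts_nonempty by auto
  then obtain x where "x \<in> inf_paths" "inf_range x \<in> verts E" by (metis ex_infpath)
  then show "\<one>\<^bsub>L\<^esub> \<noteq> \<zero>\<^bsub>L\<^esub>" by (intro diagonal_nonzero[OF d, of x]) simp
  show "a \<otimes>\<^bsub>L\<^esub> \<one>\<^bsub>L\<^esub> = a \<and> \<one>\<^bsub>L\<^esub> \<otimes>\<^bsub>L\<^esub> a = a" if a: "a \<in> carrier L"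
  proof -
    obtain V where V: "V \<subseteq> verts E" and all: "\<forall>W. finite W \<and> V \<subseteq> W \<and> W \<subseteq> verts E \<longrightarrow>
        vertex_sum W \<otimes>\<^bsub>L\<^esub> a = a \<and> a \<otimes>\<^bsub>L\<^esub> vertex_sum W = a"
      using local_unit[OF a] by (elim exE conjE)
    show ?thesis using assms V all[THEN spec, of "verts E"] by (simp add: one)
  qed
qed

text \<open>
  The scalar \<open>c\<close> of \<open>z\<close> at one path is the right one: \<open>z - c 1\<close> is central and vanishes at that path.
\<close>

lemma central_finite:
  assumes fin: "finite (verts E)" and z: "z \<in> carrier L" and central: "\<And>a. a \<in> carrier L \<Longrightarrow> a \<otimes>\<^bsub>L\<^esub> z = z \<otimes>\<^bsub>L\<^esub> a"
  shows "\<exists>c\<in>carrier K. z = c \<odot>\<^bsub>L\<^esub> \<one>\<^bsub>L\<^esub>"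
proof -
  obtain v where "v \<in> verts E" using verts_nonempty by auto
  then obtain x where x: "x \<in> inf_paths" using ex_infpath by metis
  obtain c where c: "c \<in> carrier K"
    "\<forall>\<xi> :: (nat \<Rightarrow> 'e) \<Rightarrow> unit \<Rightarrow> 'k. \<xi> \<in> K_valued \<longrightarrow> path_rep id z \<xi> x () = \<xi> x () \<otimes> c"
    by (rule bexE[OF central_scalar[OF z _ x]]) (erule central)
  note u = one_is_unit[OF fin]
  have one: "\<one>\<^bsub>L\<^esub> = vertex_sum (verts E)" by (simp add: one_L vertex_sum_def)
  have d: "diagonal \<one>\<^bsub>L\<^esub> {x \<in> inf_paths. inf_range x \<in> verts E}"
    unfolding one using fin by (intro diagonal_vertex_sum) auto
  let ?w = "z \<oplus>\<^bsub>L\<^esub> (\<ominus> c) \<odot>\<^bsub>L\<^esub> \<one>\<^bsub>L\<^esub>"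
  have "?w = \<zero>\<^bsub>L\<^esub>"
  proof (rule central_zero[OF _ _ x])
    show "?w \<in> carrier L" using z c u by simp
    show "a \<otimes>\<^bsub>L\<^esub> ?w = ?w \<otimes>\<^bsub>L\<^esub> a" if "a \<in> carrier L" for a
      using that z c u(1) u(3)[OF that] central[OF that]
      by (simp add: L.mult_r_distr L.mult_l_distr L.smult_mult_l L.smult_mult_r)
    fix \<xi> :: "(nat \<Rightarrow> 'e) \<Rightarrow> unit \<Rightarrow> 'k" assume \<xi>: "\<xi> \<in> K_valued"
    have "path_rep id ?w \<xi> x () = \<xi> x () \<otimes> c \<oplus> (\<ominus> c) \<otimes> \<xi> x ()"
      using c z u(1) x \<xi> rng_in_verts[OF x] by (simp add: path_rep_add path_rep_smult diagonalD(2)[OF d \<xi>])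
    also have "\<dots> = \<zero>" using c K_valuedD[OF \<xi>] by (simp add: K.l_minus K.m_comm K.r_neg)
    finally show "path_rep id ?w \<xi> x () = \<zero>" .
  qed
  then have "\<ominus>\<^bsub>L\<^esub> ((\<ominus> c) \<odot>\<^bsub>L\<^esub> \<one>\<^bsub>L\<^esub>) = z" using z c u(1) by (intro L.M.minus_equality) auto
  then have "z = c \<odot>\<^bsub>L\<^esub> \<one>\<^bsub>L\<^esub>" using c u(1) by (simp add: L.smult_l_minus)
  then show ?thesis using c by blast
qed

section \<open>Simplicity of the commutator algebra\<close>

theorem simple_lie_infinite:
  assumes "infinite (verts E)"
  shows "simple_lie_algebra K (L\<lparr>carrier := commutator_space K L\<rparr>) (commutator L)"
proof (rule I.simple_lie_commutator_space)
  fix z assume "z \<in> commutator_space K L" "\<And>a. a \<in> carrier L \<Longrightarrow> a \<otimes>\<^bsub>L\<^esub> z = z \<otimes>\<^bsub>L\<^esub> a"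
  then show "z = \<zero>\<^bsub>L\<^esub>" by (intro central_infinite[OF assms] subsetD[OF L.commutator_space_subset])
qed

theorem simple_lie_finite:
  assumes fin: "finite (verts E)"
  shows "simple_lie_algebra K (L\<lparr>carrier := commutator_space K L\<rparr>) (commutator L) \<longleftrightarrow>
    \<one>\<^bsub>L\<^esub> \<notin> commutator_space K L"
proof
  assume "simple_lie_algebra K (L\<lparr>carrier := commutator_space K L\<rparr>) (commutator L)"
  then show "\<one>\<^bsub>L\<^esub> \<notin> commutator_space K L"
    by (rule L.simple_lie_imp_unit_notin_commutator_space) (rule one_is_unit[OF fin])+
next
  assume n: "\<one>\<^bsub>L\<^esub> \<notin> commutator_space K L"
  show "simple_lie_algebra K (L\<lparr>carrier := commutator_space K L\<rparr>) (commutator L)"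
  proof (rule I.simple_lie_commutator_space)
    fix z assume z: "z \<in> commutator_space K L" and central: "\<And>a. a \<in> carrier L \<Longrightarrow> a \<otimes>\<^bsub>L\<^esub> z = z \<otimes>\<^bsub>L\<^esub> a"
    obtain c where c: "c \<in> carrier K" "z = c \<odot>\<^bsub>L\<^esub> \<one>\<^bsub>L\<^esub>"
      by (rule bexE[OF central_finite[OF fin subsetD[OF L.commutator_space_subset z]]]) (erule central)
    show "z = \<zero>\<^bsub>L\<^esub>"
    proof (cases "c = \<zero>")
      case True
      then show ?thesis using c one_is_unit(1)[OF fin] by simp
    next
      case False
      then have i: "inv c \<in> carrier K" "inv c \<otimes> c = \<one>" using c K.field_Units by auto
      have "inv c \<odot>\<^bsub>L\<^esub> z = \<one>\<^bsub>L\<^esub>"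
        using c i one_is_unit(1)[OF fin] by (simp add: L.smult_assoc1[symmetric])
      moreover have "inv c \<odot>\<^bsub>L\<^esub> z \<in> commutator_space K L"
        using L.submoduleE(4)[OF L.commutator_space_submodule i(1) z] .
      ultimately show ?thesis using n by simp
    qed
  qed
qed

end

theorem theorem5p7:
  fixes K :: "('k, 'm) ring_scheme"
    and G :: "('g, 'n) monoid_scheme"
    and E :: "('v, 'e) pre_digraph"
    and \<sigma>\<^sub>0 :: "'g \<Rightarrow> 'v \<Rightarrow> 'v"
    and \<sigma>\<^sub>1 :: "'g \<Rightarrow> 'e \<Rightarrow> 'e"
    and \<phi> :: "'g \<Rightarrow> 'e \<Rightarrow> 'g"
  assumes "field K"
    and "group G" and "countable (carrier G)"
    and "wf_digraph E" and "row_finite E" and "no_sources E"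
    and "graph_action G E \<sigma>\<^sub>0 \<sigma>\<^sub>1"
    and "one_cocycle G (arcs E) \<sigma>\<^sub>1 \<phi>"
    and "\<forall>g\<in>carrier G. \<forall>e\<in>arcs E. \<forall>v\<in>verts E. \<sigma>\<^sub>0 (\<phi> g e) v = \<sigma>\<^sub>0 g v"
    and "\<forall>g\<in>carrier G. \<forall>v\<in>verts E.
           finite {\<alpha>. is_path E \<alpha> \<and> path_range E \<alpha> = v \<and>
                      minimal_strongly_fixed G E \<sigma>\<^sub>0 \<sigma>\<^sub>1 \<phi> g \<alpha>}"
  shows "let L = exel_pardo_algebra K G E \<sigma>\<^sub>0 \<sigma>\<^sub>1 \<phi>;
             LL = commutator_space K L
         in (infinite (verts E) \<and> simple_algebra K L \<longrightarrow>
               simple_lie_algebra K (L\<lparr>carrier := LL\<rparr>) (commutator L)) \<and>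
            (finite (verts E) \<and> simple_algebra K L \<and>
               \<not> algebra_isomorphic K L (self_algebra K) \<longrightarrow>
               (simple_lie_algebra K (L\<lparr>carrier := LL\<rparr>) (commutator L) \<longleftrightarrow> \<one>\<^bsub>L\<^esub> \<notin> LL))"
proof -
  let ?L = "exel_pardo_algebra K G E \<sigma>\<^sub>0 \<sigma>\<^sub>1 \<phi>"
  have graph: "self_similar_graph K G E \<sigma>\<^sub>0 \<sigma>\<^sub>1 \<phi>"
    using assms by (intro self_similar_graph.intro self_similar_graph_axioms.intro) simp_all
  have lie: "(infinite (verts E) \<longrightarrow> simple_lie_algebra K (?L\<lparr>carrier := commutator_space K ?L\<rparr>) (commutator ?L)) \<and>
      (finite (verts E) \<longrightarrow> (simple_lie_algebra K (?L\<lparr>carrier := commutator_space K ?L\<rparr>) (commutator ?L)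
        \<longleftrightarrow> \<one>\<^bsub>?L\<^esub> \<notin> commutator_space K ?L))"
    if "simple_algebra K ?L"
  proof -
    interpret simple_self_similar_graph K G E \<sigma>\<^sub>0 \<sigma>\<^sub>1 \<phi>
      using graph that by (intro simple_self_similar_graph.intro simple_self_similar_graph_axioms.intro)
    show ?thesis using simple_lie_infinite simple_lie_finite by blast
  qed
  then show ?thesis unfolding Let_def by blast
qed

end
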